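(* For a real hypersurface $M$ in $CP^n$ ($n>2$, constant holomorphic sectional curvature $4$), the following conditions are equivalent: (a) there is a real constant $k$ such that $(\nabla_XR_{\xi})Y=k\big(\langle\phi X,Y\rangle\xi+\eta(Y)\phi X\big)$ for all $X,Y\in\Gamma(TM)$; (b) there is a real constant $k$ such that $\langle(\nabla_XR_{\xi})Y-(\nabla_YR_{\xi})X,W\rangle=k\big(2\eta(W)\langle\phi X,Y\rangle+\eta(Y)\langle\phi X,W\rangle-\eta(X)\langle\phi Y,W\rangle\big)$ for all $X,Y,W\in\Gamma(TM)$; (c) $M$ is totally $\eta$-umbilical.
   Context: $CP^n$ is the complex projective space of complex dimension $n>2$ with complex structure $J$ and constant holomorphic sectional curvature $4$; everything is $C^\infty$. A real hypersurface $M$ in $CP^n$ is a connected hypersurface of real codimension one, without boundary; only local properties are studied, so $M$ is not distinguished from its open subsets. $N$ is a (locally defined) unit normal field, $\langle\,,\rangle$ the induced metric, $\nabla$ its Levi-Civita connection, $A$ the shape operator ($AX=-\bar\nabla_XN$ with $\bar\nabla$ the ambient Levi-Civita connection). Define $\phi,\xi,\eta$ on $M$ by $JX=\phi X+\eta(X)N$, $JN=-\xi$, $\eta(X)=\langle X,\xi\rangle$ for $X\in\Gamma(TM)$. $D$ is the distribution of vectors orthogonal to $\xi$. The curvature tensor of $M$ is $R(X,Y)Z=\nabla_X\nabla_YZ-\nabla_Y\nabla_XZ-\nabla_{[X,Y]}Z$, and the structure Jacobi operator is $R_\xi(Y)=R(Y,\xi)\xi$. $M$ is totally $\eta$-umbilical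 if there is a function $\lambda$ with $AX=\lambda X$ for all $X\in\Gamma(D)$ (it is known that $\lambda$ is then constant). *)

theory Defs
  imports "HOL-Analysis.Analysis"
begin

section \<open>Smooth maps and submanifolds of Euclidean spaces\<close>

text \<open>The following is meant for an open set \<open>S\<close>; in finite dimension it is \<open>C\<^sup>k\<close>.\<close>

primrec Ck_on :: "nat \<Rightarrow> 'a::euclidean_space set \<Rightarrow> ('a \<Rightarrow> 'b::euclidean_space) \<Rightarrow> bool" where
  "Ck_on 0 S f \<longleftrightarrow> continuous_on S f"
| "Ck_on (Suc k) S f \<longleftrightarrow> (\<forall>x\<in>S. f differentiable (at x)) \<and>
     (\<forall>v. Ck_on k S (\<lambda>x. frechet_derivative f (at x) v))"

definition smooth_on_open :: "'a::euclidean_space set \<Rightarrow> ('a \<Rightarrow> 'b::euclidean_space) \<Rightarrow> bool" where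
  "smooth_on_open S f \<longleftrightarrow> open S \<and> (\<forall>k. Ck_on k S f)"

text \<open>Submanifolds without boundary, by slice charts.\<close>

definition submanifold :: "nat \<Rightarrow> 'a::euclidean_space set \<Rightarrow> bool" where
  "submanifold d S \<longleftrightarrow>
     (\<forall>p\<in>S. \<exists>(U::'a set) (V::'a set) f g L.
        p \<in> U \<and> smooth_on_open U f \<and> smooth_on_open V g \<and> homeomorphism U V f g \<and>
        subspace L \<and> dim L = d \<and> f ` (S \<inter> U) = L \<inter> V)"

definition smooth_map :: "'a::euclidean_space set \<Rightarrow> ('a \<Rightarrow> 'b::euclidean_space) \<Rightarrow> bool" where
  "smooth_map S f \<longleftrightarrow>
     (\<forall>p\<in>S. \<exists>W g. p \<in> W \<and> smooth_on_open W g \<and> (\<forall>q\<in>S \<inter> W. g q = f q))"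

definition tangent :: "'a::euclidean_space set \<Rightarrow> 'a \<Rightarrow> 'a set" where
  "tangent S p = {v. \<exists>c e. 0 < (e::real) \<and> smooth_on_open {-e<..<e} c \<and> c ` {-e<..<e} \<subseteq> S \<and>
     c 0 = p \<and> (c has_vector_derivative v) (at 0)}"

text \<open>A vector field on \<open>S\<close> (an element of \<open>\<Gamma>(TS)\<close>) is represented by a map on the surrounding
  vector space, of which only the values on \<open>S\<close> matter.\<close>

definition vfield :: "'a::euclidean_space set \<Rightarrow> ('a \<Rightarrow> 'a) \<Rightarrow> bool" where
  "vfield S X \<longleftrightarrow> smooth_map S X \<and> (\<forall>p\<in>S. X p \<in> tangent S p)"

text \<open>The derivative of \<open>f\<close> at \<open>p \<in> S\<close> in the direction \<open>v \<in> tangent S p\<close>.  It depends only on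
  the values of \<open>f\<close> on \<open>S\<close>.  The derivative within \<open>S\<close> is not unique as a linear map, but its
  value at a tangent vector is.\<close>

definition dir_deriv :: "'a::euclidean_space set \<Rightarrow> ('a \<Rightarrow> 'b::euclidean_space) \<Rightarrow> 'a \<Rightarrow> 'a \<Rightarrow> 'b" where
  "dir_deriv S f p v = (THE w. \<exists>f'. (f has_derivative f') (at p within S) \<and> w = f' v)"

text \<open>The Lie bracket, in the linear coordinates of the surrounding space:
  \<open>[X,Y] = dY(X) - dX(Y)\<close>.\<close>

definition lie :: "'a::euclidean_space set \<Rightarrow> ('a \<Rightarrow> 'a) \<Rightarrow> ('a \<Rightarrow> 'a) \<Rightarrow> 'a \<Rightarrow> 'a" where
  "lie S X Y = (\<lambda>p. dir_deriv S Y p (X p) - dir_deriv S X p (Y p))"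

section \<open>The Levi-Civita connection\<close>

definition affine_connection ::
  "'a::euclidean_space set \<Rightarrow> (('a \<Rightarrow> 'a) \<Rightarrow> ('a \<Rightarrow> 'a) \<Rightarrow> 'a \<Rightarrow> 'a) \<Rightarrow> bool" where
  "affine_connection S nab \<longleftrightarrow>
     (\<forall>X Y. vfield S X \<longrightarrow> vfield S Y \<longrightarrow> vfield S (nab X Y)) \<and>
     (\<forall>X X' Y. vfield S X \<longrightarrow> vfield S X' \<longrightarrow> vfield S Y \<longrightarrow>
        (\<forall>p\<in>S. nab (\<lambda>q. X q + X' q) Y p = nab X Y p + nab X' Y p)) \<and>
     (\<forall>(f::'a \<Rightarrow> real) X Y. smooth_map S f \<longrightarrow> vfield S X \<longrightarrow> vfield S Y \<longrightarrow>
        (\<forall>p\<in>S. nab (\<lambda>q. f q *\<^sub>R X q) Y p = f p *\<^sub>R nab X Y p)) \<and>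
     (\<forall>X Y Y'. vfield S X \<longrightarrow> vfield S Y \<longrightarrow> vfield S Y' \<longrightarrow>
        (\<forall>p\<in>S. nab X (\<lambda>q. Y q + Y' q) p = nab X Y p + nab X Y' p)) \<and>
     (\<forall>(f::'a \<Rightarrow> real) X Y. smooth_map S f \<longrightarrow> vfield S X \<longrightarrow> vfield S Y \<longrightarrow>
        (\<forall>p\<in>S. nab X (\<lambda>q. f q *\<^sub>R Y q) p =
                 f p *\<^sub>R nab X Y p + dir_deriv S f p (X p) *\<^sub>R Y p))"

text \<open>The metric \<open>g\<close> is the restriction to \<open>S\<close> of a fixed bilinear form on the surrounding
  vector space.\<close>

definition levi_civita ::
  "'a::euclidean_space set \<Rightarrow> ('a \<Rightarrow> 'a \<Rightarrow> real) \<Rightarrow> (('a \<Rightarrow> 'a) \<Rightarrow> ('a \<Rightarrow> 'a) \<Rightarrow> 'a \<Rightarrow> 'a) \<Rightarrow> bool" where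
  "levi_civita S g nab \<longleftrightarrow> affine_connection S nab \<and>
     (\<forall>X Y. vfield S X \<longrightarrow> vfield S Y \<longrightarrow>
        (\<forall>p\<in>S. nab X Y p - nab Y X p = lie S X Y p)) \<and>
     (\<forall>X Y Z. vfield S X \<longrightarrow> vfield S Y \<longrightarrow> vfield S Z \<longrightarrow>
        (\<forall>p\<in>S. dir_deriv S (\<lambda>q. g (Y q) (Z q)) p (X p) =
                 g (nab X Y p) (Z p) + g (Y p) (nab X Z p)))"

section \<open>Complex projective space\<close>

text \<open>
  With \<open>CARD('m) = n + 1\<close>, the point of \<open>CP\<^sup>n\<close> given by the complex line spanned by a unit vector
  \<open>z\<close> is represented by the orthogonal projector \<open>z z\<^sup>*\<close> onto that line.  This makes \<open>CP\<^sup>n\<close> a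
  submanifold of the space of complex matrices.

  By \<open>fs_dhproj\<close> below, half of the Euclidean inner product of matrices (that is,
  \<open>Re (tr (X Y)) / 2\<close> for Hermitian \<open>X\<close>, \<open>Y\<close>) restricts to the metric which makes the Hopf map
  \<open>z \<mapsto> z z\<^sup>*\<close> from the unit sphere a Riemannian submersion: the Fubini-Study metric of constant
  holomorphic sectional curvature 4.  By \<open>cpJ_dhproj\<close>, the endomorphism \<open>cpJ\<close> is the complex
  structure induced from multiplication by \<open>\<i>\<close> in the homogeneous coordinates.
\<close>

definition hproj :: "complex^'m \<Rightarrow> complex^'m^'m" where
  "hproj z = (\<chi> i j. z $ i * cnj (z $ j))"

definition CP :: "(complex^'m::finite^'m) set" where
  "CP = {hproj z |z. norm z = 1}"

definition fs :: "complex^'m::finite^'m \<Rightarrow> complex^'m^'m \<Rightarrow> real" where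
  "fs X Y = (X \<bullet> Y) / 2"

definition cpJ :: "complex^'m::finite^'m \<Rightarrow> complex^'m^'m \<Rightarrow> complex^'m^'m" where
  "cpJ P X = (\<chi> i j. \<i> * (X ** P - P ** X) $ i $ j)"

definition dhproj :: "complex^'m \<Rightarrow> complex^'m \<Rightarrow> complex^'m^'m" where
  "dhproj z v = (\<chi> i j. v $ i * cnj (z $ j) + z $ i * cnj (v $ j))"

lemma has_derivative_vec_componentwise:
  fixes f :: "'a::real_normed_vector \<Rightarrow> 'b::euclidean_space^'n"
  assumes "\<And>i. ((\<lambda>x. f x $ i) has_derivative (\<lambda>x. f' x $ i)) (at a)"
  shows "(f has_derivative f') (at a)"
  by (subst has_derivative_componentwise_within)
    (auto simp: Basis_vec_def inner_axis intro!: has_derivative_inner_left assms)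

lemma hproj_has_derivative:
  fixes z :: "complex^'m::finite"
  shows "(hproj has_derivative dhproj z) (at z)"
proof -
  have 1: "((\<lambda>z::complex^'m. z $ i) has_derivative (\<lambda>v. v $ i)) (at z)" for i
    by (rule bounded_linear.has_derivative[OF bounded_linear_vec_nth]) simp
  have 2: "((\<lambda>z::complex^'m. cnj (z $ i)) has_derivative (\<lambda>v. cnj (v $ i))) (at z)" for i
    by (rule bounded_linear.has_derivative[OF bounded_linear_cnj 1])
  have "((\<lambda>z. z $ i * cnj (z $ j)) has_derivative
          (\<lambda>v. v $ i * cnj (z $ j) + z $ i * cnj (v $ j))) (at z)" for i j
    using has_derivative_mult[OF 1 2] by (simp add: add.commute)
  then show ?thesis
    by (intro has_derivative_vec_componentwise) (simp add: hproj_def dhproj_def)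
qed

lemma unit_sum:
  fixes z :: "complex^'m::finite"
  assumes "norm z = 1"
  shows "(\<Sum>i\<in>UNIV. z $ i * cnj (z $ i)) = 1"
proof -
  have "(\<Sum>i\<in>UNIV. z $ i * cnj (z $ i)) = of_real (\<Sum>i\<in>UNIV. (norm (z $ i))\<^sup>2)"
    by (simp only: of_real_sum complex_norm_square)
  also have "(\<Sum>i\<in>UNIV. (norm (z $ i))\<^sup>2) = (norm z)\<^sup>2"
    by (simp add: norm_vec_def L2_set_def sum_nonneg)
  finally show ?thesis using assms by simp
qed

lemma hproj_eq_iff:
  fixes z w :: "complex^'m::finite"
  assumes "norm z = 1" "norm w = 1"
  shows "hproj z = hproj w \<longleftrightarrow> (\<exists>c. cmod c = 1 \<and> w = c *s z)"
proof
  assume eq: "hproj z = hproj w"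
  have e: "z $ i * cnj (z $ j) = w $ i * cnj (w $ j)" for i j
    using arg_cong[OF eq, of "\<lambda>P. P $ i $ j"] by (simp add: hproj_def)
  define c where "c = (\<Sum>j\<in>UNIV. w $ j * cnj (z $ j))"
  have "w $ i = c * z $ i" for i
  proof -
    have "w $ i = (\<Sum>j\<in>UNIV. w $ i * cnj (w $ j) * w $ j)"
      using unit_sum[OF assms(2)]
      by (simp add: mult.assoc mult.commute[of "cnj _"] flip: sum_distrib_left)
    also have "\<dots> = (\<Sum>j\<in>UNIV. z $ i * cnj (z $ j) * w $ j)" by (simp add: e)
    also have "\<dots> = c * z $ i" by (simp add: c_def sum_distrib_left sum_distrib_right mult_ac)
    finally show ?thesis .
  qed
  then have w: "w = c *s z" by (simp add: vec_eq_iff)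
  have "norm w = cmod c * norm z"
    by (simp add: w norm_vec_def norm_mult L2_set_right_distrib)
  then show "\<exists>c. cmod c = 1 \<and> w = c *s z" using w assms by auto
next
  assume "\<exists>c. cmod c = 1 \<and> w = c *s z"
  then obtain c where c: "cmod c = 1" "w = c *s z" by blast
  have "c * cnj c = 1" using c(1) by (simp flip: complex_norm_square)
  then have "(c * z $ i) * cnj (c * z $ j) = z $ i * cnj (z $ j)" for i j
    by (metis (no_types, opaque_lifting) complex_cnj_mult mult.assoc mult.commute mult_1)
  then show "hproj z = hproj w" by (simp add: hproj_def c(2) vec_eq_iff)
qed

lemma fs_dhproj:
  fixes z v w :: "complex^'m::finite"
  assumes "norm z = 1" "(\<Sum>i\<in>UNIV. v $ i * cnj (z $ i)) = 0" "(\<Sum>i\<in>UNIV. w $ i * cnj (z $ i)) = 0"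
  shows "fs (dhproj z v) (dhproj z w) = v \<bullet> w"
proof -
  define h where "h = (\<lambda>(a::complex^'m) b::complex^'m. \<Sum>i\<in>UNIV. a $ i * cnj (b $ i))"
  have h: "h z z = 1" "h v z = 0" "h w z = 0"
    using unit_sum[OF assms(1)] assms by (simp_all add: h_def)
  have hc: "cnj (h a b) = h b a" for a b by (simp add: h_def mult.commute)
  have hvz: "h z v = 0" "h z w = 0" using h hc by (metis complex_cnj_zero)+
  have ip: "a \<bullet> b = Re (a * cnj b)" for a b :: complex
    by (simp add: inner_complex_def)
  have hr: "Re (h a b) = a \<bullet> b" for a b by (simp add: h_def inner_vec_def ip)
  have "dhproj z v \<bullet> dhproj z w =
    Re (\<Sum>i\<in>UNIV. \<Sum>j\<in>UNIV. (v $ i * cnj (z $ j) + z $ i * cnj (v $ j)) *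
          cnj (w $ i * cnj (z $ j) + z $ i * cnj (w $ j)))"
    by (simp add: dhproj_def inner_vec_def ip)
  also have "(\<Sum>i\<in>UNIV. \<Sum>j\<in>UNIV. (v $ i * cnj (z $ j) + z $ i * cnj (v $ j)) *
          cnj (w $ i * cnj (z $ j) + z $ i * cnj (w $ j)))
     = h v w * h z z + h v z * h w z + h z w * h z v + h z z * h w v"
    unfolding h_def sum_product sum.distrib[symmetric]
    by (intro sum.cong refl) (simp add: algebra_simps)
  finally show ?thesis
    using h hvz hr[of v w] hr[of w v] by (simp add: fs_def inner_commute)
qed

lemma cpJ_dhproj:
  fixes z v :: "complex^'m::finite"
  assumes "norm z = 1" "(\<Sum>i\<in>UNIV. v $ i * cnj (z $ i)) = 0"
  shows "cpJ (hproj z) (dhproj z v) = dhproj z (\<i> *s v)"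
proof -
  have s1: "(\<Sum>k\<in>UNIV. cnj (z $ k) * z $ k) = 1"
    using unit_sum[OF assms(1)] by (simp add: mult.commute)
  have s2: "(\<Sum>k\<in>UNIV. cnj (v $ k) * z $ k) = 0"
    using arg_cong[OF assms(2), of cnj] by (simp add: mult.commute)
  have s3: "(\<Sum>k\<in>UNIV. cnj (z $ k) * v $ k) = 0"
    using assms(2) by (simp add: mult.commute)
  have l: "(dhproj z v ** hproj z) $ i $ j = v $ i * cnj (z $ j)" for i j
  proof -
    have "(dhproj z v ** hproj z) $ i $ j =
      (\<Sum>k\<in>UNIV. v $ i * cnj (z $ j) * (cnj (z $ k) * z $ k) +
                   z $ i * cnj (z $ j) * (cnj (v $ k) * z $ k))"
      by (simp add: matrix_matrix_mult_def dhproj_def hproj_def algebra_simps)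
    then show ?thesis by (simp add: sum.distrib s1 s2 flip: sum_distrib_left)
  qed
  have r: "(hproj z ** dhproj z v) $ i $ j = z $ i * cnj (v $ j)" for i j
  proof -
    have "(hproj z ** dhproj z v) $ i $ j =
      (\<Sum>k\<in>UNIV. z $ i * cnj (z $ j) * (cnj (z $ k) * v $ k) +
                   z $ i * cnj (v $ j) * (cnj (z $ k) * z $ k))"
      by (simp add: matrix_matrix_mult_def dhproj_def hproj_def algebra_simps)
    then show ?thesis by (simp add: sum.distrib s1 s3 flip: sum_distrib_left)
  qed
  show ?thesis
    by (simp add: cpJ_def vec_eq_iff l r) (simp add: dhproj_def algebra_simps)
qed

section \<open>Real hypersurfaces\<close>

definition real_hypersurface :: "nat \<Rightarrow> (complex^'m::finite^'m) set \<Rightarrow> bool" where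
  "real_hypersurface n M \<longleftrightarrow> M \<subseteq> CP \<and> submanifold (2 * n - 1) M \<and> connected M"

definition unit_normal ::
  "(complex^'m::finite^'m) set \<Rightarrow> (complex^'m^'m \<Rightarrow> complex^'m^'m) \<Rightarrow> bool" where
  "unit_normal M N \<longleftrightarrow> smooth_map M N \<and>
     (\<forall>p\<in>M. N p \<in> tangent CP p \<and> fs (N p) (N p) = 1 \<and> (\<forall>v\<in>tangent M p. fs v (N p) = 0))"

text \<open>The Levi-Civita connection of a submanifold \<open>S\<close> with the metric \<open>fs\<close>, to be applied to
  vector fields on \<open>S\<close>.  The values on \<open>S\<close> are unique; the choice only concerns the irrelevant
  values outside \<open>S\<close> and those on arguments which are not vector fields.\<close>

definition nabla :: "(complex^'m::finite^'m) set \<Rightarrow> (complex^'m^'m \<Rightarrow> complex^'m^'m) \<Rightarrow>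
    (complex^'m^'m \<Rightarrow> complex^'m^'m) \<Rightarrow> complex^'m^'m \<Rightarrow> complex^'m^'m" where
  "nabla S = (SOME nab. levi_civita S fs nab)"

text \<open>The ambient covariant derivative in \<open>CP\<close> of a field \<open>V\<close> along \<open>M\<close> with values in the tangent
  spaces of \<open>CP\<close>, in the direction of a vector field \<open>X\<close> on \<open>M\<close>: both are extended to an open
  piece \<open>W\<close> of \<open>CP\<close>, and the result at a point of \<open>M\<close> does not depend on the extensions.\<close>

definition ambient_nabla :: "(complex^'m::finite^'m) set \<Rightarrow> (complex^'m^'m \<Rightarrow> complex^'m^'m) \<Rightarrow>
    (complex^'m^'m \<Rightarrow> complex^'m^'m) \<Rightarrow> complex^'m^'m \<Rightarrow> complex^'m^'m" where
  "ambient_nabla M X V p =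
     (THE w. \<exists>W X' V'. openin (top_of_set CP) W \<and> p \<in> W \<and> vfield W X' \<and> vfield W V' \<and>
        (\<forall>q\<in>W \<inter> M. X' q = X q \<and> V' q = V q) \<and> w = nabla W X' V' p)"

text \<open>In the following, \<open>M\<close> is (an open piece of) a real hypersurface, and \<open>N\<close> is a unit normal
  field on all of \<open>M\<close>.\<close>

definition xi :: "(complex^'m::finite^'m \<Rightarrow> complex^'m^'m) \<Rightarrow> complex^'m^'m \<Rightarrow> complex^'m^'m" where
  "xi N p = - cpJ p (N p)"

definition eta :: "(complex^'m::finite^'m \<Rightarrow> complex^'m^'m) \<Rightarrow> complex^'m^'m \<Rightarrow> complex^'m^'m \<Rightarrow> real" where
  "eta N p v = fs v (xi N p)"

definition phi :: "(complex^'m::finite^'m \<Rightarrow> complex^'m^'m) \<Rightarrow> complex^'m^'m \<Rightarrow> complex^'m^'m \<Rightarrow>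
    complex^'m^'m" where
  "phi N p v = cpJ p v - eta N p v *\<^sub>R N p"

definition shape :: "(complex^'m::finite^'m) set \<Rightarrow> (complex^'m^'m \<Rightarrow> complex^'m^'m) \<Rightarrow>
    (complex^'m^'m \<Rightarrow> complex^'m^'m) \<Rightarrow> complex^'m^'m \<Rightarrow> complex^'m^'m" where
  "shape M N X p = - ambient_nabla M X N p"

definition curv :: "(complex^'m::finite^'m) set \<Rightarrow> (complex^'m^'m \<Rightarrow> complex^'m^'m) \<Rightarrow>
    (complex^'m^'m \<Rightarrow> complex^'m^'m) \<Rightarrow> (complex^'m^'m \<Rightarrow> complex^'m^'m) \<Rightarrow>
    complex^'m^'m \<Rightarrow> complex^'m^'m" where
  "curv M X Y Z = (\<lambda>p. nabla M X (nabla M Y Z) p - nabla M Y (nabla M X Z) p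
     - nabla M (lie M X Y) Z p)"

definition jacobi_op :: "(complex^'m::finite^'m) set \<Rightarrow> (complex^'m^'m \<Rightarrow> complex^'m^'m) \<Rightarrow>
    (complex^'m^'m \<Rightarrow> complex^'m^'m) \<Rightarrow> complex^'m^'m \<Rightarrow> complex^'m^'m" where
  "jacobi_op M N Y = curv M Y (xi N) (xi N)"

text \<open>\<open>(\<nabla>\<^sub>X R\<^sub>\<xi>) Y = \<nabla>\<^sub>X (R\<^sub>\<xi> Y) - R\<^sub>\<xi> (\<nabla>\<^sub>X Y)\<close>\<close>

definition nabla_jacobi :: "(complex^'m::finite^'m) set \<Rightarrow> (complex^'m^'m \<Rightarrow> complex^'m^'m) \<Rightarrow>
    (complex^'m^'m \<Rightarrow> complex^'m^'m) \<Rightarrow> (complex^'m^'m \<Rightarrow> complex^'m^'m) \<Rightarrow>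
    complex^'m^'m \<Rightarrow> complex^'m^'m" where
  "nabla_jacobi M N X Y = (\<lambda>p. nabla M X (jacobi_op M N Y) p - jacobi_op M N (nabla M X Y) p)"

definition jacobi_condition :: "(complex^'m::finite^'m) set \<Rightarrow> (complex^'m^'m \<Rightarrow> complex^'m^'m) \<Rightarrow>
    real \<Rightarrow> bool" where
  "jacobi_condition M N k \<longleftrightarrow>
     (\<forall>X Y. vfield M X \<longrightarrow> vfield M Y \<longrightarrow>
       (\<forall>p\<in>M. nabla_jacobi M N X Y p =
          k *\<^sub>R (fs (phi N p (X p)) (Y p) *\<^sub>R xi N p + eta N p (Y p) *\<^sub>R phi N p (X p))))"

definition skew_jacobi_condition :: "(complex^'m::finite^'m) set \<Rightarrow>
    (complex^'m^'m \<Rightarrow> complex^'m^'m) \<Rightarrow> real \<Rightarrow> bool" where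
  "skew_jacobi_condition M N k \<longleftrightarrow>
     (\<forall>X Y W. vfield M X \<longrightarrow> vfield M Y \<longrightarrow> vfield M W \<longrightarrow>
       (\<forall>p\<in>M. fs (nabla_jacobi M N X Y p - nabla_jacobi M N Y X p) (W p) =
          k * (2 * eta N p (W p) * fs (phi N p (X p)) (Y p)
               + eta N p (Y p) * fs (phi N p (X p)) (W p)
               - eta N p (X p) * fs (phi N p (Y p)) (W p))))"

definition eta_umbilical :: "(complex^'m::finite^'m) set \<Rightarrow> (complex^'m^'m \<Rightarrow> complex^'m^'m) \<Rightarrow> bool" where
  "eta_umbilical M N \<longleftrightarrow> (\<exists>lam :: complex^'m^'m \<Rightarrow> real.
     \<forall>X. vfield M X \<and> (\<forall>p\<in>M. fs (X p) (xi N p) = 0) \<longrightarrow>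
       (\<forall>p\<in>M. shape M N X p = lam p *\<^sub>R X p))"

text \<open>A unit normal field is in general only defined locally and only up to sign.  Properties
  involving \<open>N\<close> are therefore stated on a neighbourhood \<open>U\<close> in \<open>M\<close> of each point, with a unit normal
  field \<open>N\<close> on \<open>U\<close>. Replacing \<open>N\<close> by \<open>- N\<close> leaves \<open>phi\<close>, the structure Jacobi operator and
  \<open>\<eta>\<close>-umbilicity unchanged, but reverses \<open>xi\<close> and \<open>eta\<close>, so that \<open>k\<close> in the two conditions above
  becomes \<open>- k\<close>; a constant \<open>k\<close> for all of \<open>M\<close> therefore refers to suitable choices of \<open>N\<close>.\<close>

definition locally_oriented :: "(complex^'m::finite^'m) set \<Rightarrow>
    ((complex^'m^'m) set \<Rightarrow> (complex^'m^'m \<Rightarrow> complex^'m^'m) \<Rightarrow> bool) \<Rightarrow> bool" where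
  "locally_oriented M Q \<longleftrightarrow>
     (\<forall>p\<in>M. \<exists>U N. openin (top_of_set M) U \<and> p \<in> U \<and> unit_normal U N \<and> Q U N)"

end

theory Submission
  imports Defs
begin

text \<open>
  The covariant derivative of a submanifold of a Euclidean space is the ordinary derivative followed
  by the orthogonal projection \<open>P\<close> onto the tangent space (\<open>levi_civita_unique\<close>), and its curvature is
  \<open>R(x,y)z = P [dP(x), dP(y)] z\<close> (\<open>curv_eq\<close>).  For \<open>CP\<close> the projection is a polynomial in the projector
  \<open>p\<close>, and \<open>R(x,y)z = [[x,y],z]\<close> is the curvature tensor of holomorphic sectional curvature \<open>4\<close>
  (\<open>CP_curvature\<close>).  For a hypersurface with unit normal \<open>N\<close> the projection is that of \<open>CP\<close> minus its
  \<open>N\<close>-component.  This gives the equations of Gauss and Codazzi (\<open>gauss\<close>, \<open>codazzi\<close>), the derivative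
  \<open>\<phi> A\<close> of \<open>\<xi>\<close>, and the structure Jacobi operator
  \<open>S y = y - \<eta>(y) \<xi> + \<alpha> A y - \<langle>y, A \<xi>\<rangle> A \<xi>\<close> with \<open>\<alpha> = \<langle>A \<xi>, \<xi>\<rangle>\<close> (\<open>jacobi_op_eq\<close>).

  Skew-symmetrising the first condition gives the second (\<open>jacobi_imp_skew\<close>).

  The second condition implies umbilicity (\<open>skew_imp_umbilical\<close>).  If \<open>A \<xi> = \<alpha> \<xi>\<close>, the condition for
  \<open>x = \<xi>\<close> is an equation \<open>(1 + \<alpha>\<^sup>2) \<phi> A + \<epsilon> A + (\<alpha> + k) \<phi> = 0\<close> on the complement of \<open>\<xi>\<close>, and a symmetric \<open>A\<close>
  with this property is scalar there (\<open>hopf_umbilical\<close>).  Otherwise put \<open>A \<xi> = \<alpha> \<xi> + H\<close> on the open set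
  where \<open>H \<noteq> 0\<close>.  The condition, split into components along \<open>\<xi>\<close>, \<open>H\<close>, \<open>\<phi> H\<close> and the remaining
  space \<open>D\<close>, determines \<open>A\<close>: it is the scalar \<open>- (\<alpha> + k)\<close> on \<open>D\<close>, with \<open>(\<alpha> + k)\<^sup>2 = 1\<close>.  So \<open>\<alpha>\<close> is locally
  constant; the Codazzi equation for \<open>\<phi> H\<close> and a field in \<open>D\<close> gives \<open>\<alpha> (\<alpha> + k) = 1\<close>, hence \<open>k = 0\<close>;
  and \<open>b = \<langle>H, H\<rangle>\<close> has the differential \<open>- 2 (1 + 2 b) \<langle>_, \<phi> H\<rangle>\<close>.  Both \<open>\<xi> b\<close> and \<open>H b\<close> vanish, so
  \<open>[\<xi>, H] b = 0\<close>, which amounts to \<open>b = - 3\<close>, impossible for a squared length (\<open>hopf\<close>).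

  Conversely, let \<open>A\<close> be the scalar \<open>\<lambda>\<close> on the complement of \<open>\<xi>\<close>.  The Codazzi equation yields
  \<open>\<alpha> \<lambda> = \<lambda>\<^sup>2 - 1\<close> and \<open>d\<lambda> = 0\<close>, so \<open>S y = \<lambda>\<^sup>2 (y - \<eta>(y) \<xi>)\<close>, and its derivative is the first condition
  with \<open>k = - \<lambda>\<^sup>3\<close> (\<open>nabla_jacobi_umbilical\<close>).  Reversing the normal changes the sign of \<open>\<lambda>\<close>, while
  \<open>\<bar>\<lambda>\<bar>\<close> is a constant of the connected hypersurface; choosing all local normals with \<open>\<lambda> > 0\<close> gives one
  \<open>k\<close> for all points (\<open>umbilical_imp_jacobi\<close>).
\<close>

section \<open>Calculus of smooth maps\<close>

lemma frechet_derivative_cong_open: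
  fixes f g :: "'a::real_normed_vector \<Rightarrow> 'b::real_normed_vector"
  assumes "open S" "x \<in> S" "\<And>y. y \<in> S \<Longrightarrow> f y = g y"
  shows "frechet_derivative f (at x) = frechet_derivative g (at x)"
proof -
  have "(f has_derivative D) (at x) \<longleftrightarrow> (g has_derivative D) (at x)" for D
    using has_derivative_transform_within_open[of f D x UNIV S g]
      has_derivative_transform_within_open[of g D x UNIV S f] assms(1,2) assms(3) by auto
  then show ?thesis by (simp add: frechet_derivative_def)
qed

lemma Ck_on_cong:
  fixes f g :: "'a::euclidean_space \<Rightarrow> 'b::euclidean_space"
  assumes "open S" "\<And>x. x \<in> S \<Longrightarrow> f x = g x" "Ck_on k S f"
  shows "Ck_on k S g"
  using assms(2,3)
proof (induction k arbitrary: f g)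
  case 0
  then show ?case using continuous_on_cong[of S S f g] by simp
next
  case (Suc k)
  have "g differentiable (at x)" if x: "x \<in> S" for x
  proof -
    obtain D where "(f has_derivative D) (at x)"
      using Suc.prems(2) x by (auto simp: differentiable_def)
    then have "(g has_derivative D) (at x)"
      using has_derivative_transform_within_open[of f D x UNIV S g] assms(1) x Suc.prems(1) by auto
    then show ?thesis by (auto simp: differentiable_def)
  qed
  moreover have "Ck_on k S (\<lambda>x. frechet_derivative g (at x) v)" for v
    using Suc.IH[of "\<lambda>x. frechet_derivative f (at x) v"] Suc.prems
      frechet_derivative_cong_open[OF assms(1), of _ f g] by simp
  ultimately show ?case by simp
qed

lemma Ck_on_subset: "Ck_on k S f \<Longrightarrow> T \<subseteq> S \<Longrightarrow> Ck_on k T f"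
  by (induction k arbitrary: f) (auto intro: continuous_on_subset)

lemma Ck_on_Suc_imp: "Ck_on (Suc k) S f \<Longrightarrow> Ck_on k S f"
proof (induction k arbitrary: f)
  case 0
  then have "continuous (at x within S) f" if "x \<in> S" for x
    using 0 that differentiable_imp_continuous_within[of f x UNIV]
      continuous_at_imp_continuous_at_within[of x f S] by simp
  then show ?case by (simp add: continuous_on_eq_continuous_within)
next
  case (Suc k)
  have "Ck_on k S (\<lambda>x. frechet_derivative f (at x) v)" for v
    using Suc.prems by (intro Suc.IH) (simp only: Ck_on.simps(2), blast)
  moreover have "\<forall>x\<in>S. f differentiable (at x)"
    using Suc.prems by simp
  ultimately show ?case by simp
qed

text \<open>Any formula for the derivative that is valid on the open set may replace the chosen one.\<close>

lemma Ck_on_SucI: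
  assumes "open S" "\<And>x. x \<in> S \<Longrightarrow> (f has_derivative D x) (at x)"
    "\<And>v. Ck_on k S (\<lambda>x. D x v)"
  shows "Ck_on (Suc k) S f"
proof -
  have "frechet_derivative f (at x) = D x" if "x \<in> S" for x
    using frechet_derivative_at[OF assms(2)[OF that]] by simp
  then have "Ck_on k S (\<lambda>x. frechet_derivative f (at x) v)" for v
    by (intro Ck_on_cong[OF assms(1) _ assms(3)[of v]]) simp
  then show ?thesis using assms(2) by (auto simp: differentiable_def)
qed

lemma Ck_on_derivative:
  assumes "Ck_on (Suc k) S f" "x \<in> S"
  shows "(f has_derivative frechet_derivative f (at x)) (at x)"
  using assms by (simp add: frechet_derivative_works[symmetric])

lemma Ck_on_const: "open S \<Longrightarrow> Ck_on k S (\<lambda>x. c)"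
proof (induction k arbitrary: c)
  case (Suc k)
  show ?case by (rule Ck_on_SucI[OF Suc.prems has_derivative_const]) (simp add: Suc)
qed simp

lemma Ck_on_bounded_linear:
  assumes "bounded_linear L"
  shows "open S \<Longrightarrow> Ck_on k S f \<Longrightarrow> Ck_on k S (\<lambda>x. L (f x))"
proof (induction k arbitrary: f)
  case 0
  then show ?case using bounded_linear.continuous_on[OF assms] by auto
next
  case (Suc k)
  show ?case
    by (rule Ck_on_SucI[OF Suc.prems(1)
        bounded_linear.has_derivative[OF assms Ck_on_derivative[OF Suc.prems(2)]]])
      (use Suc in auto)
qed

lemma Ck_on_add:
  "open S \<Longrightarrow> Ck_on k S f \<Longrightarrow> Ck_on k S g \<Longrightarrow> Ck_on k S (\<lambda>x. f x + g x)"
proof (induction k arbitrary: f g)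
  case 0
  then show ?case by (auto intro: continuous_on_add)
next
  case (Suc k)
  show ?case
    by (rule Ck_on_SucI[OF Suc.prems(1) has_derivative_add[OF
            Ck_on_derivative[OF Suc.prems(2)] Ck_on_derivative[OF Suc.prems(3)]]])
      (use Suc in auto)
qed

lemma Ck_on_bilinear:
  assumes "bounded_bilinear B"
  shows "open S \<Longrightarrow> Ck_on k S f \<Longrightarrow> Ck_on k S g \<Longrightarrow> Ck_on k S (\<lambda>x. B (f x) (g x))"
proof (induction k arbitrary: f g)
  case 0
  then show ?case using bounded_bilinear.continuous_on[OF assms] by auto
next
  case (Suc k)
  show ?case
    by (rule Ck_on_SucI[OF Suc.prems(1) bounded_bilinear.FDERIV[OF assms
            Ck_on_derivative[OF Suc.prems(2)] Ck_on_derivative[OF Suc.prems(3)]]])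
      (use Suc Ck_on_Suc_imp[OF Suc.prems(2)] Ck_on_Suc_imp[OF Suc.prems(3)] in
        \<open>auto intro!: Ck_on_add\<close>)
qed

lemma Ck_on_inverse:
  fixes f :: "'a::euclidean_space \<Rightarrow> real"
  shows "open S \<Longrightarrow> (\<And>x. x \<in> S \<Longrightarrow> f x \<noteq> 0) \<Longrightarrow> Ck_on k S f \<Longrightarrow> Ck_on k S (\<lambda>x. inverse (f x))"
proof (induction k)
  case 0
  then show ?case by (auto intro: continuous_on_inverse)
next
  case (Suc k)
  have i: "Ck_on k S (\<lambda>x. inverse (f x))"
    using Suc Ck_on_Suc_imp by blast
  have *: "Ck_on k S (\<lambda>x. - (inverse (f x) * frechet_derivative f (at x) v * inverse (f x)))" for v
    using Suc.prems i
    by (intro Ck_on_bounded_linear[OF bounded_linear_minus[OF bounded_linear_ident]]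
        Ck_on_bilinear[OF bounded_bilinear_mult]) auto
  show ?case
    by (rule Ck_on_SucI[OF Suc.prems(1)
        Deriv.has_derivative_inverse[OF Suc.prems(2) Ck_on_derivative[OF Suc.prems(3)]]]) (use * in auto)
qed

lemma Ck_on_affine:
  assumes "bounded_linear L" "open S" "open T"
  shows "Ck_on k S g \<Longrightarrow> (\<And>x. x \<in> T \<Longrightarrow> a + L x \<in> S) \<Longrightarrow> Ck_on k T (\<lambda>x. g (a + L x))"
proof (induction k arbitrary: g)
  case 0
  have "continuous_on T (\<lambda>x. a + L x)"
    using bounded_linear.continuous_on[OF assms(1) continuous_on_id]
    by (auto intro: continuous_on_add)
  then show ?case using 0 by (auto intro: continuous_on_compose2)
next
  case (Suc k)
  have *: "((\<lambda>x. a + L x) has_derivative L) (at x)" for x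
    using has_derivative_add[OF has_derivative_const
        bounded_linear_imp_has_derivative[OF assms(1)]] by simp
  show ?case
    by (rule Ck_on_SucI[OF assms(3) has_derivative_compose[OF *
            Ck_on_derivative[OF Suc.prems(1)]]])
      (use Suc in auto)
qed

lemma smooth_on_open_subset:
  "smooth_on_open S f \<Longrightarrow> open T \<Longrightarrow> T \<subseteq> S \<Longrightarrow> smooth_on_open T f"
  by (auto simp: smooth_on_open_def intro: Ck_on_subset)

lemma smooth_on_open_derivative:
  assumes "smooth_on_open S f" "x \<in> S"
  shows "(f has_derivative frechet_derivative f (at x)) (at x)"
  using assms Ck_on_derivative[of 0 S f x] unfolding smooth_on_open_def by blast

lemma smooth_on_open_continuous: "smooth_on_open S f \<Longrightarrow> continuous_on S f"
  unfolding smooth_on_open_def by (drule conjunct2, drule spec[of _ 0]) simp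

lemma smooth_on_open_const: "open S \<Longrightarrow> smooth_on_open S (\<lambda>x. c)"
  by (simp add: smooth_on_open_def Ck_on_const)

lemma smooth_on_open_bounded_linear:
  "bounded_linear L \<Longrightarrow> smooth_on_open S f \<Longrightarrow> smooth_on_open S (\<lambda>x. L (f x))"
  by (simp add: smooth_on_open_def Ck_on_bounded_linear)

lemma smooth_on_open_id: "open S \<Longrightarrow> smooth_on_open S (\<lambda>x. x)"
proof -
  assume S: "open S"
  have "Ck_on k S (\<lambda>x. x)" for k
  proof (cases k)
    case 0
    then show ?thesis by (simp add: continuous_on_id)
  next
    case (Suc j)
    show ?thesis unfolding Suc
      by (rule Ck_on_SucI[OF S has_derivative_ident Ck_on_const[OF S]])
  qed
  with S show ?thesis by (simp add: smooth_on_open_def)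
qed

lemma smooth_on_open_add:
  "smooth_on_open S f \<Longrightarrow> smooth_on_open S g \<Longrightarrow> smooth_on_open S (\<lambda>x. f x + g x)"
  by (simp add: smooth_on_open_def Ck_on_add)

lemma smooth_on_open_bilinear:
  "bounded_bilinear B \<Longrightarrow> smooth_on_open S f \<Longrightarrow> smooth_on_open S g \<Longrightarrow>
    smooth_on_open S (\<lambda>x. B (f x) (g x))"
  by (simp add: smooth_on_open_def Ck_on_bilinear)

lemma smooth_on_open_sum:
  "finite I \<Longrightarrow> open S \<Longrightarrow> (\<And>i. i \<in> I \<Longrightarrow> smooth_on_open S (f i)) \<Longrightarrow>
    smooth_on_open S (\<lambda>x. \<Sum>i\<in>I. f i x)"
  by (induction I rule: finite_induct) (simp_all add: smooth_on_open_const smooth_on_open_add)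

text \<open>The definition of \<open>C\<^sup>k\<close> speaks of fixed directions; a variable direction is expanded in the basis.\<close>

lemma smooth_on_open_frechet_derivative:
  assumes f: "smooth_on_open S f" and h: "smooth_on_open S h"
  shows "smooth_on_open S (\<lambda>x. frechet_derivative f (at x) (h x))"
proof -
  have S: "open S" using f by (simp add: smooth_on_open_def)
  have v: "smooth_on_open S (\<lambda>x. frechet_derivative f (at x) v)" for v
    unfolding smooth_on_open_def
  proof (intro conjI allI S)
    fix k
    have "Ck_on (Suc k) S f" using f by (simp only: smooth_on_open_def)
    then show "Ck_on k S (\<lambda>x. frechet_derivative f (at x) v)" by simp
  qed
  have s: "smooth_on_open S (\<lambda>x. \<Sum>b\<in>Basis. (h x \<bullet> b) *\<^sub>R frechet_derivative f (at x) b)"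
    by (rule smooth_on_open_sum[OF finite_Basis S], rule smooth_on_open_bilinear[OF
          bounded_bilinear_scaleR smooth_on_open_bounded_linear[OF bounded_linear_inner_left h] v])
  have "frechet_derivative f (at x) (h x) =
      (\<Sum>b\<in>Basis. (h x \<bullet> b) *\<^sub>R frechet_derivative f (at x) b)" if "x \<in> S" for x
  proof -
    interpret linear "frechet_derivative f (at x)"
      using smooth_on_open_derivative[OF f that] has_derivative_linear by blast
    have "frechet_derivative f (at x) (h x) =
        frechet_derivative f (at x) (\<Sum>b\<in>Basis. (h x \<bullet> b) *\<^sub>R b)"
      by (simp only: euclidean_representation)
    then show ?thesis by (simp only: sum scale)
  qed
  then have "Ck_on k S (\<lambda>x. frechet_derivative f (at x) (h x))" for k
    by (intro Ck_on_cong[OF S _ s[unfolded smooth_on_open_def, THEN conjunct2, rule_format, of k]]) simp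
  with S show ?thesis by (simp add: smooth_on_open_def)
qed

lemma smooth_map_extension:
  assumes "smooth_map S f" "p \<in> S"
  obtains W g where "p \<in> W" "open W" "smooth_on_open W g" "\<forall>q\<in>S \<inter> W. g q = f q"
proof -
  have "\<exists>W g. p \<in> W \<and> smooth_on_open W g \<and> (\<forall>q\<in>S \<inter> W. g q = f q)"
    using assms(1) unfolding smooth_map_def by (rule bspec[OF _ assms(2)])
  then obtain W g where 1: "p \<in> W" "smooth_on_open W g" "\<forall>q\<in>S \<inter> W. g q = f q"
    by (elim exE conjE)
  from 1(2) have 2: "open W" by (simp add: smooth_on_open_def)
  show ?thesis by (rule that[OF 1(1) 2 1(2,3)])
qed

lemma smooth_mapI:
  assumes "\<And>p. p \<in> S \<Longrightarrow> \<exists>W g. p \<in> W \<and> smooth_on_open W g \<and> (\<forall>q\<in>S \<inter> W. g q = f q)"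
  shows "smooth_map S f"
  unfolding smooth_map_def by (rule ballI) (rule assms)

text \<open>The closure properties of smooth maps on an arbitrary subset reduce to those on open sets by
  passing to local extensions.\<close>

lemma smooth_map_combine:
  fixes S :: "'a::euclidean_space set"
  assumes "smooth_map S f" "smooth_map S g"
    and "\<And>(W::'a set) f g. smooth_on_open W f \<Longrightarrow> smooth_on_open W g \<Longrightarrow> smooth_on_open W (\<lambda>x. h (f x) (g x))"
  shows "smooth_map S (\<lambda>x. h (f x) (g x))"
proof (rule smooth_mapI)
  fix p assume "p \<in> S"
  obtain W f' where
    w: "p \<in> W" "open W" "smooth_on_open W f'" "\<forall>q\<in>S \<inter> W. f' q = f q"
    by (rule smooth_map_extension[OF assms(1) \<open>p \<in> S\<close>])
  obtain V g' where
    v: "p \<in> V" "open V" "smooth_on_open V g'" "\<forall>q\<in>S \<inter> V. g' q = g q"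
    by (rule smooth_map_extension[OF assms(2) \<open>p \<in> S\<close>])
  from w(2) v(2) have o: "open (W \<inter> V)" by (rule open_Int)
  show "\<exists>W k. p \<in> W \<and> smooth_on_open W k \<and> (\<forall>q\<in>S \<inter> W. k q = h (f q) (g q))"
    by (intro exI[of _ "W \<inter> V"] exI[of _ "\<lambda>x. h (f' x) (g' x)"] conjI
        assms(3)[of "W \<inter> V" f' g', OF smooth_on_open_subset[OF w(3) o] smooth_on_open_subset[OF v(3) o]])
      (use w v in auto)
qed

lemma smooth_map_const [intro]: "smooth_map S (\<lambda>x. c)"
  unfolding smooth_map_def
  by (intro ballI exI[of _ UNIV] exI[of _ "\<lambda>x. c"]) (simp add: smooth_on_open_const)

lemma smooth_map_id: "smooth_map S (\<lambda>x. x)"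
  unfolding smooth_map_def
  by (intro ballI exI[of _ UNIV] exI[of _ "\<lambda>x. x"]) (simp add: smooth_on_open_id)

lemma smooth_map_add: "smooth_map S f \<Longrightarrow> smooth_map S g \<Longrightarrow> smooth_map S (\<lambda>x. f x + g x)"
  by (rule smooth_map_combine[of S f g "(+)"]) (simp_all add: smooth_on_open_add)

lemma smooth_map_bounded_linear:
  "bounded_linear L \<Longrightarrow> smooth_map S f \<Longrightarrow> smooth_map S (\<lambda>x. L (f x))"
  by (rule smooth_map_combine[of S f f "\<lambda>x y. L x"]) (simp_all add: smooth_on_open_bounded_linear)

lemma smooth_map_bilinear:
  "bounded_bilinear B \<Longrightarrow> smooth_map S f \<Longrightarrow> smooth_map S g \<Longrightarrow> smooth_map S (\<lambda>x. B (f x) (g x))"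
  by (rule smooth_map_combine[of S f g B]) (simp_all add: smooth_on_open_bilinear)

lemma smooth_map_scaleR: "smooth_map S f \<Longrightarrow> smooth_map S g \<Longrightarrow> smooth_map S (\<lambda>x. f x *\<^sub>R g x)"
  by (rule smooth_map_bilinear[OF bounded_bilinear_scaleR])

lemma smooth_map_mult:
  fixes f g :: "'a::euclidean_space \<Rightarrow> real"
  shows "smooth_map S f \<Longrightarrow> smooth_map S g \<Longrightarrow> smooth_map S (\<lambda>x. f x * g x)"
  by (rule smooth_map_bilinear[OF bounded_bilinear_mult])

lemma smooth_map_minus: "smooth_map S f \<Longrightarrow> smooth_map S (\<lambda>x. - f x)"
  by (rule smooth_map_bounded_linear[OF bounded_linear_minus[OF bounded_linear_ident]])

lemma smooth_map_diff: "smooth_map S f \<Longrightarrow> smooth_map S g \<Longrightarrow> smooth_map S (\<lambda>x. f x - g x)"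
  using smooth_map_add[of S f "\<lambda>x. - g x"] smooth_map_minus[of S g] by simp

lemma smooth_map_sum:
  "finite I \<Longrightarrow> (\<And>i. i \<in> I \<Longrightarrow> smooth_map S (f i)) \<Longrightarrow> smooth_map S (\<lambda>x. \<Sum>i\<in>I. f i x)"
  by (induction I rule: finite_induct) (simp_all add: smooth_map_const smooth_map_add)

lemma smooth_map_inner: "smooth_map S f \<Longrightarrow> smooth_map S g \<Longrightarrow> smooth_map S (\<lambda>x. f x \<bullet> g x)"
  by (rule smooth_map_bilinear[OF bounded_bilinear_inner])

lemma smooth_map_cong_subset:
  assumes "smooth_map S f" "T \<subseteq> S" "\<And>p. p \<in> T \<Longrightarrow> f p = g p"
  shows "smooth_map T g"
proof (rule smooth_mapI)
  fix p assume p: "p \<in> T"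
  have "p \<in> S" using p assms(2) by auto
  obtain W h where "p \<in> W" "open W" "smooth_on_open W h" "\<forall>q\<in>S \<inter> W. h q = f q"
    by (rule smooth_map_extension[OF assms(1) \<open>p \<in> S\<close>])
  then show "\<exists>W h. p \<in> W \<and> smooth_on_open W h \<and> (\<forall>q\<in>T \<inter> W. h q = g q)"
    using assms(2,3) by (intro exI[of _ W] exI[of _ h]) auto
qed

lemma smooth_map_subset: "smooth_map S f \<Longrightarrow> T \<subseteq> S \<Longrightarrow> smooth_map T f"
  by (rule smooth_map_cong_subset[of S f T f]) simp_all

lemma smooth_map_cong: "smooth_map S f \<Longrightarrow> (\<And>p. p \<in> S \<Longrightarrow> f p = g p) \<Longrightarrow> smooth_map S g"
  by (rule smooth_map_cong_subset[of S f S g]) simp_all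

lemma smooth_map_inverse:
  fixes f :: "'a::euclidean_space \<Rightarrow> real"
  assumes "smooth_map S f" "\<And>p. p \<in> S \<Longrightarrow> f p \<noteq> 0"
  shows "smooth_map S (\<lambda>p. inverse (f p))"
proof (rule smooth_mapI)
  fix p assume p: "p \<in> S"
  obtain W g where w: "p \<in> W" "open W" "smooth_on_open W g" "\<forall>q\<in>S \<inter> W. g q = f q"
    by (rule smooth_map_extension[OF assms(1) p])
  have "continuous_on W g" "open W"
    using smooth_on_open_continuous[OF w(3)] w(2) by auto
  then have o: "open (W \<inter> g -` (- {0}))"
    by (intro continuous_open_preimage) auto
  have s: "smooth_on_open (W \<inter> g -` (- {0})) g"
    using smooth_on_open_subset[OF w(3) o] by auto
  then have "smooth_on_open (W \<inter> g -` (- {0})) (\<lambda>x. inverse (g x))"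
    using Ck_on_inverse[OF o, of g] by (simp add: smooth_on_open_def)
  then show "\<exists>W g. p \<in> W \<and> smooth_on_open W g \<and> (\<forall>q\<in>S \<inter> W. g q = inverse (f q))"
    using w(1) s p assms(2)[OF p] w(4)
    by (intro exI[of _ "W \<inter> g -` (- {0})"] exI[of _ "\<lambda>x. inverse (g x)"]) auto
qed

lemma smooth_map_has_derivative:
  assumes "smooth_map S f" "p \<in> S"
  obtains f' where "(f has_derivative f') (at p within S)"
proof -
  obtain W g where w: "p \<in> W" "open W" "smooth_on_open W g" "\<forall>q\<in>S \<inter> W. g q = f q"
    by (rule smooth_map_extension[OF assms])
  have "(g has_derivative frechet_derivative g (at p)) (at p within S)"
    using smooth_on_open_derivative[OF w(3,1)] has_derivative_at_withinI by blast
  moreover obtain e where "e > 0" "ball p e \<subseteq> W" using w(1,2) openE by blast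
  ultimately have "(f has_derivative frechet_derivative g (at p)) (at p within S)"
    using w(4) assms(2)
    by (elim has_derivative_transform_within[where d=e]) (auto simp: dist_commute subset_iff)
  then show ?thesis by (rule that)
qed

lemma smooth_map_continuous:
  assumes "smooth_map S f"
  shows "continuous_on S f"
  unfolding continuous_on_eq_continuous_within
proof
  fix p assume "p \<in> S"
  then obtain f' where "(f has_derivative f') (at p within S)"
    by (rule smooth_map_has_derivative[OF assms])
  then show "continuous (at p within S) f" by (rule has_derivative_continuous)
qed

section \<open>Symmetry of the second derivative\<close>

text \<open>Two applications of the mean value theorem turn the second difference over a small parallelogram
  into a mixed second derivative at an intermediate point.  The second difference is symmetric in
  \<open>u\<close> and \<open>v\<close>, which forces the mixed derivatives to agree in the limit.\<close>

lemma second_difference_mean_value: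
  fixes F :: "'a::euclidean_space \<Rightarrow> real"
  assumes F: "smooth_on_open W F" and h: "h > 0"
    and W: "\<And>s t. 0 \<le> s \<Longrightarrow> s \<le> h \<Longrightarrow> 0 \<le> t \<Longrightarrow> t \<le> h \<Longrightarrow> p + s *\<^sub>R u + t *\<^sub>R v \<in> W"
  obtains s t where "0 \<le> s" "s \<le> h" "0 \<le> t" "t \<le> h"
    "F (p + h *\<^sub>R u + h *\<^sub>R v) - F (p + h *\<^sub>R u) - F (p + h *\<^sub>R v) + F p =
      h * h * frechet_derivative (\<lambda>x. frechet_derivative F (at x) u) (at (p + s *\<^sub>R u + t *\<^sub>R v)) v"
proof -
  have o: "open W" using F by (simp add: smooth_on_open_def)
  let ?F = "\<lambda>x. frechet_derivative F (at x)"
  let ?G = "\<lambda>x. ?F x u"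
  have G: "smooth_on_open W ?G"
    by (rule smooth_on_open_frechet_derivative[OF F smooth_on_open_const[OF o]])
  have lin: "linear (frechet_derivative f (at x))" if "smooth_on_open W f" "x \<in> W" for f :: "'a \<Rightarrow> real" and x
    using smooth_on_open_derivative[OF that] has_derivative_linear by blast
  have d: "((\<lambda>s. f (a + s *\<^sub>R w)) has_real_derivative frechet_derivative f (at (a + s *\<^sub>R w)) w) (at s)"
    if "smooth_on_open W f" "a + s *\<^sub>R w \<in> W" for f :: "'a \<Rightarrow> real" and a w s
  proof -
    have "((\<lambda>s. a + s *\<^sub>R w) has_derivative (\<lambda>x. x *\<^sub>R w)) (at s)"
      by (auto intro!: derivative_eq_intros)
    from has_derivative_compose[OF this smooth_on_open_derivative[OF that]]
    show ?thesis
      by (simp add: has_field_derivative_def linear_cmul[OF lin[OF that]] mult.commute[of _ "frechet_derivative f _ _"])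
  qed
  have "\<exists>s>0. s < h \<and> (F (p + h *\<^sub>R v + h *\<^sub>R u) - F (p + h *\<^sub>R u)) - (F (p + h *\<^sub>R v + 0 *\<^sub>R u) - F (p + 0 *\<^sub>R u)) =
     (h - 0) * (?G (p + h *\<^sub>R v + s *\<^sub>R u) - ?G (p + s *\<^sub>R u))"
  proof (rule MVT2[OF h], rule DERIV_diff)
    fix s :: real assume s: "0 \<le> s" "s \<le> h"
    show "((\<lambda>x. F (p + h *\<^sub>R v + x *\<^sub>R u)) has_real_derivative ?G (p + h *\<^sub>R v + s *\<^sub>R u)) (at s)"
      using W[OF s, of h] h by (intro d[OF F]) (simp add: add_ac)
    show "((\<lambda>x. F (p + x *\<^sub>R u)) has_real_derivative ?G (p + s *\<^sub>R u)) (at s)"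
      using W[OF s, of 0] h by (intro d[OF F]) simp
  qed
  then obtain s where s: "0 < s" "s < h"
    "F (p + h *\<^sub>R v + h *\<^sub>R u) - F (p + h *\<^sub>R u) - (F (p + h *\<^sub>R v) - F p) =
     h * (?G (p + h *\<^sub>R v + s *\<^sub>R u) - ?G (p + s *\<^sub>R u))" by auto
  have "\<exists>t>0. t < h \<and> ?G (p + s *\<^sub>R u + h *\<^sub>R v) - ?G (p + s *\<^sub>R u + 0 *\<^sub>R v) =
     (h - 0) * frechet_derivative ?G (at (p + s *\<^sub>R u + t *\<^sub>R v)) v"
    by (rule MVT2[OF h]) (use W[of s] s h in \<open>auto intro!: d G\<close>)
  then obtain t where t: "0 < t" "t < h" "?G (p + s *\<^sub>R u + h *\<^sub>R v) - ?G (p + s *\<^sub>R u) =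
     h * frechet_derivative ?G (at (p + s *\<^sub>R u + t *\<^sub>R v)) v" by auto
  show ?thesis by (rule that[of s t]) (use s t in \<open>auto simp: add_ac\<close>)
qed

lemma second_derivative_symmetric_real:
  fixes F :: "'a::euclidean_space \<Rightarrow> real"
  assumes F: "smooth_on_open W F" and p: "p \<in> W"
  shows "frechet_derivative (\<lambda>x. frechet_derivative F (at x) u) (at p) v =
         frechet_derivative (\<lambda>x. frechet_derivative F (at x) v) (at p) u"
proof -
  have o: "open W" using F by (simp add: smooth_on_open_def)
  let ?D = "\<lambda>u v x. frechet_derivative (\<lambda>x. frechet_derivative F (at x) u) (at x) v"
  have "smooth_on_open W (?D u v)" for u v
    by (intro smooth_on_open_frechet_derivative F smooth_on_open_const o)
  then have c: "continuous (at p) (?D u v)" for u v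
    using p o smooth_on_open_continuous continuous_on_eq_continuous_at by blast
  obtain r where r: "r > 0" "ball p r \<subseteq> W" using o p openE by blast
  have close: "\<bar>?D u v p - ?D v u p\<bar> \<le> 2 * e" if e: "e > 0" for e
  proof -
    obtain d1 where d1: "d1 > 0" "\<forall>x. dist x p < d1 \<longrightarrow> dist (?D u v x) (?D u v p) < e"
      using c[of u v] e unfolding continuous_at_eps_delta by meson
    obtain d2 where d2: "d2 > 0" "\<forall>x. dist x p < d2 \<longrightarrow> dist (?D v u x) (?D v u p) < e"
      using c[of v u] e unfolding continuous_at_eps_delta by meson
    define m where "m = min r (min d1 d2)"
    have m: "m > 0" using r d1 d2 by (simp add: m_def)
    define h where "h = m / (2 * (norm u + norm v + 1))"
    have nn: "norm u + norm v + 1 > 0" by (simp add: add_nonneg_pos)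
    have h: "h > 0" using m nn by (simp add: h_def)
    have near: "dist (p + s *\<^sub>R a + t *\<^sub>R b) p < m"
      if "0 \<le> s" "s \<le> h" "0 \<le> t" "t \<le> h" "norm a + norm b = norm u + norm v" for s t a b
    proof -
      have "dist (p + s *\<^sub>R a + t *\<^sub>R b) p \<le> norm (s *\<^sub>R a) + norm (t *\<^sub>R b)"
        by (simp add: dist_norm) (metis add.assoc add_diff_cancel_left' norm_triangle_ineq norm_scaleR)
      also have "\<dots> \<le> h * norm a + h * norm b"
        using that by (intro add_mono) (auto intro: mult_right_mono)
      also have "\<dots> < h * (norm u + norm v + 1)" using h by (simp add: that(5) flip: distrib_left)
      also have "\<dots> = m / 2" using nn unfolding h_def by (simp add: divide_simps)
      finally show ?thesis using m by simp
    qed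
    have inW: "p + s *\<^sub>R a + t *\<^sub>R b \<in> W"
      if "0 \<le> s" "s \<le> h" "0 \<le> t" "t \<le> h" "norm a + norm b = norm u + norm v" for s t a b
      using near[OF that] r(2) by (auto simp: m_def dist_commute)
    obtain s t where 1: "0 \<le> s" "s \<le> h" "0 \<le> t" "t \<le> h"
      "F (p + h *\<^sub>R u + h *\<^sub>R v) - F (p + h *\<^sub>R u) - F (p + h *\<^sub>R v) + F p = h * h * ?D u v (p + s *\<^sub>R u + t *\<^sub>R v)"
      by (rule second_difference_mean_value[OF F h, of p u v]) (use inW in auto)
    obtain s' t' where 2: "0 \<le> s'" "s' \<le> h" "0 \<le> t'" "t' \<le> h"
      "F (p + h *\<^sub>R v + h *\<^sub>R u) - F (p + h *\<^sub>R v) - F (p + h *\<^sub>R u) + F p = h * h * ?D v u (p + s' *\<^sub>R v + t' *\<^sub>R u)"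
      by (rule second_difference_mean_value[OF F h, of p v u]) (use inW in \<open>auto simp: add.commute\<close>)
    have "h * h * ?D u v (p + s *\<^sub>R u + t *\<^sub>R v) = h * h * ?D v u (p + s' *\<^sub>R v + t' *\<^sub>R u)"
      using 1(5) 2(5) by (simp only: add_ac)
    then have "?D u v (p + s *\<^sub>R u + t *\<^sub>R v) = ?D v u (p + s' *\<^sub>R v + t' *\<^sub>R u)" using h by simp
    moreover have "dist (?D u v (p + s *\<^sub>R u + t *\<^sub>R v)) (?D u v p) < e"
      using d1(2) near[OF 1(1-4), of u v] by (auto simp: m_def)
    moreover have "dist (?D v u (p + s' *\<^sub>R v + t' *\<^sub>R u)) (?D v u p) < e"
      using d2(2) near[OF 2(1-4), of v u] by (auto simp: m_def)
    ultimately show ?thesis unfolding dist_real_def by linarith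
  qed
  have "\<bar>?D u v p - ?D v u p\<bar> \<le> 0 + e" if "e > 0" for e using close[of "e / 2"] that by simp
  then have "\<bar>?D u v p - ?D v u p\<bar> \<le> 0" using field_le_epsilon by blast
  then show ?thesis by simp
qed

lemma second_derivative_symmetric:
  fixes F :: "'a::euclidean_space \<Rightarrow> 'b::euclidean_space"
  assumes F: "smooth_on_open W F" and p: "p \<in> W"
  shows "frechet_derivative (\<lambda>x. frechet_derivative F (at x) u) (at p) v =
         frechet_derivative (\<lambda>x. frechet_derivative F (at x) v) (at p) u"
proof (rule euclidean_eqI)
  fix b :: 'b assume "b \<in> Basis"
  have o: "open W" using F by (simp add: smooth_on_open_def)
  have Fb: "smooth_on_open W (\<lambda>x. F x \<bullet> b)"
    by (rule smooth_on_open_bounded_linear[OF bounded_linear_inner_left F])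
  have c: "frechet_derivative (\<lambda>x. f x \<bullet> b) (at x) v = frechet_derivative f (at x) v \<bullet> b"
    if "smooth_on_open W f" "x \<in> W" for f :: "'a \<Rightarrow> 'b" and x v
    by (simp add: frechet_derivative_at[OF
          has_derivative_inner_left[OF smooth_on_open_derivative[OF that]], symmetric])
  have "frechet_derivative (\<lambda>x. frechet_derivative F (at x) u) (at p) v \<bullet> b =
    frechet_derivative (\<lambda>x. frechet_derivative (\<lambda>x. F x \<bullet> b) (at x) u) (at p) v" for u v
  proof -
    have "frechet_derivative (\<lambda>x. frechet_derivative (\<lambda>x. F x \<bullet> b) (at x) u) (at p) =
          frechet_derivative (\<lambda>x. frechet_derivative F (at x) u \<bullet> b) (at p)"
      by (rule frechet_derivative_cong_open[OF o p]) (rule c[OF F])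
    then show ?thesis
      by (simp only: c[OF smooth_on_open_frechet_derivative[OF F smooth_on_open_const[OF o]] p])
  qed
  then show "frechet_derivative (\<lambda>x. frechet_derivative F (at x) u) (at p) v \<bullet> b =
      frechet_derivative (\<lambda>x. frechet_derivative F (at x) v) (at p) u \<bullet> b"
    using second_derivative_symmetric_real[OF Fb p, of u v] by simp
qed

section \<open>Directional derivatives along a subset\<close>

text \<open>The value of a derivative within \<open>S\<close> on a tangent vector is visible along a curve in \<open>S\<close>.  Hence
  it is unique, although the derivative is not.\<close>

lemma tangent_curve_has_vector_derivative:
  assumes "(f has_derivative f') (at p within S)" "0 < (e::real)" "c ` {-e<..<e} \<subseteq> S" "c 0 = p"
    "(c has_vector_derivative v) (at 0)"
  shows "((\<lambda>t. f (c t)) has_vector_derivative f' v) (at 0)"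
proof -
  have 0: "(0::real) \<in> {-e<..<e}" using assms(2) by simp
  interpret f': bounded_linear f' using assms(1) has_derivative_bounded_linear by blast
  have c: "(c has_derivative (\<lambda>t. t *\<^sub>R v)) (at 0 within {-e<..<e})"
    using assms(5) by (simp add: has_vector_derivative_def has_derivative_at_withinI)
  have "(f has_derivative f') (at (c 0) within c ` {-e<..<e})"
    using has_derivative_subset[OF assms(1,3)] assms(4) by simp
  from has_derivative_in_compose[OF c this]
  have "((\<lambda>t. f (c t)) has_derivative (\<lambda>t. t *\<^sub>R f' v)) (at 0 within {-e<..<e})"
    by (simp add: f'.scaleR)
  then show ?thesis
    by (simp add: has_vector_derivative_def at_within_open[OF 0])
qed

lemma tangentI:
  "0 < (e::real) \<Longrightarrow> smooth_on_open {-e<..<e} c \<Longrightarrow> c ` {-e<..<e} \<subseteq> S \<Longrightarrow> c 0 = p \<Longrightarrow>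
    (c has_vector_derivative v) (at 0) \<Longrightarrow> v \<in> tangent S p"
  unfolding tangent_def by blast

lemma tangentE:
  assumes "v \<in> tangent S p"
  obtains c and e :: real where "0 < e" "smooth_on_open {-e<..<e} c" "c ` {-e<..<e} \<subseteq> S" "c 0 = p"
    "(c has_vector_derivative v) (at 0)"
  using assms unfolding tangent_def by blast

lemma dir_deriv_eq:
  assumes "(f has_derivative f') (at p within S)" "v \<in> tangent S p"
  shows "dir_deriv S f p v = f' v"
  unfolding dir_deriv_def
proof (rule the_equality)
  show "\<exists>f'a. (f has_derivative f'a) (at p within S) \<and> f' v = f'a v" using assms(1) by auto
next
  fix w assume "\<exists>f'. (f has_derivative f') (at p within S) \<and> w = f' v"
  then obtain f2 where f2: "(f has_derivative f2) (at p within S)" "w = f2 v" by auto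
  obtain c and e :: real where c: "0 < e" "smooth_on_open {-e<..<e} c" "c ` {-e<..<e} \<subseteq> S" "c 0 = p"
    "(c has_vector_derivative v) (at 0)"
    using assms(2) by (rule tangentE)
  show "w = f' v" unfolding f2(2)
    using tangent_curve_has_vector_derivative[OF assms(1) c(1,3,4,5)]
      tangent_curve_has_vector_derivative[OF f2(1) c(1,3,4,5)] by (rule vector_derivative_unique_at[rotated])
qed

lemma tangent_mono: "S \<subseteq> T \<Longrightarrow> tangent S p \<subseteq> tangent T p"
  by (auto elim!: tangentE intro!: tangentI)

lemma tangent_openin:
  assumes "openin (top_of_set S) U" "p \<in> U"
  shows "tangent U p = tangent S p"
proof
  show "tangent U p \<subseteq> tangent S p" using assms(1) by (intro tangent_mono openin_imp_subset)
  show "tangent S p \<subseteq> tangent U p"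
  proof
    fix v assume "v \<in> tangent S p"
    then obtain c and e :: real where c: "0 < e" "smooth_on_open {-e<..<e} c" "c ` {-e<..<e} \<subseteq> S" "c 0 = p"
      "(c has_vector_derivative v) (at 0)" by (rule tangentE)
    obtain T where T: "open T" "U = S \<inter> T" using assms(1) by (auto simp: openin_open)
    have "open ({-e<..<e} \<inter> c -` T)"
      by (rule continuous_open_preimage[OF smooth_on_open_continuous[OF c(2)]]) (use T in auto)
    moreover have "0 \<in> {-e<..<e} \<inter> c -` T" using c assms(2) T by auto
    ultimately obtain d where d: "d > 0" "ball 0 d \<subseteq> {-e<..<e} \<inter> c -` T"
      by (rule openE)
    have b: "ball 0 d = {-d<..<d::real}" by (auto simp: dist_real_def)
    show "v \<in> tangent U p"
      using c d smooth_on_open_subset[OF c(2), of "{-d<..<d}"]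
      unfolding b by (intro tangentI[of d c]) (auto simp: T)
  qed
qed

lemma extension_has_derivative:
  assumes "open W" "smooth_on_open W F" "\<forall>q\<in>S \<inter> W. F q = f q" "q \<in> S" "q \<in> W"
  shows "(f has_derivative frechet_derivative F (at q)) (at q within S)"
proof -
  have "(F has_derivative frechet_derivative F (at q)) (at q within S)"
    using smooth_on_open_derivative[OF assms(2,5)] has_derivative_at_withinI by blast
  moreover obtain e where "e > 0" "ball q e \<subseteq> W" using assms(1,5) openE by blast
  ultimately show ?thesis
    using assms(3,4)
    by (elim has_derivative_transform_within[where d=e]) (auto simp: dist_commute subset_iff)
qed

lemma smooth_dir_deriv:
  assumes "smooth_map S f" "p \<in> S"
  obtains f' where "(f has_derivative f') (at p within S)" "linear f'"
    "\<forall>v\<in>tangent S p. dir_deriv S f p v = f' v"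
proof -
  obtain f' where f': "(f has_derivative f') (at p within S)"
    by (rule smooth_map_has_derivative[OF assms])
  show ?thesis using dir_deriv_eq[OF f'] by (intro that[OF f' has_derivative_linear[OF f']] ballI)
qed

lemma dir_deriv_cong:
  assumes "p \<in> S" "\<And>q. q \<in> S \<Longrightarrow> f q = g q"
  shows "dir_deriv S f p v = dir_deriv S g p v"
proof -
  have "(f has_derivative f') (at p within S) \<longleftrightarrow> (g has_derivative f') (at p within S)" for f'
    using has_derivative_transform[OF assms(1), of g f f'] has_derivative_transform[OF assms(1), of f g f']
      assms(2) by auto
  then show ?thesis by (simp add: dir_deriv_def)
qed

lemma dir_deriv_subset:
  assumes "smooth_map S f" "T \<subseteq> S" "p \<in> T" "v \<in> tangent T p"
  shows "dir_deriv T f p v = dir_deriv S f p v"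
proof -
  obtain f' where f': "(f has_derivative f') (at p within S)"
    by (rule smooth_map_has_derivative[OF assms(1)]) (use assms in auto)
  show ?thesis
    by (simp add: dir_deriv_eq[OF f' subsetD[OF tangent_mono[OF assms(2)] assms(4)]]
        dir_deriv_eq[OF has_derivative_subset[OF f' assms(2)] assms(4)])
qed

lemma dir_deriv_const: "v \<in> tangent S p \<Longrightarrow> dir_deriv S (\<lambda>q. c) p v = 0"
  by (rule dir_deriv_eq[OF has_derivative_const])

lemma dir_deriv_bounded_linear:
  assumes "bounded_linear L" "smooth_map S f" "p \<in> S" "v \<in> tangent S p"
  shows "dir_deriv S (\<lambda>q. L (f q)) p v = L (dir_deriv S f p v)"
proof -
  obtain f' where f': "(f has_derivative f') (at p within S)"
    by (rule smooth_map_has_derivative[OF assms(2,3)])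
  show ?thesis
    by (simp add: dir_deriv_eq[OF f' assms(4)]
        dir_deriv_eq[OF bounded_linear.has_derivative[OF assms(1) f'] assms(4)])
qed

lemma dir_deriv_bilinear:
  assumes "bounded_bilinear B" "smooth_map S f" "smooth_map S g" "p \<in> S" "v \<in> tangent S p"
  shows "dir_deriv S (\<lambda>q. B (f q) (g q)) p v =
    B (dir_deriv S f p v) (g p) + B (f p) (dir_deriv S g p v)"
proof -
  obtain f' where f': "(f has_derivative f') (at p within S)"
    by (rule smooth_map_has_derivative[OF assms(2,4)])
  obtain g' where g': "(g has_derivative g') (at p within S)"
    by (rule smooth_map_has_derivative[OF assms(3,4)])
  show ?thesis
    by (simp add: dir_deriv_eq[OF f' assms(5)] dir_deriv_eq[OF g' assms(5)]
        dir_deriv_eq[OF bounded_bilinear.FDERIV[OF assms(1) f' g'] assms(5)])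
qed

lemma dir_deriv_add:
  assumes "smooth_map S f" "smooth_map S g" "p \<in> S" "v \<in> tangent S p"
  shows "dir_deriv S (\<lambda>q. f q + g q) p v = dir_deriv S f p v + dir_deriv S g p v"
proof -
  obtain f' where f': "(f has_derivative f') (at p within S)"
    by (rule smooth_map_has_derivative[OF assms(1,3)])
  obtain g' where g': "(g has_derivative g') (at p within S)"
    by (rule smooth_map_has_derivative[OF assms(2,3)])
  show ?thesis
    by (simp add: dir_deriv_eq[OF f' assms(4)] dir_deriv_eq[OF g' assms(4)]
        dir_deriv_eq[OF has_derivative_add[OF f' g'] assms(4)])
qed

lemma dir_deriv_minus:
  "smooth_map S f \<Longrightarrow> p \<in> S \<Longrightarrow> v \<in> tangent S p \<Longrightarrow>
    dir_deriv S (\<lambda>q. - f q) p v = - dir_deriv S f p v"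
  by (rule dir_deriv_bounded_linear[OF bounded_linear_minus[OF bounded_linear_ident]])

lemma dir_deriv_diff:
  "smooth_map S f \<Longrightarrow> smooth_map S g \<Longrightarrow> p \<in> S \<Longrightarrow> v \<in> tangent S p \<Longrightarrow>
    dir_deriv S (\<lambda>q. f q - g q) p v = dir_deriv S f p v - dir_deriv S g p v"
  using dir_deriv_add[OF _ smooth_map_minus, of S f g p v] dir_deriv_minus[of S g p v] by simp

lemma dir_deriv_sum:
  "finite I \<Longrightarrow> (\<And>i. i \<in> I \<Longrightarrow> smooth_map S (f i)) \<Longrightarrow> p \<in> S \<Longrightarrow> v \<in> tangent S p \<Longrightarrow>
    dir_deriv S (\<lambda>q. \<Sum>i\<in>I. f i q) p v = (\<Sum>i\<in>I. dir_deriv S (f i) p v)"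
  by (induction I rule: finite_induct)
    (simp_all add: dir_deriv_const dir_deriv_add smooth_map_sum)

lemmas dir_deriv_scaleR = dir_deriv_bilinear[OF bounded_bilinear_scaleR]
lemmas dir_deriv_mult = dir_deriv_bilinear[OF bounded_bilinear_mult]
lemmas dir_deriv_inner = dir_deriv_bilinear[OF bounded_bilinear_inner]

text \<open>Product rule for a differential applied to a varying direction; the symmetry of the second
  derivative allows the direction \<open>v\<close> to be taken inside.\<close>

lemma frechet_derivative_field_has_derivative:
  assumes W: "open W" and F: "smooth_on_open W F" and Y: "smooth_on_open W Y" and p: "p \<in> W"
  shows "((\<lambda>q. frechet_derivative F (at q) (Y q)) has_derivative
     (\<lambda>v. frechet_derivative (\<lambda>q. frechet_derivative F (at q) v) (at p) (Y p) +
          frechet_derivative F (at p) (frechet_derivative Y (at p) v))) (at p)"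
proof -
  have lin: "linear (frechet_derivative F (at q))" if "q \<in> W" for q
    using smooth_on_open_derivative[OF F that] has_derivative_linear by blast
  have sm: "smooth_on_open W (\<lambda>q. frechet_derivative F (at q) b)" for b
    by (rule smooth_on_open_frechet_derivative[OF F smooth_on_open_const[OF W]])
  let ?H = "\<lambda>u v. frechet_derivative (\<lambda>q. frechet_derivative F (at q) u) (at p) v"
  have sym: "?H u v = ?H v u" for u v by (rule second_derivative_symmetric[OF F p])
  have linH: "linear (?H u)" for u
    using smooth_on_open_derivative[OF sm p] has_derivative_linear by blast
  have rep: "L y = (\<Sum>b\<in>Basis. (y \<bullet> b) *\<^sub>R L b)" if "linear L" for L :: "'a \<Rightarrow> 'b" and y
  proof -
    have "L y = L (\<Sum>b\<in>Basis. (y \<bullet> b) *\<^sub>R b)" by (simp only: euclidean_representation)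
    then show ?thesis by (simp only: linear_sum[OF that] linear_cmul[OF that])
  qed
  have "((\<lambda>q. \<Sum>b\<in>Basis. (Y q \<bullet> b) *\<^sub>R frechet_derivative F (at q) b) has_derivative
     (\<lambda>v. \<Sum>b\<in>Basis. (Y p \<bullet> b) *\<^sub>R ?H b v + (frechet_derivative Y (at p) v \<bullet> b) *\<^sub>R frechet_derivative F (at p) b)) (at p)"
    by (intro has_derivative_sum has_derivative_scaleR has_derivative_inner_left
        smooth_on_open_derivative[OF Y p] smooth_on_open_derivative[OF sm p])
  also have "(\<lambda>v. \<Sum>b\<in>Basis. (Y p \<bullet> b) *\<^sub>R ?H b v + (frechet_derivative Y (at p) v \<bullet> b) *\<^sub>R frechet_derivative F (at p) b)
     = (\<lambda>v. ?H v (Y p) + frechet_derivative F (at p) (frechet_derivative Y (at p) v))"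
    by (simp add: sum.distrib rep[OF lin[OF p], symmetric] sym[of _ "_::'a"] rep[OF linH, symmetric] fun_eq_iff)
  finally show ?thesis
    by (rule has_derivative_transform_within_open[OF _ W p]) (simp add: rep[OF lin, symmetric])
qed

lemma common_extension:
  assumes "smooth_map S f" "smooth_map S g" "p \<in> S"
  obtains W F G where "p \<in> W" "open W" "smooth_on_open W F" "\<forall>q\<in>S \<inter> W. F q = f q"
    "smooth_on_open W G" "\<forall>q\<in>S \<inter> W. G q = g q"
proof -
  obtain W F where w: "p \<in> W" "open W" "smooth_on_open W F" "\<forall>q\<in>S \<inter> W. F q = f q"
    by (rule smooth_map_extension[OF assms(1,3)])
  obtain V G where v: "p \<in> V" "open V" "smooth_on_open V G" "\<forall>q\<in>S \<inter> V. G q = g q"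
    by (rule smooth_map_extension[OF assms(2,3)])
  have o: "open (W \<inter> V)" using w v by auto
  show ?thesis
    by (rule that[of "W \<inter> V" F G])
      (use w v o smooth_on_open_subset[OF w(3) o] smooth_on_open_subset[OF v(3) o] in auto)
qed

lemma smooth_map_dir_deriv:
  assumes "smooth_map S f" "smooth_map S Y" "\<And>q. q \<in> S \<Longrightarrow> Y q \<in> tangent S q"
  shows "smooth_map S (\<lambda>q. dir_deriv S f q (Y q))"
proof (rule smooth_mapI)
  fix p assume p: "p \<in> S"
  obtain W F G where w: "p \<in> W" "open W" "smooth_on_open W F" "\<forall>q\<in>S \<inter> W. F q = f q"
    "smooth_on_open W G" "\<forall>q\<in>S \<inter> W. G q = Y q"
    by (rule common_extension[OF assms(1,2) p])
  have "frechet_derivative F (at q) (G q) = dir_deriv S f q (Y q)" if "q \<in> S" "q \<in> W" for q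
    using dir_deriv_eq[OF extension_has_derivative[OF w(2-4) that] assms(3)[OF that(1)]] w(6) that by auto
  then show "\<exists>W g. p \<in> W \<and> smooth_on_open W g \<and> (\<forall>q\<in>S \<inter> W. g q = dir_deriv S f q (Y q))"
    using w(1) smooth_on_open_frechet_derivative[OF w(3,5)]
    by (intro exI[of _ W] exI[of _ "\<lambda>q. frechet_derivative F (at q) (G q)"]) auto
qed

text \<open>The commutator of two derivations along \<open>S\<close> is the derivation along the Lie bracket.  At this
  stage the bracket is not yet known to be tangent, so the derivation is that of an extension.\<close>

lemma dir_deriv_commute_extension:
  assumes F: "open W1" "smooth_on_open W1 F" "\<forall>q\<in>S \<inter> W1. F q = f q" and p: "p \<in> S" "p \<in> W1"
    and X: "vfield S X" and Y: "vfield S Y"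
  shows "dir_deriv S (\<lambda>q. dir_deriv S f q (Y q)) p (X p) - dir_deriv S (\<lambda>q. dir_deriv S f q (X q)) p (Y p)
     = frechet_derivative F (at p) (lie S X Y p)"
proof -
  have sX: "smooth_map S X" "\<And>q. q \<in> S \<Longrightarrow> X q \<in> tangent S q"
    and sY: "smooth_map S Y" "\<And>q. q \<in> S \<Longrightarrow> Y q \<in> tangent S q"
    using X Y by (auto simp: vfield_def)
  have second: "dir_deriv S (\<lambda>q. dir_deriv S f q (Y q)) p v =
      frechet_derivative (\<lambda>q. frechet_derivative F (at q) v) (at p) (Y p) +
      frechet_derivative F (at p) (dir_deriv S Y p v)"
    if sY: "smooth_map S Y" "\<And>q. q \<in> S \<Longrightarrow> Y q \<in> tangent S q" and v: "v \<in> tangent S p" for Y v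
  proof -
    obtain W2 G where w2: "p \<in> W2" "open W2" "smooth_on_open W2 G" "\<forall>q\<in>S \<inter> W2. G q = Y q"
      by (rule smooth_map_extension[OF sY(1) p(1)])
    define W where "W = W1 \<inter> W2"
    have W: "open W" "p \<in> W" using F(1) p w2 by (auto simp: W_def)
    have FW: "smooth_on_open W F" and GW: "smooth_on_open W G"
      using smooth_on_open_subset[OF F(2) W(1)] smooth_on_open_subset[OF w2(3) W(1)] by (auto simp: W_def)
    have e: "\<forall>q\<in>S \<inter> W. frechet_derivative F (at q) (G q) = dir_deriv S f q (Y q)"
    proof
      fix q assume q: "q \<in> S \<inter> W"
      then have "q \<in> S" "q \<in> W1" by (auto simp: W_def)
      from dir_deriv_eq[OF extension_has_derivative[OF F this] sY(2)[OF this(1)]]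
      show "frechet_derivative F (at q) (G q) = dir_deriv S f q (Y q)"
        using w2(4) q by (auto simp: W_def)
    qed
    have d1: "((\<lambda>q. dir_deriv S f q (Y q)) has_derivative
        frechet_derivative (\<lambda>q. frechet_derivative F (at q) (G q)) (at p)) (at p within S)"
      by (rule extension_has_derivative[OF W(1) smooth_on_open_frechet_derivative[OF FW GW] e p(1) W(2)])
    have d2: "dir_deriv S Y p v = frechet_derivative G (at p) v"
      by (rule dir_deriv_eq[OF extension_has_derivative[OF w2(2-4) p(1) w2(1)] v])
    show ?thesis
      using w2(4) p(1) w2(1)
      by (simp add: dir_deriv_eq[OF d1 v] d2
          frechet_derivative_at[OF frechet_derivative_field_has_derivative[OF W(1) FW GW W(2)], symmetric])
  qed
  have lin: "linear (frechet_derivative F (at p))"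
    using smooth_on_open_derivative[OF F(2) p(2)] has_derivative_linear by blast
  show ?thesis
    using second_derivative_symmetric[OF F(2) p(2), of "X p" "Y p"]
    by (simp add: second[OF sY sX(2)[OF p(1)]] second[OF sX sY(2)[OF p(1)]] lie_def linear_diff[OF lin])
qed

lemma dir_deriv_commute:
  assumes f: "smooth_map S f" and X: "vfield S X" and Y: "vfield S Y" and p: "p \<in> S"
    and tan: "lie S X Y p \<in> tangent S p"
  shows "dir_deriv S (\<lambda>q. dir_deriv S f q (Y q)) p (X p) - dir_deriv S (\<lambda>q. dir_deriv S f q (X q)) p (Y p)
     = dir_deriv S f p (lie S X Y p)"
proof -
  obtain W F where w: "p \<in> W" "open W" "smooth_on_open W F" "\<forall>q\<in>S \<inter> W. F q = f q"
    by (rule smooth_map_extension[OF f p])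
  show ?thesis
    using dir_deriv_commute_extension[OF w(2-4) p w(1) X Y]
      dir_deriv_eq[OF extension_has_derivative[OF w(2-4) p w(1)] tan] by simp
qed

section \<open>The Levi-Civita connection of a submanifold as the projected derivative\<close>

text \<open>A smooth field of orthogonal projectors onto the tangent spaces carries the whole intrinsic
  geometry.  It also extends a tangent vector \<open>x\<close> at \<open>p\<close> to the global field \<open>q \<mapsto> P q x\<close>, which is how
  identities between fields become identities between vectors.\<close>

locale projected_manifold =
  fixes S :: "'a::euclidean_space set" and P :: "'a \<Rightarrow> 'a \<Rightarrow> 'a"
  assumes P_smooth: "\<And>v. smooth_map S (\<lambda>q. P q v)"
    and P_linear: "\<And>p. p \<in> S \<Longrightarrow> linear (P p)"
    and P_tangent: "\<And>p v. p \<in> S \<Longrightarrow> P p v \<in> tangent S p"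
    and P_id: "\<And>p v. p \<in> S \<Longrightarrow> v \<in> tangent S p \<Longrightarrow> P p v = v"
    and P_sym: "\<And>p v w. p \<in> S \<Longrightarrow> P p v \<bullet> w = v \<bullet> P p w"
    and lie_tangent: "\<And>X Y p. vfield S X \<Longrightarrow> vfield S Y \<Longrightarrow> p \<in> S \<Longrightarrow> lie S X Y p \<in> tangent S p"
begin

definition DP :: "'a \<Rightarrow> 'a \<Rightarrow> 'a \<Rightarrow> 'a" where
  "DP p x v = dir_deriv S (\<lambda>q. P q v) p x"

text \<open>The covariant derivative in the direction of a single vector: tensor identities can then be
  stated at a point.\<close>

definition cov :: "('a \<Rightarrow> 'a) \<Rightarrow> 'a \<Rightarrow> 'a \<Rightarrow> 'a" where
  "cov Y p x = P p (dir_deriv S Y p x)"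

lemma subspace_tangent: "p \<in> S \<Longrightarrow> subspace (tangent S p)"
proof -
  assume p: "p \<in> S"
  have "v \<in> tangent S p \<longleftrightarrow> P p v = v" for v
    using P_id[OF p, of v] P_tangent[OF p, of v] by auto
  then have "tangent S p = {v. P p v = v}" by blast
  then show ?thesis
    by (simp add: subspace_def linear_0[OF P_linear[OF p]] linear_add[OF P_linear[OF p]] linear_cmul[OF P_linear[OF p]])
qed

lemma P_expand: "p \<in> S \<Longrightarrow> P p v = (\<Sum>b\<in>Basis. (v \<bullet> b) *\<^sub>R P p b)"
proof -
  assume p: "p \<in> S"
  have "P p v = P p (\<Sum>b\<in>Basis. (v \<bullet> b) *\<^sub>R b)" by (simp only: euclidean_representation)
  then show ?thesis by (simp only: linear_sum[OF P_linear[OF p]] linear_cmul[OF P_linear[OF p]])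
qed

lemma smooth_map_P:
  assumes "smooth_map S V"
  shows "smooth_map S (\<lambda>q. P q (V q))"
proof (rule smooth_map_cong)
  show "smooth_map S (\<lambda>q. \<Sum>b\<in>Basis. (V q \<bullet> b) *\<^sub>R P q b)"
    by (intro smooth_map_sum finite_Basis smooth_map_scaleR P_smooth smooth_map_inner assms smooth_map_const)
qed (rule P_expand[symmetric])

lemma vfield_P: "smooth_map S V \<Longrightarrow> vfield S (\<lambda>q. P q (V q))"
  by (simp add: vfield_def smooth_map_P P_tangent)

lemma vfieldD: "vfield S X \<Longrightarrow> smooth_map S X" "vfield S X \<Longrightarrow> p \<in> S \<Longrightarrow> X p \<in> tangent S p"
  by (simp_all add: vfield_def)

lemma vfield_add: "vfield S X \<Longrightarrow> vfield S Y \<Longrightarrow> vfield S (\<lambda>q. X q + Y q)"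
  by (simp add: vfield_def smooth_map_add subspace_add[OF subspace_tangent])

lemma vfield_diff: "vfield S X \<Longrightarrow> vfield S Y \<Longrightarrow> vfield S (\<lambda>q. X q - Y q)"
  by (simp add: vfield_def smooth_map_diff subspace_diff[OF subspace_tangent])

lemma vfield_scaleR: "smooth_map S f \<Longrightarrow> vfield S Y \<Longrightarrow> vfield S (\<lambda>q. f q *\<^sub>R Y q)"
  by (simp add: vfield_def smooth_map_scaleR subspace_scale[OF subspace_tangent])

lemma tangent_extend:
  assumes "p \<in> S" "x \<in> tangent S p"
  obtains X where "vfield S X" "X p = x"
  using that[OF vfield_P[OF smooth_map_const, of x]] P_id[OF assms] by simp

lemma dir_deriv_linear:
  assumes "smooth_map S f" "p \<in> S" "x \<in> tangent S p" "y \<in> tangent S p"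
  shows "dir_deriv S f p (a *\<^sub>R x + b *\<^sub>R y) = a *\<^sub>R dir_deriv S f p x + b *\<^sub>R dir_deriv S f p y"
proof -
  obtain f' where f': "(f has_derivative f') (at p within S)" "linear f'"
    "\<forall>v\<in>tangent S p. dir_deriv S f p v = f' v" by (rule smooth_dir_deriv[OF assms(1,2)])
  have "a *\<^sub>R x + b *\<^sub>R y \<in> tangent S p"
    using assms subspace_tangent by (simp add: subspace_add subspace_scale)
  then show ?thesis using f' assms by (simp add: linear_add linear_cmul)
qed

lemma dir_deriv_dir_add:
  "smooth_map S f \<Longrightarrow> p \<in> S \<Longrightarrow> x \<in> tangent S p \<Longrightarrow> y \<in> tangent S p \<Longrightarrow>
    dir_deriv S f p (x + y) = dir_deriv S f p x + dir_deriv S f p y"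
  using dir_deriv_linear[of f p x y 1 1] by simp

lemma dir_deriv_dir_scaleR:
  "smooth_map S f \<Longrightarrow> p \<in> S \<Longrightarrow> x \<in> tangent S p \<Longrightarrow>
    dir_deriv S f p (a *\<^sub>R x) = a *\<^sub>R dir_deriv S f p x"
  using dir_deriv_linear[of f p x x a 0] by simp

lemma P_P: "p \<in> S \<Longrightarrow> P p (P p v) = P p v"
  by (rule P_id[OF _ P_tangent])

lemma DP_linear: assumes "p \<in> S" "x \<in> tangent S p" shows "linear (DP p x)"
proof
  fix v w :: 'a and c :: real
  have "DP p x (v + w) = dir_deriv S (\<lambda>q. P q v + P q w) p x"
    unfolding DP_def using assms(1) by (intro dir_deriv_cong) (simp_all add: linear_add[OF P_linear])
  then show "DP p x (v + w) = DP p x v + DP p x w"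
    by (simp add: DP_def dir_deriv_add[OF P_smooth P_smooth assms])
  have "DP p x (c *\<^sub>R v) = dir_deriv S (\<lambda>q. c *\<^sub>R P q v) p x"
    unfolding DP_def using assms(1) by (intro dir_deriv_cong) (simp_all add: linear_cmul[OF P_linear])
  then show "DP p x (c *\<^sub>R v) = c *\<^sub>R DP p x v"
    by (simp add: DP_def dir_deriv_scaleR[OF smooth_map_const P_smooth assms] dir_deriv_const[OF assms(2)])
qed

lemma dir_deriv_P:
  assumes V: "smooth_map S V" and p: "p \<in> S" and x: "x \<in> tangent S p"
  shows "dir_deriv S (\<lambda>q. P q (V q)) p x = DP p x (V p) + P p (dir_deriv S V p x)"
proof -
  have "dir_deriv S (\<lambda>q. P q (V q)) p x = dir_deriv S (\<lambda>q. \<Sum>b\<in>Basis. (V q \<bullet> b) *\<^sub>R P q b) p x"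
    by (rule dir_deriv_cong[OF p P_expand])
  also have "\<dots> = (\<Sum>b\<in>Basis. dir_deriv S (\<lambda>q. (V q \<bullet> b) *\<^sub>R P q b) p x)"
    by (intro dir_deriv_sum finite_Basis p x smooth_map_scaleR P_smooth smooth_map_inner V smooth_map_const)
  also have "\<dots> = (\<Sum>b\<in>Basis. (V p \<bullet> b) *\<^sub>R DP p x b + (dir_deriv S V p x \<bullet> b) *\<^sub>R P p b)"
    by (simp add: dir_deriv_scaleR[OF smooth_map_inner[OF V smooth_map_const] P_smooth p x] DP_def
        dir_deriv_inner[OF V smooth_map_const p x] dir_deriv_const[OF x] add.commute)
  also have "\<dots> = DP p x (\<Sum>b\<in>Basis. (V p \<bullet> b) *\<^sub>R b) + P p (dir_deriv S V p x)"
    by (simp add: sum.distrib P_expand[OF p, symmetric] linear_sum[OF DP_linear[OF p x]]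
        linear_cmul[OF DP_linear[OF p x]] del: euclidean_representation)
  finally show ?thesis by (simp add: euclidean_representation)
qed

text \<open>Differentiating \<open>P P = P\<close> shows that the derivative of the projector has no tangential block.\<close>

lemma P_DP_P: assumes p: "p \<in> S" and x: "x \<in> tangent S p" shows "P p (DP p x (P p v)) = 0"
proof -
  have "DP p x (P p v) + P p (DP p x v) = DP p x v"
    using dir_deriv_P[OF P_smooth p x, of v] dir_deriv_cong[OF p, of "\<lambda>q. P q (P q v)" "\<lambda>q. P q v" x] P_P
    by (simp add: DP_def)
  then have "P p (DP p x (P p v)) + P p (P p (DP p x v)) = P p (DP p x v)"
    by (metis linear_add[OF P_linear[OF p]])
  then show ?thesis by (simp add: P_P[OF p])
qed

lemma vfield_cov: "vfield S X \<Longrightarrow> vfield S Y \<Longrightarrow> vfield S (\<lambda>q. cov Y q (X q))"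
  unfolding cov_def by (intro vfield_P smooth_map_dir_deriv) (simp_all add: vfield_def)

lemma cov_tangent: "p \<in> S \<Longrightarrow> cov Y p x \<in> tangent S p"
  by (simp add: cov_def P_tangent)

lemma cov_add:
  "vfield S Y \<Longrightarrow> vfield S Z \<Longrightarrow> p \<in> S \<Longrightarrow> x \<in> tangent S p \<Longrightarrow>
    cov (\<lambda>q. Y q + Z q) p x = cov Y p x + cov Z p x"
  by (simp add: cov_def vfieldD dir_deriv_add linear_add[OF P_linear])

lemma cov_diff:
  "vfield S Y \<Longrightarrow> vfield S Z \<Longrightarrow> p \<in> S \<Longrightarrow> x \<in> tangent S p \<Longrightarrow>
    cov (\<lambda>q. Y q - Z q) p x = cov Y p x - cov Z p x"
  by (simp add: cov_def vfieldD dir_deriv_diff linear_diff[OF P_linear])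

lemma cov_scaleR:
  "smooth_map S f \<Longrightarrow> vfield S Y \<Longrightarrow> p \<in> S \<Longrightarrow> x \<in> tangent S p \<Longrightarrow>
    cov (\<lambda>q. f q *\<^sub>R Y q) p x = dir_deriv S f p x *\<^sub>R Y p + f p *\<^sub>R cov Y p x"
  by (simp add: cov_def vfieldD dir_deriv_scaleR linear_add[OF P_linear] linear_cmul[OF P_linear] P_id)

lemma cov_cong: "p \<in> S \<Longrightarrow> (\<And>q. q \<in> S \<Longrightarrow> Y q = Z q) \<Longrightarrow> cov Y p x = cov Z p x"
  unfolding cov_def by (subst dir_deriv_cong[of p S Y Z]) simp_all

lemma cov_dir_add:
  "vfield S Y \<Longrightarrow> p \<in> S \<Longrightarrow> x \<in> tangent S p \<Longrightarrow> y \<in> tangent S p \<Longrightarrow>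
    cov Y p (x + y) = cov Y p x + cov Y p y"
  by (simp add: cov_def vfieldD dir_deriv_dir_add linear_add[OF P_linear])

lemma cov_dir_scaleR:
  "vfield S Y \<Longrightarrow> p \<in> S \<Longrightarrow> x \<in> tangent S p \<Longrightarrow> cov Y p (a *\<^sub>R x) = a *\<^sub>R cov Y p x"
  by (simp add: cov_def vfieldD dir_deriv_dir_scaleR linear_cmul[OF P_linear])

lemma cov_metric:
  assumes "vfield S Y" "vfield S Z" "p \<in> S" "x \<in> tangent S p"
  shows "dir_deriv S (\<lambda>q. Y q \<bullet> Z q) p x = cov Y p x \<bullet> Z p + Y p \<bullet> cov Z p x"
  using assms by (simp add: dir_deriv_inner vfieldD cov_def P_sym P_id) (metis P_id P_sym vfieldD(2))

lemma cov_torsion: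
  assumes "vfield S X" "vfield S Y" "p \<in> S"
  shows "cov Y p (X p) - cov X p (Y p) = lie S X Y p"
  using P_id[OF assms(3) lie_tangent[OF assms]]
  by (simp add: cov_def lie_def linear_diff[OF P_linear[OF assms(3)]])

lemma levi_civita_cov: "levi_civita S (\<lambda>x y. (x \<bullet> y) / 2) (\<lambda>X Y p. cov Y p (X p))"
  unfolding levi_civita_def affine_connection_def
proof (intro conjI allI impI ballI)
  fix X Y Z p assume *: "vfield S X" "vfield S Y" "vfield S Z" "p \<in> S"
  have "dir_deriv S (\<lambda>q. Y q \<bullet> Z q / 2) p (X p) = dir_deriv S (\<lambda>q. Y q \<bullet> Z q) p (X p) / 2"
    using * by (intro dir_deriv_bounded_linear bounded_linear_divide smooth_map_inner) (simp_all add: vfieldD)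
  then show "dir_deriv S (\<lambda>q. Y q \<bullet> Z q / 2) p (X p) =
      cov Y p (X p) \<bullet> Z p / 2 + Y p \<bullet> cov Z p (X p) / 2"
    using * by (simp add: cov_metric vfieldD)
qed (simp_all add: vfield_cov cov_torsion cov_add cov_scaleR cov_dir_add cov_dir_scaleR vfieldD)

text \<open>The difference of two Levi-Civita connections, paired with a third field, is symmetric in the first
  two arguments by the absence of torsion and skew in the last two by compatibility with the metric.
  Such a form vanishes.\<close>

lemma levi_civita_unique:
  assumes nab: "levi_civita S (\<lambda>x y. (x \<bullet> y) / 2) nab" and X: "vfield S X" and Y: "vfield S Y" and p: "p \<in> S"
  shows "nab X Y p = cov Y p (X p)"
proof -
  define d where "d X Y = nab X Y p - cov Y p (X p)" for X Y
  have sym: "d X Y = d Y X" if "vfield S X" "vfield S Y" for X Y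
  proof -
    have "nab X Y p - nab Y X p = lie S X Y p" using nab that p by (simp add: levi_civita_def)
    with cov_torsion[OF that p] show ?thesis by (simp add: d_def algebra_simps)
  qed
  have skew: "d X Y \<bullet> Z p = - (Y p \<bullet> d X Z)" if "vfield S X" "vfield S Y" "vfield S Z" for X Y Z
  proof -
    have "dir_deriv S (\<lambda>q. Y q \<bullet> Z q / 2) p (X p) = nab X Y p \<bullet> Z p / 2 + Y p \<bullet> nab X Z p / 2"
      using nab that p by (simp add: levi_civita_def)
    moreover have "dir_deriv S (\<lambda>q. Y q \<bullet> Z q / 2) p (X p) = cov Y p (X p) \<bullet> Z p / 2 + Y p \<bullet> cov Z p (X p) / 2"
      using levi_civita_cov that p by (simp add: levi_civita_def)
    ultimately show ?thesis by (simp add: d_def inner_diff_left inner_diff_right)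
  qed
  have zero: "d X Y \<bullet> Z p = 0" if "vfield S X" "vfield S Y" "vfield S Z" for X Y Z
    using skew[OF that] skew[OF that(2,3,1)] skew[OF that(3,1,2)] sym[OF that(1,2)] sym[OF that(2,3)] sym[OF that(1,3)]
    by (simp add: inner_commute)
  have "d X Y \<in> tangent S p"
    unfolding d_def
  proof (rule subspace_diff[OF subspace_tangent[OF p]])
    have "vfield S (nab X Y)" using nab X Y by (simp add: levi_civita_def affine_connection_def)
    then show "nab X Y p \<in> tangent S p" using p by (rule vfieldD)
  qed (rule cov_tangent[OF p])
  then obtain Z where "vfield S Z" "Z p = d X Y" by (rule tangent_extend[OF p])
  with zero[OF X Y] have "d X Y \<bullet> d X Y = 0" by metis
  then show ?thesis by (simp add: d_def)
qed

end

lemma fs_eq: "fs = (\<lambda>x y. (x \<bullet> y) / 2)"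
  by (simp add: fun_eq_iff fs_def)

locale projected_matrix_manifold = projected_manifold S P
  for S :: "(complex^'m::finite^'m) set" and P
begin

lemma levi_civita_nabla: "levi_civita S fs (nabla S)"
  unfolding nabla_def fs_eq by (rule someI[where P="levi_civita S _"], rule levi_civita_cov)

lemma nabla_eq: "vfield S X \<Longrightarrow> vfield S Y \<Longrightarrow> p \<in> S \<Longrightarrow> nabla S X Y p = cov Y p (X p)"
  by (rule levi_civita_unique[OF levi_civita_nabla[unfolded fs_eq]])

lemma vfield_nabla: "vfield S X \<Longrightarrow> vfield S Y \<Longrightarrow> vfield S (nabla S X Y)"
  using levi_civita_nabla by (simp add: levi_civita_def affine_connection_def)

lemma vfield_lie:
  assumes "vfield S X" "vfield S Y" shows "vfield S (lie S X Y)"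
  using assms lie_tangent[OF assms]
  by (simp add: vfield_def lie_def smooth_map_diff smooth_map_dir_deriv)

text \<open>The second derivatives of \<open>Z\<close> cancel against the bracket term; there remains the commutator of the
  derivatives of the projector, which is the Gauss equation of \<open>S\<close> in the Euclidean space.\<close>

lemma curv_eq:
  assumes X: "vfield S X" and Y: "vfield S Y" and Z: "vfield S Z" and p: "p \<in> S"
  shows "curv S X Y Z p = P p (DP p (X p) (DP p (Y p) (Z p))) - P p (DP p (Y p) (DP p (X p) (Z p)))"
proof -
  note lin = linear_add[OF P_linear[OF p]] linear_diff[OF P_linear[OF p]]
  have Zs: "smooth_map S Z" by (rule vfieldD[OF Z])
  have D: "P p (DP p u (dir_deriv S Z p v)) = P p (DP p u (DP p v (Z p)))"
    if u: "u \<in> tangent S p" and v: "v \<in> tangent S p" for u v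
  proof -
    have "dir_deriv S Z p v = DP p v (Z p) + P p (dir_deriv S Z p v)"
      using dir_deriv_P[OF Zs p v] dir_deriv_cong[OF p, of Z "\<lambda>q. P q (Z q)" v] P_id vfieldD(2)[OF Z] by simp
    then have "P p (DP p u (dir_deriv S Z p v)) =
        P p (DP p u (DP p v (Z p))) + P p (DP p u (P p (dir_deriv S Z p v)))"
      by (metis linear_add[OF DP_linear[OF p u]] lin(1))
    then show ?thesis by (simp add: P_DP_P[OF p u])
  qed
  have N: "nabla S U (nabla S V Z) p = P p (DP p (U p) (dir_deriv S Z p (V p))) +
       P p (dir_deriv S (\<lambda>q. dir_deriv S Z q (V q)) p (U p))"
    if U: "vfield S U" and V: "vfield S V" for U V
  proof -
    have "nabla S U (nabla S V Z) p = cov (nabla S V Z) p (U p)"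
      by (rule nabla_eq[OF U vfield_nabla[OF V Z] p])
    also have "\<dots> = cov (\<lambda>q. P q (dir_deriv S Z q (V q))) p (U p)"
      by (rule cov_cong[OF p]) (simp add: nabla_eq[OF V Z] cov_def)
    also have "\<dots> = P p (DP p (U p) (dir_deriv S Z p (V p)) +
       P p (dir_deriv S (\<lambda>q. dir_deriv S Z q (V q)) p (U p)))"
      unfolding cov_def
      by (subst dir_deriv_P) (simp_all add: smooth_map_dir_deriv Zs vfieldD[OF V] vfieldD(2)[OF U] p)
    finally show ?thesis by (simp add: lin P_P[OF p])
  qed
  show ?thesis
    unfolding curv_def nabla_eq[OF vfield_lie[OF X Y] Z p] cov_def
      dir_deriv_commute[OF Zs X Y p lie_tangent[OF X Y p], symmetric]
      N[OF X Y] N[OF Y X] lin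
    by (simp add: D[OF vfieldD(2)[OF X p] vfieldD(2)[OF Y p]] D[OF vfieldD(2)[OF Y p] vfieldD(2)[OF X p]])
qed

end

section \<open>Geometry of complex projective space\<close>

definition madj :: "complex^'m^'m \<Rightarrow> complex^'m^'m" where
  "madj X = (\<chi> i j. cnj (X $ j $ i))"

lemma madj_simps [simp]:
  "madj (X + Y) = madj X + madj Y" "madj (X - Y) = madj X - madj Y" "madj (- X) = - madj X"
  "madj (c *\<^sub>R X) = c *\<^sub>R madj X" "madj (madj X) = X" "madj 0 = 0"
  by (simp_all add: madj_def vec_eq_iff)

lemma madj_mult [simp]: "madj (X ** Y) = madj Y ** madj (X :: complex^'m::finite^'m)"
  by (simp add: madj_def vec_eq_iff matrix_matrix_mult_def mult.commute)

lemma bounded_linear_madj: "bounded_linear (madj :: complex^'m::finite^'m \<Rightarrow> _)"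
  by (simp add: linear_conv_bounded_linear[symmetric] linear_iff)

lemma bounded_bilinear_matrix_mult:
  "bounded_bilinear ((**) :: complex^'m::finite^'m \<Rightarrow> complex^'m^'m \<Rightarrow> _)"
proof -
  have "linear (\<lambda>Y::complex^'m^'m. X ** Y)" "linear (\<lambda>Y::complex^'m^'m. Y ** X)" for X :: "complex^'m^'m"
    by (simp_all add: linear_iff matrix_matrix_mult_def vec_eq_iff sum.distrib scaleR_sum_right
        algebra_simps)
  then show ?thesis by (simp add: bilinear_conv_bounded_bilinear[symmetric] bilinear_def)
qed

interpretation mm: bounded_bilinear "(**) :: complex^'m::finite^'m \<Rightarrow> complex^'m^'m \<Rightarrow> _"
  by (rule bounded_bilinear_matrix_mult)

lemmas mm_simps = mm.add_left mm.add_right mm.diff_left mm.diff_right mm.minus_left mm.minus_right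
  mm.scaleR_left mm.scaleR_right mm.zero_left mm.zero_right matrix_mul_assoc[symmetric]

text \<open>A numeral in the componentwise ring of vectors acts on matrices as a scalar.\<close>

lemma numeral_times_matrix:
  fixes X :: "complex^'m::finite^'m"
  shows "numeral n * X = numeral n *\<^sub>R X" "X * numeral n = numeral n *\<^sub>R X"
proof -
  show "numeral n * X = numeral n *\<^sub>R X"
    by (simp add: vec_eq_iff scaleR_conv_of_real)
  then show "X * numeral n = numeral n *\<^sub>R X" by (simp only: mult.commute)
qed

lemma inner_complex_matrix:
  "(X :: complex^'m::finite^'m) \<bullet> Y = Re (\<Sum>i\<in>UNIV. \<Sum>j\<in>UNIV. X $ i $ j * cnj (Y $ i $ j))"
  by (simp add: inner_vec_def inner_complex_def)

lemma inner_mult_left: "(X ** Y) \<bullet> Z = Y \<bullet> (madj X ** Z)" for X Y Z :: "complex^'m::finite^'m"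
proof -
  have "(\<Sum>i\<in>UNIV. \<Sum>j\<in>UNIV. (X ** Y) $ i $ j * cnj (Z $ i $ j)) =
      (\<Sum>i\<in>UNIV. \<Sum>j\<in>UNIV. \<Sum>k\<in>UNIV. X $ i $ k * Y $ k $ j * cnj (Z $ i $ j))"
    by (simp add: matrix_matrix_mult_def sum_distrib_right)
  also have "\<dots> = (\<Sum>i\<in>UNIV. \<Sum>k\<in>UNIV. \<Sum>j\<in>UNIV. X $ i $ k * Y $ k $ j * cnj (Z $ i $ j))"
    by (rule sum.cong[OF refl], rule sum.swap)
  also have "\<dots> = (\<Sum>k\<in>UNIV. \<Sum>i\<in>UNIV. \<Sum>j\<in>UNIV. X $ i $ k * Y $ k $ j * cnj (Z $ i $ j))"
    by (rule sum.swap)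
  also have "\<dots> = (\<Sum>k\<in>UNIV. \<Sum>j\<in>UNIV. \<Sum>i\<in>UNIV. X $ i $ k * Y $ k $ j * cnj (Z $ i $ j))"
    by (rule sum.cong[OF refl], rule sum.swap)
  also have "\<dots> = (\<Sum>k\<in>UNIV. \<Sum>j\<in>UNIV. Y $ k $ j * cnj ((madj X ** Z) $ k $ j))"
    by (simp add: matrix_matrix_mult_def madj_def sum_distrib_left mult_ac)
  finally show ?thesis by (simp add: inner_complex_matrix)
qed

lemma inner_madj: "madj X \<bullet> Y = X \<bullet> madj Y" for X Y :: "complex^'m::finite^'m"
proof -
  have "Re (\<Sum>i\<in>UNIV. \<Sum>j\<in>UNIV. madj X $ i $ j * cnj (Y $ i $ j)) =
      Re (\<Sum>j\<in>UNIV. \<Sum>i\<in>UNIV. madj X $ i $ j * cnj (Y $ i $ j))"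
    by (subst sum.swap) simp
  also have "\<dots> = Re (cnj (\<Sum>j\<in>UNIV. \<Sum>i\<in>UNIV. madj X $ i $ j * cnj (Y $ i $ j)))"
    by (simp only: cnj.simps)
  also have "\<dots> = Re (\<Sum>j\<in>UNIV. \<Sum>i\<in>UNIV. X $ j $ i * cnj (madj Y $ j $ i))"
    by (simp add: madj_def)
  finally show ?thesis by (simp add: inner_complex_matrix)
qed

lemma inner_mult_right: "(X ** Y) \<bullet> Z = X \<bullet> (Z ** madj Y)" for X Y Z :: "complex^'m::finite^'m"
proof -
  have "(X ** Y) \<bullet> Z = (madj Y ** madj X) \<bullet> madj Z" using inner_madj[of "X ** Y" "madj Z"] by simp
  also have "\<dots> = madj X \<bullet> (Y ** madj Z)" by (simp add: inner_mult_left)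
  also have "\<dots> = X \<bullet> (Z ** madj Y)" by (simp add: inner_madj)
  finally show ?thesis .
qed

lemma CP_E:
  assumes "p \<in> CP"
  obtains z where "norm z = 1" "p = hproj z"
  using assms by (auto simp: CP_def)

lemma CP_madj: "p \<in> CP \<Longrightarrow> madj p = p"
  by (erule CP_E) (simp add: hproj_def madj_def mult.commute)

lemma CP_idem: assumes "p \<in> CP" shows "p ** p = p"
proof -
  obtain z where z: "norm z = 1" "p = hproj z" using assms by (rule CP_E)
  have "(\<Sum>k\<in>UNIV. z $ i * cnj (z $ k) * (z $ k * cnj (z $ j))) = z $ i * cnj (z $ j)" for i j
  proof -
    have "(\<Sum>k\<in>UNIV. z $ i * cnj (z $ k) * (z $ k * cnj (z $ j))) =
       (z $ i * cnj (z $ j)) * (\<Sum>k\<in>UNIV. z $ k * cnj (z $ k))"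
      by (simp add: sum_distrib_left mult_ac)
    then show ?thesis by (simp add: unit_sum[OF z(1)])
  qed
  then show ?thesis by (simp add: z(2) hproj_def matrix_matrix_mult_def vec_eq_iff)
qed

text \<open>The Hermitian tangent vectors at \<open>p\<close>, as cut out by the linearisation of the projector equation
  \<open>p\<^sup>2 = p\<close>.\<close>

definition ctan :: "complex^'m::finite^'m \<Rightarrow> complex^'m^'m \<Rightarrow> bool" where
  "ctan p X \<longleftrightarrow> madj X = X \<and> X ** p + p ** X = X"

text \<open>A tangent vector exchanges the image of \<open>p\<close> with its complement.  Together with \<open>p p = p\<close> these
  equations move every \<open>p\<close> in a product to the front, where at most one survives: a normal form for
  words in \<open>p\<close> and tangent vectors.\<close>

lemma ctan_move:
  fixes p X Z :: "complex^'m::finite^'m"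
  assumes "ctan p X"
  shows "X ** p = X - p ** X" "X ** (p ** Z) = X ** Z - p ** (X ** Z)"
proof -
  show 1: "X ** p = X - p ** X" using assms by (simp add: ctan_def algebra_simps)
  have "X ** (p ** Z) = (X ** p) ** Z" by (simp add: matrix_mul_assoc)
  then show "X ** (p ** Z) = X ** Z - p ** (X ** Z)" by (simp add: 1 mm_simps)
qed

lemma CP_move:
  fixes p Z :: "complex^'m::finite^'m"
  assumes "p \<in> CP"
  shows "p ** p = p" "p ** (p ** Z) = p ** Z"
  using CP_idem[OF assms] by (simp_all add: matrix_mul_assoc)

text \<open>For \<open>p = z z\<^sup>*\<close> the equation \<open>X = X p + p X\<close> expresses \<open>X\<close> by the vector \<open>X z\<close>, and its consequence
  \<open>p X p = 0\<close> says that \<open>X z\<close> is orthogonal to \<open>z\<close>.\<close>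

lemma ctan_dhproj:
  fixes z :: "complex^'m::finite"
  assumes z: "norm z = 1" and X: "ctan (hproj z) X"
  shows "X = dhproj z (X *v z)" "(\<Sum>i\<in>UNIV. (X *v z) $ i * cnj (z $ i)) = 0"
proof -
  have p: "hproj z \<in> CP" using z by (auto simp: CP_def)
  have "madj X = X" using X by (simp add: ctan_def)
  then have "madj X $ j $ i = X $ j $ i" for i j by simp
  then have h: "cnj (X $ i $ j) = X $ j $ i" for i j by (simp add: madj_def)
  have 1: "(X ** hproj z) $ i $ j = (X *v z) $ i * cnj (z $ j)" for i j
    by (simp add: matrix_matrix_mult_def matrix_vector_mult_def hproj_def sum_distrib_left mult_ac)
  have 2: "(hproj z ** Y) $ i $ j = z $ i * (\<Sum>k\<in>UNIV. cnj (z $ k) * Y $ k $ j)" for Y i j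
    by (simp add: matrix_matrix_mult_def hproj_def sum_distrib_left mult_ac)
  have 3: "(\<Sum>k\<in>UNIV. cnj (z $ k) * X $ k $ j) = cnj ((X *v z) $ j)" for j
    by (simp add: matrix_vector_mult_def h mult.commute)
  have "X = X ** hproj z + hproj z ** X" using X by (simp add: ctan_def)
  also have "\<dots> = dhproj z (X *v z)" by (simp add: vec_eq_iff 1 2 3) (simp add: dhproj_def)
  finally show "X = dhproj z (X *v z)" .
  let ?s = "\<Sum>i\<in>UNIV. (X *v z) $ i * cnj (z $ i)"
  have "hproj z ** (X ** hproj z) = 0"
    using ctan_move[OF X] CP_move[OF p] by (simp add: mm_simps)
  moreover have "(hproj z ** (X ** hproj z)) $ i $ j = z $ i * (?s * cnj (z $ j))" for i j
    by (simp add: 2 1 sum_distrib_left mult_ac)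
  ultimately have 4: "z $ i * (?s * cnj (z $ j)) = 0" for i j by (metis zero_index)
  obtain i where "z $ i \<noteq> 0" using z by (metis norm_zero vec_eq_iff zero_index zero_neq_one)
  then show "?s = 0" using 4[of i i] by simp
qed

lemma hproj_expand: "hproj (z + t *\<^sub>R v) = hproj z + t *\<^sub>R dhproj z v + (t * t) *\<^sub>R hproj v"
  by (simp add: hproj_def dhproj_def vec_eq_iff algebra_simps)

text \<open>The projector onto the line through \<open>z + t v\<close> is rational in \<open>t\<close> and has the required velocity.\<close>

lemma dhproj_tangent:
  fixes z v :: "complex^'m::finite"
  assumes z: "norm z = 1" and v: "(\<Sum>i\<in>UNIV. v $ i * cnj (z $ i)) = 0"
  shows "dhproj z v \<in> tangent CP (hproj z)"
proof -
  have zv: "z \<bullet> v = 0"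
  proof -
    have "v \<bullet> z = Re (\<Sum>i\<in>UNIV. v $ i * cnj (z $ i))" by (simp add: inner_vec_def inner_complex_def)
    then show ?thesis by (simp add: v inner_commute)
  qed
  define r where "r t = 1 + t * t * (v \<bullet> v)" for t :: real
  have r: "r t > 0" for t by (simp add: r_def add_pos_nonneg)
  have nr: "(norm (z + t *\<^sub>R v))\<^sup>2 = r t" for t
    using z zv by (simp add: r_def power2_norm_eq_inner inner_add_left inner_add_right inner_commute)
      (simp add: flip: power2_norm_eq_inner)
  define c where "c t = inverse (r t) *\<^sub>R (hproj z + t *\<^sub>R dhproj z v + (t * t) *\<^sub>R hproj v)" for t
  have c: "c t = hproj (inverse (norm (z + t *\<^sub>R v)) *\<^sub>R (z + t *\<^sub>R v))" for t
  proof -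
    have "hproj (a *\<^sub>R w) = (a\<^sup>2) *\<^sub>R hproj w" for a and w :: "complex^'m"
      by (simp add: hproj_def vec_eq_iff power2_eq_square)
    then show ?thesis by (simp add: c_def hproj_expand[symmetric] nr[symmetric] power_inverse)
  qed
  show ?thesis
  proof (rule tangentI[of 1 c])
    have o: "open {-1<..<1::real}" by simp
    note i = smooth_on_open_id[OF o] and k = smooth_on_open_const[OF o]
    note m = smooth_on_open_bilinear[OF bounded_bilinear_mult] and s = smooth_on_open_bilinear[OF bounded_bilinear_scaleR]
    have "smooth_on_open {-1<..<1} r"
      unfolding r_def by (rule smooth_on_open_add[OF k m[OF m[OF i i] k]])
    then have "smooth_on_open {-1<..<1} (\<lambda>t. inverse (r t))"
      using Ck_on_inverse[OF o, of r] r by (simp add: smooth_on_open_def less_imp_neq[THEN not_sym])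
    then show "smooth_on_open {-1<..<1} c"
      unfolding c_def by (rule s[OF _ smooth_on_open_add[OF smooth_on_open_add[OF k s[OF i k]] s[OF m[OF i i] k]]])
    have "z + t *\<^sub>R v \<noteq> 0" for t using nr[of t] r[of t] by (metis norm_zero power_zero_numeral less_irrefl)
    then have "norm (inverse (norm (z + t *\<^sub>R v)) *\<^sub>R (z + t *\<^sub>R v)) = 1" for t by simp
    then show "c ` {-1<..<1} \<subseteq> CP" using c by (auto simp: CP_def)
    show "c 0 = hproj z" by (simp add: c_def r_def)
    show "(c has_vector_derivative dhproj z v) (at 0)"
      unfolding c_def r_def has_vector_derivative_def
      by (auto intro!: derivative_eq_intros simp: fun_eq_iff)
  qed simp
qed

lemma dir_deriv_id: "v \<in> tangent S p \<Longrightarrow> dir_deriv S (\<lambda>q. q) p v = v"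
  by (rule dir_deriv_eq[OF has_derivative_ident])

text \<open>One inclusion differentiates \<open>p\<^sup>2 = p = p\<^sup>*\<close>, the other writes the vector as a velocity of a line.\<close>

lemma tangent_CP:
  fixes p :: "complex^'m::finite^'m"
  assumes p: "p \<in> CP"
  shows "v \<in> tangent CP p \<longleftrightarrow> ctan p v"
proof
  assume v: "v \<in> tangent CP p"
  have "v = dir_deriv CP madj p v"
    using dir_deriv_cong[OF p, of madj "\<lambda>q. q" v, OF CP_madj] dir_deriv_id[OF v] by simp
  also have "\<dots> = madj v"
    using dir_deriv_bounded_linear[OF bounded_linear_madj smooth_map_id p v] dir_deriv_id[OF v] by simp
  finally have 1: "madj v = v" by simp
  have "v = dir_deriv CP (\<lambda>q. q ** q) p v"
    using dir_deriv_cong[OF p, of "\<lambda>q. q ** q" "\<lambda>q. q" v, OF CP_idem] dir_deriv_id[OF v] by simp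
  also have "\<dots> = v ** p + p ** v"
    using dir_deriv_bilinear[OF bounded_bilinear_matrix_mult smooth_map_id smooth_map_id p v]
      dir_deriv_id[OF v] by simp
  finally show "ctan p v" using 1 by (simp add: ctan_def)
next
  assume v: "ctan p v"
  obtain z where z: "norm z = 1" "p = hproj z" using p by (rule CP_E)
  show "v \<in> tangent CP p"
    using ctan_dhproj[OF z(1) v[unfolded z(2)]] dhproj_tangent[OF z(1)] z(2) by metis
qed

lemma tangent_CP_dhproj:
  assumes "ctan p X" "p \<in> CP" "norm z = 1" "p = hproj z"
  obtains v where "X = dhproj z v" "(\<Sum>i\<in>UNIV. v $ i * cnj (z $ i)) = 0"
  using ctan_dhproj[OF assms(3)] assms that by blast

text \<open>The Hermitian part \<open>h\<close> of \<open>v\<close>, reduced to its blocks \<open>(1 - p) h p\<close> and \<open>p h (1 - p)\<close>.\<close>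

definition cproj :: "complex^'m::finite^'m \<Rightarrow> complex^'m^'m \<Rightarrow> complex^'m^'m" where
  "cproj p v = (let h = (1/2) *\<^sub>R (v + madj v) in h ** p + p ** h - 2 *\<^sub>R (p ** (h ** p)))"

text \<open>The derivative of \<open>cproj\<close> in \<open>p\<close>, in the direction \<open>x\<close>.\<close>

definition dcproj :: "complex^'m::finite^'m \<Rightarrow> complex^'m^'m \<Rightarrow> complex^'m^'m \<Rightarrow> complex^'m^'m" where
  "dcproj p x v = (let h = (1/2) *\<^sub>R (v + madj v) in
     h ** x + x ** h - 2 *\<^sub>R (x ** (h ** p) + p ** (h ** x)))"

lemma half_double: "(1/2) *\<^sub>R (v + v) = (v :: 'a::real_vector)"
  by (simp add: scaleR_2[symmetric])

lemma cproj_herm: "madj v = v \<Longrightarrow> cproj p v = v ** p + p ** v - 2 *\<^sub>R (p ** (v ** p))"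
  by (simp add: cproj_def half_double)

lemma dcproj_herm: "madj v = v \<Longrightarrow> dcproj p x v = v ** x + x ** v - 2 *\<^sub>R (x ** (v ** p) + p ** (v ** x))"
  by (simp add: dcproj_def half_double)

lemma linear_cproj: "linear (cproj p)"
  by (rule linearI) (simp_all add: cproj_def Let_def mm_simps algebra_simps)

lemma cproj_ctan: "p \<in> CP \<Longrightarrow> ctan p (cproj p v)"
  by (simp add: ctan_def cproj_def Let_def mm_simps CP_madj CP_move algebra_simps)

lemma cproj_id: "p \<in> CP \<Longrightarrow> ctan p v \<Longrightarrow> cproj p v = v"
  using ctan_move[of p v] by (simp add: cproj_herm ctan_def mm_simps CP_move)

lemma cproj_sym: assumes "p \<in> CP" shows "cproj p v \<bullet> w = v \<bullet> cproj p w"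
proof -
  have q: "(h ** p + p ** h - 2 *\<^sub>R (p ** (h ** p))) \<bullet> w = h \<bullet> (w ** p + p ** w - 2 *\<^sub>R (p ** (w ** p)))" for h w
  proof -
    have "(p ** (h ** p)) \<bullet> w = h \<bullet> ((p ** w) ** p)"
      by (simp only: inner_mult_left[of p] inner_mult_right[of h p] CP_madj[OF assms])
    then show ?thesis
      by (simp add: inner_diff_left inner_diff_right inner_add_left inner_add_right
        inner_mult_right[of h p] inner_mult_left[of p h] CP_madj[OF assms] matrix_mul_assoc)
  qed
  have h: "((1/2) *\<^sub>R (v + madj v)) \<bullet> k = v \<bullet> ((1/2) *\<^sub>R (k + madj k))" for k
    by (simp add: inner_add_left inner_add_right inner_madj)
  show ?thesis unfolding cproj_def Let_def q h
    by (rule arg_cong[where f="inner v"]) (simp add: mm_simps CP_madj[OF assms] algebra_simps)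
qed

lemma smooth_map_mm: "smooth_map S f \<Longrightarrow> smooth_map S g \<Longrightarrow> smooth_map S (\<lambda>q. f q ** g q)"
  for f g :: "'a::euclidean_space \<Rightarrow> complex^'m::finite^'m"
  by (rule smooth_map_bilinear[OF bounded_bilinear_matrix_mult])

lemma smooth_map_cproj: "smooth_map S (\<lambda>q. cproj q v)"
  unfolding cproj_def Let_def
  by (intro smooth_map_diff smooth_map_add smooth_map_scaleR smooth_map_mm smooth_map_id smooth_map_const)

lemma dir_deriv_cproj:
  fixes S :: "(complex^'m::finite^'m) set"
  assumes p: "p \<in> S" and x: "x \<in> tangent S p"
  shows "dir_deriv S (\<lambda>q. cproj q v) p x = dcproj p x v"
proof -
  define h where "h = (1/2) *\<^sub>R (v + madj v)"
  have c: "(\<lambda>q. cproj q v) = (\<lambda>q. h ** q + q ** h - 2 *\<^sub>R (q ** (h ** q)))"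
    by (simp add: cproj_def h_def Let_def)
  have "((\<lambda>q. h ** q + q ** h - 2 *\<^sub>R (q ** (h ** q))) has_derivative
     (\<lambda>x. (h ** x + 0 ** p) + (p ** 0 + x ** h) - 2 *\<^sub>R (p ** (h ** x + 0 ** p) + x ** (h ** p)))) (at p within S)"
    by (intro has_derivative_diff has_derivative_add has_derivative_scaleR_right
        mm.FDERIV has_derivative_ident has_derivative_const)
  from dir_deriv_eq[OF this x] have "dir_deriv S (\<lambda>q. cproj q v) p x =
      (h ** x + 0 ** p) + (p ** 0 + x ** h) - 2 *\<^sub>R (p ** (h ** x + 0 ** p) + x ** (h ** p))"
    by (simp only: c)
  also have "\<dots> = h ** x + x ** h - 2 *\<^sub>R (x ** (h ** p) + p ** (h ** x))"
    by (simp add: mm_simps algebra_simps)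
  finally show ?thesis by (simp only: dcproj_def h_def Let_def)
qed

lemma open_CP_tangent:
  fixes W :: "(complex^'m::finite^'m) set"
  assumes "openin (top_of_set CP) W" "p \<in> W"
  shows "v \<in> tangent W p \<longleftrightarrow> ctan p v"
proof -
  have "p \<in> CP" using openin_imp_subset[OF assms(1)] assms(2) by blast
  then show ?thesis using tangent_openin[OF assms] tangent_CP[of p v] by simp
qed

text \<open>The linearised projector equation, differentiated once more along \<open>X\<close>, contains the term
  \<open>Y X + X Y\<close>, which is symmetric and drops out of the bracket.\<close>

lemma lie_ctan:
  fixes W :: "(complex^'m::finite^'m) set"
  assumes W: "openin (top_of_set CP) W" and X: "vfield W X" and Y: "vfield W Y" and p: "p \<in> W"
  shows "ctan p (lie W X Y p)"
proof -
  note tan = open_CP_tangent[OF W]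
  have D: "madj (dir_deriv W Y p (X p)) = dir_deriv W Y p (X p) \<and>
     dir_deriv W Y p (X p) ** p + Y p ** X p + X p ** Y p + p ** dir_deriv W Y p (X p) = dir_deriv W Y p (X p)"
    if "vfield W X" "vfield W Y" for X Y
  proof -
    have s: "smooth_map W Y" and t: "X p \<in> tangent W p" using that p by (simp_all add: vfield_def)
    have e: "madj (Y q) = Y q" "Y q ** q + q ** Y q = Y q" if "q \<in> W" for q
      using \<open>vfield W Y\<close> that tan[OF that, of "Y q"] by (simp_all add: vfield_def ctan_def)
    have "dir_deriv W (\<lambda>q. madj (Y q)) p (X p) = dir_deriv W Y p (X p)"
      by (rule dir_deriv_cong[OF p e(1)])
    then have 1: "madj (dir_deriv W Y p (X p)) = dir_deriv W Y p (X p)"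
      using dir_deriv_bounded_linear[OF bounded_linear_madj s p t] by simp
    have "dir_deriv W Y p (X p) = dir_deriv W (\<lambda>q. Y q ** q + q ** Y q) p (X p)"
      by (rule dir_deriv_cong[OF p e(2), symmetric])
    also have "\<dots> = dir_deriv W (\<lambda>q. Y q ** q) p (X p) + dir_deriv W (\<lambda>q. q ** Y q) p (X p)"
      by (intro dir_deriv_add smooth_map_mm s smooth_map_id p t)
    also have "\<dots> = dir_deriv W Y p (X p) ** p + Y p ** X p + X p ** Y p + p ** dir_deriv W Y p (X p)"
      by (simp add: dir_deriv_bilinear[OF bounded_bilinear_matrix_mult s smooth_map_id p t]
          dir_deriv_bilinear[OF bounded_bilinear_matrix_mult smooth_map_id s p t] dir_deriv_id[OF t])
    finally show ?thesis using 1 by simp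
  qed
  have cancel: "(a ** p - b ** p) + (p ** a - p ** b) = a - b"
    if "a ** p + u + v + p ** a = a" "b ** p + v + u + p ** b = b" for a b u v :: "complex^'m^'m"
  proof -
    have "a - b = (a ** p + u + v + p ** a) - (b ** p + v + u + p ** b)" using that by simp
    then show ?thesis by (simp add: algebra_simps)
  qed
  have "lie W X Y p ** p + p ** lie W X Y p = lie W X Y p"
    unfolding lie_def mm_simps
    by (rule cancel[where u = "Y p ** X p" and v = "X p ** Y p"]) (use D[OF X Y] D[OF Y X] in simp_all)
  moreover have "madj (lie W X Y p) = lie W X Y p" using D[OF X Y] D[OF Y X] by (simp add: lie_def)
  ultimately show ?thesis by (simp add: ctan_def)
qed

lemma projected_CP:
  fixes W :: "(complex^'m::finite^'m) set"
  assumes W: "openin (top_of_set CP) W"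
  shows "projected_matrix_manifold W cproj"
proof (intro projected_matrix_manifold.intro projected_manifold.intro)
  note sub = subsetD[OF openin_imp_subset[OF W]] and tan = open_CP_tangent[OF W]
  show "smooth_map W (\<lambda>q. cproj q v)" for v by (rule smooth_map_cproj)
  show "linear (cproj p)" for p :: "complex^'m^'m" by (rule linear_cproj)
  show "cproj p v \<in> tangent W p" if "p \<in> W" for p v
    using cproj_ctan[OF sub[OF that]] tan[OF that] by simp
  show "cproj p v = v" if "p \<in> W" "v \<in> tangent W p" for p v
    using cproj_id[OF sub[OF that(1)]] tan[OF that(1)] that(2) by simp
  show "cproj p v \<bullet> w = v \<bullet> cproj p w" if "p \<in> W" for p v w by (rule cproj_sym[OF sub[OF that]])
  show "lie W X Y p \<in> tangent W p" if "vfield W X" "vfield W Y" "p \<in> W" for X Y p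
    using lie_ctan[OF W that] tan[OF that(3)] by simp
qed

text \<open>Antisymmetrising the right-hand side in \<open>x\<close> and \<open>y\<close> leaves \<open>[[x,y],z]\<close>: the curvature of \<open>CP\<close> is a
  double commutator, as for every symmetric space.\<close>

lemma dcproj_dcproj:
  fixes p x y z :: "complex^'m::finite^'m"
  assumes p: "p \<in> CP" and x: "ctan p x" and y: "ctan p y" and z: "ctan p z"
  shows "cproj p (dcproj p x (dcproj p y z)) =
    y ** (z ** x) + z ** (y ** x) + x ** (y ** z) + x ** (z ** y)"
proof -
  have h: "madj x = x" "madj y = y" "madj z = z" using x y z by (simp_all add: ctan_def)
  define w where "w = dcproj p y z"
  define u where "u = dcproj p x w"
  have w: "madj w = w"
    using h by (simp add: w_def dcproj_herm CP_madj[OF p] matrix_mul_assoc algebra_simps)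
  have u: "madj u = u"
    using h w by (simp add: u_def dcproj_herm CP_madj[OF p] matrix_mul_assoc algebra_simps)
  note move = mm_simps ctan_move[OF x] ctan_move[OF y] ctan_move[OF z] CP_move[OF p]
  have weq: "w = y ** z + z ** y - 2 *\<^sub>R (p ** (y ** z)) - 2 *\<^sub>R (p ** (z ** y))"
    by (simp add: w_def dcproj_herm[OF h(3)] move algebra_simps)
  have wp: "w ** p = p ** w" "w ** (p ** Z) = p ** (w ** Z)" for Z :: "complex^'m^'m"
  proof -
    show 1: "w ** p = p ** w" by (simp add: weq move algebra_simps)
    show "w ** (p ** Z) = p ** (w ** Z)"
      using arg_cong[OF 1, of "\<lambda>M. M ** Z"] by (simp add: matrix_mul_assoc)
  qed
  have "cproj p u = w ** x - p ** (w ** x) - p ** (w ** x) + (p ** (x ** w) + p ** (x ** w)) - x ** w"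
    unfolding cproj_herm[OF u]
    by (simp add: u_def dcproj_herm[OF w] move wp numeral_times_matrix algebra_simps)
  also have "\<dots> = y ** (z ** x) + z ** (y ** x) + x ** (y ** z) + x ** (z ** y)"
    by (simp add: weq move numeral_times_matrix algebra_simps)
  finally show ?thesis by (simp only: u_def w_def)
qed

text \<open>The derivative of the projector takes tangent vectors to normal ones.  As these commute with \<open>p\<close>,
  they are annihilated by \<open>cpJ p\<close>; and the derivative of \<open>cpJ\<close> itself is normal (\<open>cproj_cpJ\<close>).  In
  this sense the complex structure is parallel.\<close>

lemma cproj_dcproj:
  fixes p x n :: "complex^'m::finite^'m"
  assumes p: "p \<in> CP" and x: "ctan p x" and n: "ctan p n"
  shows "cproj p (dcproj p x n) = 0"
proof -
  have h: "madj x = x" "madj n = n" using x n by (simp_all add: ctan_def)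
  define w where "w = dcproj p x n"
  have "madj w = w"
    using h by (simp add: w_def dcproj_herm CP_madj[OF p] matrix_mul_assoc algebra_simps)
  from cproj_herm[OF this] show ?thesis unfolding w_def[symmetric]
    by simp
      (simp add: w_def dcproj_herm[OF h(2)] numeral_times_matrix mm_simps ctan_move[OF x] ctan_move[OF n] CP_move[OF p] algebra_simps)
qed

definition imul :: "complex^'m^'m \<Rightarrow> complex^'m^'m" where
  "imul X = (\<chi> i j. \<i> * X $ i $ j)"

lemma imul_simps:
  fixes X Y :: "complex^'m::finite^'m"
  shows "imul (X + Y) = imul X + imul Y" "imul (X - Y) = imul X - imul Y" "imul (- X) = - imul X"
  "imul (c *\<^sub>R X) = c *\<^sub>R imul X" "imul (imul X) = - X" "imul 0 = 0"
  "madj (imul X) = - imul (madj X)" "imul X ** Y = imul (X ** Y)" "X ** imul Y = imul (X ** Y)"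
  by (simp_all add: imul_def madj_def vec_eq_iff matrix_matrix_mult_def algebra_simps sum_distrib_left)

lemma inner_imul: "imul X \<bullet> Y = - (X \<bullet> imul Y)" for X Y :: "complex^'m::finite^'m"
  by (simp add: imul_def inner_vec_def inner_complex_def sum_negf[symmetric] algebra_simps)

lemma cpJ_eq: "cpJ p X = imul (X ** p - p ** X)"
  by (simp add: cpJ_def imul_def)

lemma bounded_bilinear_cpJ:
  "bounded_bilinear (cpJ :: complex^'m::finite^'m \<Rightarrow> complex^'m^'m \<Rightarrow> _)"
  by (simp add: bilinear_conv_bounded_bilinear[symmetric] bilinear_def linear_iff cpJ_eq
      mm_simps imul_simps algebra_simps)

lemma cpJ_dcproj:
  fixes p x n :: "complex^'m::finite^'m"
  assumes p: "p \<in> CP" and x: "ctan p x" and n: "ctan p n"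
  shows "cpJ p (dcproj p x n) = 0"
proof -
  have h: "madj n = n" using n by (simp_all add: ctan_def)
  show ?thesis
    by (simp add: cpJ_eq dcproj_herm[OF h] numeral_times_matrix mm_simps ctan_move[OF x] ctan_move[OF n] CP_move[OF p]
        imul_simps algebra_simps)
qed

lemma cproj_cpJ:
  fixes p x n :: "complex^'m::finite^'m"
  assumes p: "p \<in> CP" and x: "ctan p x" and n: "ctan p n"
  shows "cproj p (cpJ x n) = 0"
proof -
  have h: "madj x = x" "madj n = n" using x n by (simp_all add: ctan_def)
  have "madj (cpJ x n) = cpJ x n" using h by (simp add: cpJ_eq imul_simps algebra_simps)
  then show ?thesis unfolding cproj_herm[OF \<open>madj (cpJ x n) = cpJ x n\<close>]
    by (simp add: cpJ_eq numeral_times_matrix mm_simps ctan_move[OF x] ctan_move[OF n] CP_move[OF p] imul_simps algebra_simps)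
qed

lemma ctan_cpJ:
  fixes p x :: "complex^'m::finite^'m"
  assumes p: "p \<in> CP" and x: "ctan p x"
  shows "ctan p (cpJ p x)" "cpJ p (cpJ p x) = - x"
proof -
  have h: "madj x = x" using x by (simp_all add: ctan_def)
  show "ctan p (cpJ p x)"
    using h by (simp add: ctan_def cpJ_eq imul_simps CP_madj[OF p] numeral_times_matrix mm_simps ctan_move[OF x] CP_move[OF p]
        algebra_simps)
  show "cpJ p (cpJ p x) = - x"
    by (simp add: cpJ_eq imul_simps numeral_times_matrix mm_simps ctan_move[OF x] CP_move[OF p] algebra_simps)
qed

lemma fs_cpJ:
  fixes p x y :: "complex^'m::finite^'m"
  assumes p: "p \<in> CP"
  shows "fs (cpJ p x) y = - fs x (cpJ p y)"
  by (simp add: fs_def cpJ_eq inner_imul imul_simps inner_diff_left inner_diff_right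
      inner_mult_left[of p] inner_mult_right[of x p] CP_madj[OF p] diff_divide_distrib)

text \<open>Of the eight products of rank one matrices only two survive, since \<open>a\<close>, \<open>b\<close>, \<open>c\<close> are orthogonal to
  \<open>e\<close>.\<close>

lemma dhproj_triple:
  fixes e a b c :: "complex^'m::finite"
  defines "h \<equiv> \<lambda>a b :: complex^'m. \<Sum>k\<in>UNIV. a $ k * cnj (b $ k)"
  assumes e: "norm e = 1" and "h a e = 0" "h b e = 0" "h c e = 0"
  shows "(dhproj e a ** (dhproj e b ** dhproj e c)) $ i $ j =
     a $ i * cnj (e $ j) * h c b + e $ i * cnj (c $ j) * h b a"
proof -
  have hd: "h x y = (\<Sum>k\<in>UNIV. x $ k * cnj (y $ k))" for x y by (simp add: h_def)
  have hc: "h x y = cnj (h y x)" for x y by (simp add: h_def mult.commute)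
  have z: "h e a = 0" "h e b = 0" "h e c = 0"
    using assms(3-5) hc[of e a] hc[of e b] hc[of e c] by simp_all
  have ee: "h e e = 1" using unit_sum[OF e] by (simp add: h_def)
  have 1: "(dhproj e b ** dhproj e c) $ k $ j =
      b $ k * cnj (e $ j) * h c e + b $ k * cnj (c $ j) * h e e + e $ k * cnj (e $ j) * h c b + e $ k * cnj (c $ j) * h e b" for k
    by (simp add: dhproj_def matrix_matrix_mult_def h_def sum_distrib_left sum.distrib[symmetric] algebra_simps)
  have "(dhproj e a ** (dhproj e b ** dhproj e c)) $ i $ j =
     (\<Sum>k\<in>UNIV. (a $ i * cnj (e $ k) + e $ i * cnj (a $ k)) * (b $ k * cnj (c $ j) + e $ k * cnj (e $ j) * h c b))"
  proof -
    have 2: "dhproj e a $ i $ k = a $ i * cnj (e $ k) + e $ i * cnj (a $ k)" for k by (simp add: dhproj_def)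
    have "(X ** Y) $ i $ j = (\<Sum>k\<in>UNIV. X $ i $ k * Y $ k $ j)" for X Y :: "complex^'m^'m"
      by (simp add: matrix_matrix_mult_def)
    then show ?thesis by (simp only: 1 2 assms(3-5) z ee mult_zero_right mult_1_right add_0_left add_0_right)
  qed
  also have "\<dots> = a $ i * cnj (c $ j) * h b e + e $ i * cnj (c $ j) * h b a
     + a $ i * cnj (e $ j) * h c b * h e e + e $ i * cnj (e $ j) * h c b * h e a"
    unfolding hd[of b e] hd[of b a] hd[of e e] hd[of e a] sum_distrib_left sum.distrib[symmetric]
    by (rule sum.cong[OF refl]) (simp add: algebra_simps)
  finally show ?thesis using assms(3-5) z ee by simp
qed

lemma hermitian_pairing:
  fixes e u v w :: "complex^'m::finite"
  shows "((v \<bullet> w) *\<^sub>R dhproj e u + ((\<i> *s v) \<bullet> w) *\<^sub>R dhproj e (\<i> *s u)) $ i $ j =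
    u $ i * cnj (e $ j) * (\<Sum>k\<in>UNIV. w $ k * cnj (v $ k)) +
    e $ i * cnj (u $ j) * (\<Sum>k\<in>UNIV. v $ k * cnj (w $ k))"
proof -
  define H where "H = (\<Sum>k\<in>UNIV. v $ k * cnj (w $ k))"
  have 1: "v \<bullet> w = Re H" "(\<i> *s v) \<bullet> w = - Im H"
    by (simp_all add: H_def inner_vec_def inner_complex_def sum_negf[symmetric] algebra_simps)
  have 2: "(\<Sum>k\<in>UNIV. w $ k * cnj (v $ k)) = cnj H" by (simp add: H_def mult.commute)
  have 3: "of_real (Re H) * (a + b) - of_real (Im H) * (\<i> * a - \<i> * b) = a * cnj H + b * H" for H a b
    by (simp add: complex_eq_iff algebra_simps)
  show ?thesis unfolding 1 2 H_def[symmetric]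
    using 3[of H "u $ i * cnj (e $ j)" "e $ i * cnj (u $ j)"]
    unfolding vector_add_component vector_scaleR_component unfolding dhproj_def scaleR_conv_of_real
    by (simp add: algebra_simps)
qed

text \<open>The double commutator is evaluated on \<open>x = u e\<^sup>* + e u\<^sup>*\<close> and likewise \<open>y\<close>, \<open>z\<close>, where \<open>p = e e\<^sup>*\<close>; grouping
  the Hermitian products into real and imaginary parts yields the curvature tensor of constant
  holomorphic sectional curvature \<open>4\<close>.\<close>

lemma CP_curvature:
  fixes p x y z :: "complex^'m::finite^'m"
  assumes p: "p \<in> CP" and x: "ctan p x" and y: "ctan p y" and z: "ctan p z"
  shows "cproj p (dcproj p x (dcproj p y z)) - cproj p (dcproj p y (dcproj p x z)) =
    fs y z *\<^sub>R x - fs x z *\<^sub>R y + fs (cpJ p y) z *\<^sub>R cpJ p x - fs (cpJ p x) z *\<^sub>R cpJ p y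
      - (2 * fs (cpJ p x) y) *\<^sub>R cpJ p z"
proof -
  obtain e where e: "norm e = 1" "p = hproj e" using p by (rule CP_E)
  let ?h = "\<lambda>a b :: complex^'m. \<Sum>k\<in>UNIV. a $ k * cnj (b $ k)"
  obtain u where u: "x = dhproj e u" "?h u e = 0" by (rule tangent_CP_dhproj[OF x p e])
  obtain v where v: "y = dhproj e v" "?h v e = 0" by (rule tangent_CP_dhproj[OF y p e])
  obtain w where w: "z = dhproj e w" "?h w e = 0" by (rule tangent_CP_dhproj[OF z p e])
  have i0: "?h (\<i> *s a) e = 0" if "?h a e = 0" for a
    using that by (simp add: mult.assoc sum_distrib_left[symmetric])
  have f: "fs (dhproj e a) (dhproj e b) = a \<bullet> b" if "?h a e = 0" "?h b e = 0" for a b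
    by (rule fs_dhproj[OF e(1) that])
  have J: "cpJ p (dhproj e a) = dhproj e (\<i> *s a)" if "?h a e = 0" for a
    unfolding e(2) by (rule cpJ_dhproj[OF e(1) that])
  have iu: "(2 * ((\<i> *s u) \<bullet> v)) *\<^sub>R dhproj e (\<i> *s w) $ i $ j =
     (?h v u - ?h u v) * (w $ i * cnj (e $ j) - e $ i * cnj (w $ j))" for i j
  proof -
    define H where "H = ?h u v"
    have 1: "(\<i> *s u) \<bullet> v = - Im H"
      by (simp add: H_def inner_vec_def inner_complex_def sum_negf[symmetric] algebra_simps)
    have 2: "?h v u = cnj H" by (simp add: H_def mult.commute)
    have 3: "- (2 * of_real (Im H)) * (\<i> * a - \<i> * b) = (cnj H - H) * (a - b)" for H a b
      by (simp add: complex_eq_iff algebra_simps)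
    show ?thesis unfolding 1 2 H_def[symmetric]
      using 3[of H "w $ i * cnj (e $ j)" "e $ i * cnj (w $ j)"]
      by (simp add: dhproj_def scaleR_conv_of_real algebra_simps)
  qed
  have "cproj p (dcproj p x (dcproj p y z)) - cproj p (dcproj p y (dcproj p x z)) =
      z ** (y ** x) + x ** (y ** z) - z ** (x ** y) - y ** (x ** z)"
    by (simp add: dcproj_dcproj[OF p x y z] dcproj_dcproj[OF p y x z] algebra_simps)
  also have "\<dots> = (fs y z *\<^sub>R x + fs (cpJ p y) z *\<^sub>R cpJ p x) - (fs x z *\<^sub>R y + fs (cpJ p x) z *\<^sub>R cpJ p y)
      - (2 * fs (cpJ p x) y) *\<^sub>R cpJ p z"
    unfolding u(1) v(1) w(1) J[OF u(2)] J[OF v(2)] J[OF w(2)]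
      f[OF v(2) w(2)] f[OF u(2) w(2)] f[OF i0[OF v(2)] w(2)] f[OF i0[OF u(2)] w(2)] f[OF i0[OF u(2)] v(2)]
  proof (rule vec_eq_iff[THEN iffD2], rule allI, rule vec_eq_iff[THEN iffD2], rule allI)
    fix i j
    note T = dhproj_triple[OF e(1)]
    have lhs: "(dhproj e w ** (dhproj e v ** dhproj e u) + dhproj e u ** (dhproj e v ** dhproj e w)
        - dhproj e w ** (dhproj e u ** dhproj e v) - dhproj e v ** (dhproj e u ** dhproj e w)) $ i $ j =
       (w $ i * cnj (e $ j) * ?h u v + e $ i * cnj (u $ j) * ?h v w)
       + (u $ i * cnj (e $ j) * ?h w v + e $ i * cnj (w $ j) * ?h v u)
       - (w $ i * cnj (e $ j) * ?h v u + e $ i * cnj (v $ j) * ?h u w)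
       - (v $ i * cnj (e $ j) * ?h w u + e $ i * cnj (w $ j) * ?h u v)"
      by (simp only: vector_add_component vector_minus_component T[OF w(2) v(2) u(2)] T[OF u(2) v(2) w(2)]
          T[OF w(2) u(2) v(2)] T[OF v(2) u(2) w(2)])
    have alg: "(W1 * c1 + E1) + (U + W2 * c2) - (W1 * c2 + E2) - (V + W2 * c1) =
        (U + E1) - (V + E2) - (c2 - c1) * (W1 - W2)" for W1 c1 E1 U W2 c2 E2 V :: complex
      by (simp add: algebra_simps)
    show "(dhproj e w ** (dhproj e v ** dhproj e u) + dhproj e u ** (dhproj e v ** dhproj e w)
        - dhproj e w ** (dhproj e u ** dhproj e v) - dhproj e v ** (dhproj e u ** dhproj e w)) $ i $ j =
       ((v \<bullet> w) *\<^sub>R dhproj e u + ((\<i> *s v) \<bullet> w) *\<^sub>R dhproj e (\<i> *s u) -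
        ((u \<bullet> w) *\<^sub>R dhproj e v + ((\<i> *s u) \<bullet> w) *\<^sub>R dhproj e (\<i> *s v)) -
        (2 * ((\<i> *s u) \<bullet> v)) *\<^sub>R dhproj e (\<i> *s w)) $ i $ j"
      unfolding lhs unfolding alg vector_minus_component hermitian_pairing
      unfolding vector_scaleR_component iu by simp
  qed
  finally show ?thesis by (simp add: algebra_simps)
qed

text \<open>The tangent space is the linear image of the complex orthogonal complement of \<open>z\<close>, whose real
  codimension is two.\<close>

lemma dim_tangent_CP:
  fixes p :: "complex^'m::finite^'m"
  assumes p: "p \<in> CP"
  shows "dim (tangent CP p) + 2 \<le> 2 * CARD('m)"
proof -
  obtain z where z: "norm z = 1" "p = hproj z" using p by (rule CP_E)
  define K where "K = {u \<in> UNIV. \<forall>x\<in>span {z, \<i> *s z}. orthogonal x u}"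
  have "linear (dhproj z)"
    by (rule linearI) (simp_all add: dhproj_def vec_eq_iff algebra_simps)
  then have "dim (dhproj z ` K) \<le> dim K" by (rule dim_image_le)
  moreover have "tangent CP p \<subseteq> dhproj z ` K"
  proof
    fix x assume "x \<in> tangent CP p"
    then have "ctan p x" using tangent_CP[OF p] by simp
    then obtain u where u: "x = dhproj z u" "(\<Sum>k\<in>UNIV. u $ k * cnj (z $ k)) = 0"
      using tangent_CP_dhproj[OF _ p z] by metis
    have "u \<bullet> z = Re (\<Sum>k\<in>UNIV. u $ k * cnj (z $ k))" "u \<bullet> (\<i> *s z) = Im (\<Sum>k\<in>UNIV. u $ k * cnj (z $ k))"
      by (simp_all add: inner_vec_def inner_complex_def algebra_simps)
    then have "orthogonal u z" "orthogonal u (\<i> *s z)" by (simp_all add: u(2) orthogonal_def)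
    then have "orthogonal u x" if "x \<in> span {z, \<i> *s z}" for x
      using orthogonal_to_span[OF that, of u] by auto
    then show "x \<in> dhproj z ` K" using u(1) by (auto simp: K_def orthogonal_commute)
  qed
  then have "dim (tangent CP p) \<le> dim (dhproj z ` K)" by (rule dim_subset)
  moreover have "dim K + dim (span {z, \<i> *s z}) = dim (UNIV :: (complex^'m) set)"
    unfolding K_def by (rule dim_subspace_orthogonal_to_vectors) auto
  moreover have "dim (span {z, \<i> *s z}) = 2"
  proof -
    have o: "z \<bullet> (\<i> *s z) = 0" by (simp add: inner_vec_def inner_complex_def algebra_simps)
    have nz: "z \<noteq> 0" using z by auto
    then have nz2: "\<i> *s z \<noteq> 0" by (simp add: vec_eq_iff)
    have ne: "z \<noteq> \<i> *s z" using o nz by (metis inner_eq_zero_iff)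
    have "pairwise orthogonal {z, \<i> *s z}" using o by (simp add: pairwise_insert orthogonal_def inner_commute)
    then have "independent {z, \<i> *s z}" using nz nz2 by (intro pairwise_orthogonal_independent) auto
    then show ?thesis using ne by (simp add: dim_eq_card_independent)
  qed
  ultimately show ?thesis by (simp add: dim_UNIV)
qed

section \<open>Charts of submanifolds\<close>

text \<open>Turns membership in a subspace into an equation, which can be differentiated.\<close>

lemma subspace_projection:
  fixes L :: "'a::euclidean_space set"
  assumes "subspace L"
  obtains \<pi> where "bounded_linear \<pi>" "\<And>x. x \<in> L \<longleftrightarrow> \<pi> x = x"
proof -
  obtain B where B: "B \<subseteq> L" "pairwise orthogonal B" "\<And>x. x \<in> B \<Longrightarrow> norm x = 1"
    "independent B" "card B = dim L" "span B = L"
    using orthonormal_basis_subspace[OF assms] by metis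
  have fin: "finite B" using B(4) independent_bound_general by blast
  have "linear (\<lambda>x. \<Sum>i\<in>B. (x \<bullet> i) *\<^sub>R i)"
    by (rule linearI) (simp_all add: inner_add_left scaleR_add_left sum.distrib scaleR_sum_right)
  then have "bounded_linear (\<lambda>x. \<Sum>i\<in>B. (x \<bullet> i) *\<^sub>R i)" by (simp add: linear_conv_bounded_linear)
  moreover have "x \<in> L \<longleftrightarrow> (\<Sum>i\<in>B. (x \<bullet> i) *\<^sub>R i) = x" for x
  proof
    assume "x \<in> L"
    then show "(\<Sum>i\<in>B. (x \<bullet> i) *\<^sub>R i) = x"
      using orthonormal_basis_expand[OF B(2,3) _ fin, of x] B(6) by simp
  next
    assume *: "(\<Sum>i\<in>B. (x \<bullet> i) *\<^sub>R i) = x"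
    have "(\<Sum>i\<in>B. (x \<bullet> i) *\<^sub>R i) \<in> L"
      using B(1) by (intro subspace_sum[OF assms] subspace_scale[OF assms]) auto
    then show "x \<in> L" unfolding * .
  qed
  ultimately show ?thesis by (rule that)
qed

locale slice_chart =
  fixes S U V L :: "'a::euclidean_space set" and f g :: "'a \<Rightarrow> 'a"
  assumes f: "smooth_on_open U f" and g: "smooth_on_open V g" and hom: "homeomorphism U V f g"
    and L: "subspace L" and slice: "f ` (S \<inter> U) = L \<inter> V"
begin

abbreviation "S' \<equiv> S \<inter> U"
abbreviation "Df q \<equiv> frechet_derivative f (at q)"
abbreviation "Dg y \<equiv> frechet_derivative g (at y)"

lemma opens: "open U" "open V" using f g by (simp_all add: smooth_on_open_def)

lemma maps: "q \<in> U \<Longrightarrow> f q \<in> V" "y \<in> V \<Longrightarrow> g y \<in> U" "q \<in> U \<Longrightarrow> g (f q) = q" "y \<in> V \<Longrightarrow> f (g y) = y"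
  using hom by (auto simp: homeomorphism_def)

lemma openin_S': "openin (top_of_set S) S'" by (rule openin_open_Int[OF opens(1)])

lemma tangent_S': "q \<in> S' \<Longrightarrow> tangent S' q = tangent S q" by (rule tangent_openin[OF openin_S'])

lemma g_slice: "y \<in> L \<Longrightarrow> y \<in> V \<Longrightarrow> g y \<in> S'"
proof -
  assume "y \<in> L" "y \<in> V"
  then have "y \<in> f ` S'" using slice by simp
  then show ?thesis using maps(3) by auto
qed

lemma D: "q \<in> U \<Longrightarrow> (f has_derivative Df q) (at q)" "y \<in> V \<Longrightarrow> (g has_derivative Dg y) (at y)"
  using smooth_on_open_derivative[OF f] smooth_on_open_derivative[OF g] by simp_all

lemma linear_D: "q \<in> U \<Longrightarrow> linear (Df q)" "y \<in> V \<Longrightarrow> linear (Dg y)"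
  using D has_derivative_linear by blast+

lemma DfDg: assumes q: "q \<in> U" shows "Dg (f q) (Df q v) = v" "Df q (Dg (f q) v) = v"
proof -
  have "((\<lambda>x. g (f x)) has_derivative (\<lambda>v. Dg (f q) (Df q v))) (at q)"
    by (rule has_derivative_compose[OF D(1)[OF q] D(2)[OF maps(1)[OF q]]])
  then have "((\<lambda>x. x) has_derivative (\<lambda>v. Dg (f q) (Df q v))) (at q)"
    by (rule has_derivative_transform_within_open[OF _ opens(1) q]) (rule maps(3))
  then show "Dg (f q) (Df q v) = v" using has_derivative_unique[OF _ has_derivative_ident] by metis
  have "((\<lambda>y. f (g y)) has_derivative (\<lambda>v. Df q (Dg (f q) v))) (at (f q))"
    using has_derivative_compose[OF D(2)[OF maps(1)[OF q]], of f "Df q"] D(1)[OF q] maps(3)[OF q] by simp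
  then have "((\<lambda>y. y) has_derivative (\<lambda>v. Df q (Dg (f q) v))) (at (f q))"
    by (rule has_derivative_transform_within_open[OF _ opens(2) maps(1)[OF q]]) (rule maps(4))
  then show "Df q (Dg (f q) v) = v" using has_derivative_unique[OF _ has_derivative_ident] by metis
qed

lemma dir_deriv_f: "q \<in> S' \<Longrightarrow> v \<in> tangent S q \<Longrightarrow> dir_deriv S' f q v = Df q v"
  by (rule dir_deriv_eq) (auto simp: tangent_S' intro: has_derivative_at_withinI D)

lemma smooth_map_f: "smooth_map S' f"
  by (rule smooth_mapI) (use f in blast)

lemma Df_tangent: assumes q: "q \<in> S'" and v: "v \<in> tangent S q" shows "Df q v \<in> L"
proof -
  obtain \<pi> where \<pi>: "bounded_linear \<pi>" "\<And>x. x \<in> L \<longleftrightarrow> \<pi> x = x" by (rule subspace_projection[OF L]) simp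
  have v': "v \<in> tangent S' q" using v tangent_S'[OF q] by simp
  have "dir_deriv S' (\<lambda>x. \<pi> (f x)) q v = dir_deriv S' f q v"
    using slice \<pi>(2) by (intro dir_deriv_cong[OF q]) auto
  then have "\<pi> (Df q v) = Df q v"
    using dir_deriv_bounded_linear[OF \<pi>(1) smooth_map_f q v'] dir_deriv_f[OF q v] by simp
  then show ?thesis using \<pi>(2) by simp
qed

lemma Dg_tangent: assumes q: "q \<in> S'" and l: "l \<in> L" shows "Dg (f q) l \<in> tangent S q"
proof -
  have qU: "q \<in> U" using q by simp
  have fq: "f q \<in> L" "f q \<in> V" using q slice by auto
  have bl: "bounded_linear (\<lambda>t::real. t *\<^sub>R l)" by (rule bounded_linear_scaleR_left)
  have "open ((\<lambda>t::real. f q + t *\<^sub>R l) -` V)"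
    by (rule open_vimage[OF opens(2)]) (intro continuous_intros)
  moreover have "0 \<in> (\<lambda>t::real. f q + t *\<^sub>R l) -` V" using fq by simp
  ultimately obtain e where e: "e > 0" "ball 0 e \<subseteq> (\<lambda>t::real. f q + t *\<^sub>R l) -` V" by (rule openE)
  have b: "ball 0 e = {-e<..<e::real}" by (auto simp: dist_real_def)
  have inV: "f q + t *\<^sub>R l \<in> V" if "t \<in> {-e<..<e}" for t using e(2) that unfolding b by auto
  show ?thesis
  proof (rule tangentI[OF e(1)])
    show "smooth_on_open {-e<..<e} (\<lambda>t. g (f q + t *\<^sub>R l))"
      unfolding smooth_on_open_def
      using Ck_on_affine[OF bl opens(2), of "{-e<..<e}" _ g "f q"] g inV by (simp add: smooth_on_open_def)
    show "(\<lambda>t. g (f q + t *\<^sub>R l)) ` {-e<..<e} \<subseteq> S"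
    proof (rule image_subsetI)
      fix t assume t: "t \<in> {-e<..<e}"
      have "f q + t *\<^sub>R l \<in> L" using fq(1) l L by (simp add: subspace_add subspace_scale)
      from g_slice[OF this inV[OF t]] show "g (f q + t *\<^sub>R l) \<in> S" by simp
    qed
    show "g (f q + 0 *\<^sub>R l) = q" using maps(3)[OF qU] by simp
    have "((\<lambda>t. f q + t *\<^sub>R l) has_derivative (\<lambda>t. t *\<^sub>R l)) (at 0)"
      by (auto intro!: derivative_eq_intros)
    from has_derivative_compose[OF this, of g "Dg (f q)"]
    show "((\<lambda>t. g (f q + t *\<^sub>R l)) has_vector_derivative Dg (f q) l) (at 0)"
      using D(2)[OF fq(2)] linear_cmul[OF linear_D(2)[OF fq(2)]] by (simp add: has_vector_derivative_def)
  qed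
qed

lemma tangent_iff: "q \<in> S' \<Longrightarrow> v \<in> tangent S q \<longleftrightarrow> Df q v \<in> L"
  using Df_tangent Dg_tangent[of q "Df q v"] DfDg by auto

lemma subspace_tangent_slice: "q \<in> S' \<Longrightarrow> subspace (tangent S q)"
  using L linear_D(1)[of q]
  by (auto simp: subspace_def tangent_iff linear_0 linear_add linear_cmul)

lemma dim_tangent_slice: assumes q: "q \<in> S'" shows "dim (tangent S q) = dim L"
proof (rule antisym)
  have U: "q \<in> U" using q by simp
  have "tangent S q \<subseteq> Dg (f q) ` L"
    using Df_tangent[OF q] DfDg(1)[OF U] by (metis image_eqI subsetI)
  then have "dim (tangent S q) \<le> dim (Dg (f q) ` L)" by (rule dim_subset)
  also have "\<dots> \<le> dim L" by (rule dim_image_le[OF linear_D(2)[OF maps(1)[OF U]]])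
  finally show "dim (tangent S q) \<le> dim L" .
  have "L \<subseteq> Df q ` tangent S q"
    using Dg_tangent[OF q] DfDg(2)[OF U] by (metis image_eqI subsetI)
  then have "dim L \<le> dim (Df q ` tangent S q)" by (rule dim_subset)
  also have "\<dots> \<le> dim (tangent S q)" by (rule dim_image_le[OF linear_D(1)[OF U]])
  finally show "dim L \<le> dim (tangent S q)" .
qed

text \<open>In the chart, \<open>X\<close> and \<open>Y\<close> take values in \<open>L\<close>, and so do their derivatives along \<open>S\<close>; their
  difference is the image of the bracket, because the second derivative of the chart is symmetric.\<close>

lemma lie_tangent_slice:
  assumes X: "vfield S X" and Y: "vfield S Y" and q: "q \<in> S'"
  shows "lie S X Y q \<in> tangent S q"
proof -
  have sub: "S' \<subseteq> S" by simp
  have res: "vfield S' Z" if Z: "vfield S Z" for Z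
    unfolding vfield_def
  proof (intro conjI ballI)
    show "smooth_map S' Z" by (rule smooth_map_subset[OF _ sub]) (use Z in \<open>simp add: vfield_def\<close>)
    show "Z r \<in> tangent S' r" if "r \<in> S'" for r
      using tangent_S'[OF that] Z that by (simp add: vfield_def)
  qed
  note XY = res[OF X] res[OF Y]
  obtain \<pi> where \<pi>: "bounded_linear \<pi>" "\<And>x. x \<in> L \<longleftrightarrow> \<pi> x = x" by (rule subspace_projection[OF L]) simp
  have fixed: "\<pi> (dir_deriv S' (\<lambda>q. dir_deriv S' f q (Z q)) q v) = dir_deriv S' (\<lambda>q. dir_deriv S' f q (Z q)) q v"
    if Z: "vfield S' Z" and v: "v \<in> tangent S' q" for Z v
  proof -
    have ZT: "Z r \<in> tangent S r" if "r \<in> S'" for r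
      unfolding tangent_S'[OF that, symmetric] using Z that unfolding vfield_def by blast
    have sm: "smooth_map S' (\<lambda>q. dir_deriv S' f q (Z q))"
      using Z by (intro smooth_map_dir_deriv smooth_map_f) (simp_all add: vfield_def)
    have "dir_deriv S' (\<lambda>r. \<pi> (dir_deriv S' f r (Z r))) q v = dir_deriv S' (\<lambda>q. dir_deriv S' f q (Z q)) q v"
    proof (rule dir_deriv_cong[OF q])
      fix r assume r: "r \<in> S'"
      show "\<pi> (dir_deriv S' f r (Z r)) = dir_deriv S' f r (Z r)"
        using Df_tangent[OF r ZT[OF r]] \<pi>(2) by (simp add: dir_deriv_f[OF r ZT[OF r]])
    qed
    then show ?thesis using dir_deriv_bounded_linear[OF \<pi>(1) sm q v] by simp
  qed
  have t: "X q \<in> tangent S' q" "Y q \<in> tangent S' q" using XY q by (auto simp: vfield_def)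
  have "\<pi> (Df q (lie S' X Y q)) = Df q (lie S' X Y q)"
    using dir_deriv_commute_extension[OF opens(1) f _ q _ XY, of f] q
      fixed[OF XY(2) t(1)] fixed[OF XY(1) t(2)] linear_diff[OF bounded_linear.linear[OF \<pi>(1)]]
    by (metis IntE)
  then have "lie S' X Y q \<in> tangent S q" using \<pi>(2) tangent_iff[OF q] by simp
  moreover have "lie S' X Y q = lie S X Y q"
    using X Y unfolding lie_def vfield_def
    by (simp only: dir_deriv_subset[OF _ sub q t(1), of Y] dir_deriv_subset[OF _ sub q t(2), of X])
  ultimately show ?thesis by simp
qed

text \<open>Along the preimage of a segment in \<open>L\<close> the function has derivative zero.\<close>

lemma locally_constant_slice:
  fixes h :: "'a \<Rightarrow> real"
  assumes h: "smooth_map S h" and d: "\<And>q v. q \<in> S \<Longrightarrow> v \<in> tangent S q \<Longrightarrow> dir_deriv S h q v = 0"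
    and p: "p \<in> S'"
  obtains W where "openin (top_of_set S) W" "p \<in> W" "\<forall>q\<in>W. h q = h p"
proof -
  have fp: "f p \<in> L" "f p \<in> V" using p slice by auto
  obtain e where e: "e > 0" "ball (f p) e \<subseteq> V" using opens(2) fp(2) by (rule openE)
  have const: "h (g y) = h p" if y: "y \<in> L" "y \<in> ball (f p) e" for y
  proof -
    define w where "w = y - f p"
    have w: "w \<in> L" using y(1) fp(1) L by (simp add: w_def subspace_diff)
    have inL: "f p + t *\<^sub>R w \<in> L" for t :: real using fp(1) w L by (simp add: subspace_add subspace_scale)
    have inV: "f p + t *\<^sub>R w \<in> V" if "t \<in> {0..1}" for t :: real
    proof -
      have "dist (f p) (f p + t *\<^sub>R w) = t * dist (f p) y" using that by (simp add: dist_norm w_def norm_minus_commute)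
      also have "\<dots> \<le> 1 * dist (f p) y" using that by (intro mult_right_mono) auto
      also have "\<dots> < e" using y(2) by simp
      finally show ?thesis using e(2) by auto
    qed
    define k where "k t = g (f p + t *\<^sub>R w)" for t :: real
    have kS: "k t \<in> S'" if "t \<in> {0..1}" for t using g_slice[OF inL inV[OF that]] by (simp add: k_def)
    have "\<exists>c. \<forall>t\<in>{0..1}. h (k t) = c"
    proof (rule has_derivative_zero_constant)
      fix t :: real assume t: "t \<in> {0..1}"
      let ?y = "f p + t *\<^sub>R w"
      have "((\<lambda>t. f p + t *\<^sub>R w) has_derivative (\<lambda>t. t *\<^sub>R w)) (at t)" by (auto intro!: derivative_eq_intros)
      from has_derivative_compose[OF this D(2)[OF inV[OF t]]]
      have k: "(k has_derivative (\<lambda>s. s *\<^sub>R Dg ?y w)) (at t within {0..1})"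
        using linear_cmul[OF linear_D(2)[OF inV[OF t]]] by (auto simp: k_def[abs_def] intro: has_derivative_at_withinI)
      have kS0: "k t \<in> S" using kS[OF t] by simp
      obtain h' where h': "(h has_derivative h') (at (k t) within S)" "linear h'"
        "\<forall>v\<in>tangent S (k t). dir_deriv S h (k t) v = h' v" by (rule smooth_dir_deriv[OF h kS0])
      have "f (k t) = ?y" using maps(4)[OF inV[OF t]] by (simp add: k_def)
      then have "Dg ?y w \<in> tangent S (k t)" using Dg_tangent[OF kS[OF t] w] by simp
      then have z: "h' (Dg ?y w) = 0" using h'(3) d[OF kS0] by simp
      have "k ` {0..1} \<subseteq> S" using kS by auto
      from has_derivative_in_compose[OF k has_derivative_subset[OF h'(1) this]]
      show "((\<lambda>t. h (k t)) has_derivative (\<lambda>h. 0)) (at t within {0..1})"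
        by (simp add: linear_cmul[OF h'(2)] z)
    qed simp
    then have "h (k 1) = h (k 0)" by (metis atLeastAtMost_iff zero_le_one order_refl)
    then show ?thesis using maps(3)[of p] p by (simp add: k_def w_def)
  qed
  have c: "continuous_on U f" using hom by (simp add: homeomorphism_def)
  have o: "open (U \<inter> f -` ball (f p) e)" by (rule continuous_open_preimage[OF c opens(1)]) simp
  show ?thesis
  proof (rule that, rule_tac [3] ballI)
    show "openin (top_of_set S) (S \<inter> (U \<inter> f -` ball (f p) e))" by (rule openin_open_Int[OF o])
    show "p \<in> S \<inter> (U \<inter> f -` ball (f p) e)" using p e by simp
    fix q assume q: "q \<in> S \<inter> (U \<inter> f -` ball (f p) e)"
    then have "f q \<in> L" using slice by auto
    then show "h q = h p" using const[of "f q"] q maps(3)[of q] by simp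
  qed
qed

end

lemma submanifold_slice_chart:
  fixes S :: "'a::euclidean_space set"
  assumes "submanifold d S" "p \<in> S"
  obtains U V L f g where "slice_chart S U V L f g" "p \<in> U" "dim L = d"
proof -
  have "\<exists>(U :: 'a set) (V :: 'a set) f g L. p \<in> U \<and> smooth_on_open U f \<and> smooth_on_open V g \<and>
      homeomorphism U V f g \<and> subspace L \<and> dim L = d \<and> f ` (S \<inter> U) = L \<inter> V"
    using assms(1) unfolding submanifold_def by (rule bspec[OF _ assms(2)])
  then obtain U :: "'a set" and V :: "'a set" and f g L where "p \<in> U" "smooth_on_open U f" "smooth_on_open V g" "homeomorphism U V f g"
        "subspace L" "dim L = d" "f ` (S \<inter> U) = L \<inter> V" by (elim exE conjE)
  then show ?thesis by (intro that[of U V L f g] slice_chart.intro) assumption+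
qed

lemma submanifold_openin:
  fixes S :: "'a::euclidean_space set"
  assumes S: "submanifold d S" and W: "openin (top_of_set S) W"
  shows "submanifold d W"
  unfolding submanifold_def
proof
  fix p assume p: "p \<in> W"
  obtain T where T: "open T" "W = S \<inter> T" using W by (auto simp: openin_open)
  have "p \<in> S" using p T by auto
  then obtain U V L f g where c: "slice_chart S U V L f g" "p \<in> U" "dim L = d"
    by (rule submanifold_slice_chart[OF S])
  interpret slice_chart S U V L f g by (rule c(1))
  have gc: "continuous_on V g" and fc: "continuous_on U f" using hom by (simp_all add: homeomorphism_def)
  have oU: "open (U \<inter> T)" and oV: "open (V \<inter> g -` T)"
    using opens T continuous_open_preimage[OF gc opens(2) T(1)] by auto
  have img: "f ` (U \<inter> T) = V \<inter> g -` T"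
  proof
    show "f ` (U \<inter> T) \<subseteq> V \<inter> g -` T" using maps by auto
    show "V \<inter> g -` T \<subseteq> f ` (U \<inter> T)"
    proof
      fix y assume "y \<in> V \<inter> g -` T"
      then show "y \<in> f ` (U \<inter> T)" using maps(2,4)[of y] by (intro image_eqI[of _ _ "g y"]) auto
    qed
  qed
  have img2: "g ` (V \<inter> g -` T) = U \<inter> T"
  proof
    show "g ` (V \<inter> g -` T) \<subseteq> U \<inter> T" using maps by auto
    show "U \<inter> T \<subseteq> g ` (V \<inter> g -` T)"
    proof
      fix x assume "x \<in> U \<inter> T"
      then show "x \<in> g ` (V \<inter> g -` T)" using maps(1,3)[of x] by (intro image_eqI[of _ _ "f x"]) auto
    qed
  qed
  have "homeomorphism (U \<inter> T) (V \<inter> g -` T) f g"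
    unfolding homeomorphism_def
    using img img2 maps(3,4) continuous_on_subset[OF fc] continuous_on_subset[OF gc] by auto
  moreover have "f ` (W \<inter> (U \<inter> T)) = L \<inter> (V \<inter> g -` T)"
  proof
    show "f ` (W \<inter> (U \<inter> T)) \<subseteq> L \<inter> (V \<inter> g -` T)" using slice T(2) maps by auto
    show "L \<inter> (V \<inter> g -` T) \<subseteq> f ` (W \<inter> (U \<inter> T))"
    proof
      fix y assume y: "y \<in> L \<inter> (V \<inter> g -` T)"
      then have "g y \<in> S \<inter> U" using g_slice by auto
      then show "y \<in> f ` (W \<inter> (U \<inter> T))" using y maps(4)[of y] T(2) by (intro image_eqI[of _ _ "g y"]) auto
    qed
  qed
  ultimately show "\<exists>(U::'a set) (V::'a set) f g L. p \<in> U \<and> smooth_on_open U f \<and> smooth_on_open V g \<and> homeomorphism U V f g \<and>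
        subspace L \<and> dim L = d \<and> f ` (W \<inter> U) = L \<inter> V"
    using p T c smooth_on_open_subset[OF f oU] smooth_on_open_subset[OF g oV] L
    by (intro exI[of _ "U \<inter> T"] exI[of _ "V \<inter> g -` T"] exI[of _ f] exI[of _ g] exI[of _ L]) simp
qed

lemma submanifold_tangent:
  assumes S: "submanifold d S" and p: "p \<in> S"
  shows "subspace (tangent S p)" "dim (tangent S p) = d"
proof -
  obtain U V L f g where c: "slice_chart S U V L f g" "p \<in> U" "dim L = d"
    by (rule submanifold_slice_chart[OF S p])
  interpret slice_chart S U V L f g by (rule c(1))
  show "subspace (tangent S p)" "dim (tangent S p) = d"
    using subspace_tangent_slice[of p] dim_tangent_slice[of p] p c by auto
qed

lemma submanifold_lie_tangent:
  assumes S: "submanifold d S" and "vfield S X" "vfield S Y" and p: "p \<in> S"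
  shows "lie S X Y p \<in> tangent S p"
proof -
  obtain U V L f g where c: "slice_chart S U V L f g" "p \<in> U" "dim L = d"
    by (rule submanifold_slice_chart[OF S p])
  interpret slice_chart S U V L f g by (rule c(1))
  show ?thesis using lie_tangent_slice[OF assms(2,3)] p c(2) by simp
qed

lemma submanifold_locally_constant:
  fixes h :: "'a::euclidean_space \<Rightarrow> real"
  assumes S: "submanifold d S" and h: "smooth_map S h"
    and d: "\<And>q v. q \<in> S \<Longrightarrow> v \<in> tangent S q \<Longrightarrow> dir_deriv S h q v = 0" and p: "p \<in> S"
  obtains W where "openin (top_of_set S) W" "p \<in> W" "\<forall>q\<in>W. h q = h p"
proof -
  obtain U V L f g where c: "slice_chart S U V L f g" "p \<in> U" "dim L = d"
    by (rule submanifold_slice_chart[OF S p])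
  interpret slice_chart S U V L f g by (rule c(1))
  have "p \<in> S \<inter> U" using p c(2) by simp
  from locally_constant_slice[OF h d this] obtain W where
    "openin (top_of_set S) W" "p \<in> W" "\<forall>q\<in>W. h q = h p" by metis
  then show ?thesis by (rule that)
qed

section \<open>The structure equations of a real hypersurface\<close>

lemma bounded_bilinear_fs: "bounded_bilinear (fs :: complex^'m::finite^'m \<Rightarrow> complex^'m^'m \<Rightarrow> real)"
  by (simp add: bilinear_conv_bounded_bilinear[symmetric] bilinear_def linear_iff fs_def
      inner_add_left inner_add_right add_divide_distrib)

interpretation fs: bounded_bilinear "fs :: complex^'m::finite^'m \<Rightarrow> complex^'m^'m \<Rightarrow> real"
  by (rule bounded_bilinear_fs)

lemma fs_commute: "fs x y = fs y x"
  by (simp add: fs_def inner_commute)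

lemma fs_pos: "fs x x \<ge> 0" "fs x x = 0 \<longleftrightarrow> x = 0"
  by (simp_all add: fs_def)

lemma fs_cproj: "p \<in> CP \<Longrightarrow> fs (cproj p v) w = fs v (cproj p w)"
  by (simp add: fs_def cproj_sym)

lemmas fs_simps = fs.add_left fs.add_right fs.diff_left fs.diff_right fs.minus_left fs.minus_right
  fs.scaleR_left fs.scaleR_right fs.zero_left fs.zero_right

lemma smooth_map_fs: "smooth_map S f \<Longrightarrow> smooth_map S g \<Longrightarrow> smooth_map S (\<lambda>q. fs (f q) (g q))"
  for f g :: "'a::euclidean_space \<Rightarrow> complex^'m::finite^'m"
  by (rule smooth_map_bilinear[OF bounded_bilinear_fs])

lemmas dir_deriv_fs = dir_deriv_bilinear[OF bounded_bilinear_fs]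

lemma linear_dcproj: "linear (dcproj p x)"
  by (rule linearI) (simp_all add: dcproj_def Let_def mm_simps algebra_simps)

lemma smooth_map_cproj_comp: "smooth_map S V \<Longrightarrow> smooth_map S (\<lambda>q. cproj q (V q))"
  unfolding cproj_def Let_def
  by (intro smooth_map_diff smooth_map_add smooth_map_scaleR smooth_map_mm smooth_map_id smooth_map_const
      smooth_map_bounded_linear[OF bounded_linear_madj])

lemma dir_deriv_cproj_comp:
  fixes S :: "(complex^'m::finite^'m) set"
  assumes V: "smooth_map S V" and p: "p \<in> S" and x: "x \<in> tangent S p"
  shows "dir_deriv S (\<lambda>q. cproj q (V q)) p x = dcproj p x (V p) + cproj p (dir_deriv S V p x)"
proof -
  have expand: "L v = (\<Sum>b\<in>Basis. (v \<bullet> b) *\<^sub>R L b)" if "linear L" for L :: "complex^'m^'m \<Rightarrow> complex^'m^'m" and v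
  proof -
    have "L v = L (\<Sum>b\<in>Basis. (v \<bullet> b) *\<^sub>R b)" by (simp only: euclidean_representation)
    then show ?thesis by (simp only: linear_sum[OF that] linear_cmul[OF that])
  qed
  have "dir_deriv S (\<lambda>q. cproj q (V q)) p x = dir_deriv S (\<lambda>q. \<Sum>b\<in>Basis. (V q \<bullet> b) *\<^sub>R cproj q b) p x"
    by (rule dir_deriv_cong[OF p expand[OF linear_cproj]])
  also have "\<dots> = (\<Sum>b\<in>Basis. dir_deriv S (\<lambda>q. (V q \<bullet> b) *\<^sub>R cproj q b) p x)"
    by (intro dir_deriv_sum finite_Basis p x smooth_map_scaleR smooth_map_cproj smooth_map_inner V smooth_map_const)
  also have "\<dots> = (\<Sum>b\<in>Basis. (V p \<bullet> b) *\<^sub>R dcproj p x b + (dir_deriv S V p x \<bullet> b) *\<^sub>R cproj p b)"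
    by (simp add: dir_deriv_scaleR[OF smooth_map_inner[OF V smooth_map_const] smooth_map_cproj p x]
        dir_deriv_cproj[OF p x] dir_deriv_inner[OF V smooth_map_const p x] dir_deriv_const[OF x] add.commute)
  also have "\<dots> = dcproj p x (V p) + cproj p (dir_deriv S V p x)"
    by (simp only: sum.distrib expand[OF linear_cproj, symmetric] expand[OF linear_dcproj, symmetric])
  finally show ?thesis .
qed

locale oriented_hypersurface =
  fixes M :: "(complex^'m::finite^'m) set" and N :: "complex^'m^'m \<Rightarrow> complex^'m^'m" and n :: nat
  assumes card: "CARD('m) = n + 1" and n: "n > 2" and M_CP: "M \<subseteq> CP"
    and M_sub: "submanifold (2 * n - 1) M" and normal: "unit_normal M N"
begin

text \<open>The projector onto the tangent space of the hypersurface.\<close>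

definition P :: "complex^'m^'m \<Rightarrow> complex^'m^'m \<Rightarrow> complex^'m^'m" where
  "P p v = cproj p v - fs v (N p) *\<^sub>R N p"

text \<open>The shape operator at a point.  The projection is to the tangent space of \<open>CP\<close> only; the result is
  tangent to the hypersurface because \<open>N\<close> has constant length.\<close>

definition A :: "complex^'m^'m \<Rightarrow> complex^'m^'m \<Rightarrow> complex^'m^'m" where
  "A p x = - cproj p (dir_deriv M N p x)"

abbreviation T :: "complex^'m^'m \<Rightarrow> (complex^'m^'m) set" where
  "T \<equiv> tangent M"

abbreviation J :: "complex^'m^'m \<Rightarrow> complex^'m^'m \<Rightarrow> complex^'m^'m" where
  "J \<equiv> cpJ"

lemma CP: "p \<in> M \<Longrightarrow> p \<in> CP" using M_CP by auto

lemma N_smooth: "smooth_map M N" and N_norm: "p \<in> M \<Longrightarrow> fs (N p) (N p) = 1"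
  and N_ctan: "p \<in> M \<Longrightarrow> ctan p (N p)"
  using normal CP by (auto simp: unit_normal_def tangent_CP)

text \<open>The inclusion from left to right is an equality because the dimensions agree: \<open>2 n - 1\<close> for the
  hypersurface, and less than \<open>2 n\<close> for the complement of \<open>N\<close> in the tangent space of \<open>CP\<close>.\<close>

lemma T_iff: assumes p: "p \<in> M" shows "v \<in> T p \<longleftrightarrow> ctan p v \<and> fs v (N p) = 0"
proof -
  let ?C = "tangent CP p" and ?Q = "{v. ctan p v \<and> fs v (N p) = 0}"
  have C: "?C = {v. ctan p v}" using tangent_CP[OF CP[OF p]] by auto
  have sC: "subspace ?C" unfolding C
    by (auto simp: subspace_def ctan_def mm_simps simp flip: scaleR_add_right)
      (metis add.assoc add.commute add.left_commute)
  have sQ: "subspace ?Q" using sC unfolding C by (auto simp: subspace_def fs_simps)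
  have sub: "?Q \<subseteq> ?C" unfolding C by auto
  have "N p \<in> ?C" "N p \<notin> ?Q" using N_ctan[OF p] N_norm[OF p] unfolding C by auto
  then have "?Q \<noteq> ?C" by auto
  then have "dim ?Q < dim ?C"
    using subspace_dim_equal[OF sQ sC sub] dim_subset[OF sub] by linarith
  then have "dim ?Q \<le> 2 * n - 1" using dim_tangent_CP[OF CP[OF p]] card by simp
  moreover have "T p \<subseteq> ?Q"
    using tangent_mono[OF M_CP, of p] normal p unfolding C by (auto simp: unit_normal_def)
  ultimately have "T p = ?Q"
    using submanifold_tangent[OF M_sub p] by (intro subspace_dim_equal sQ) auto
  then show ?thesis by auto
qed

lemma T_ctan: "p \<in> M \<Longrightarrow> x \<in> T p \<Longrightarrow> ctan p x" and T_N: "p \<in> M \<Longrightarrow> x \<in> T p \<Longrightarrow> fs x (N p) = 0"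
  using T_iff by auto

lemma ctan_scaleR: "ctan p x \<Longrightarrow> ctan p (c *\<^sub>R x)"
  by (auto simp: ctan_def mm_simps simp flip: scaleR_add_right)

lemma ctan_minus: "ctan p x \<Longrightarrow> ctan p (- x)"
  using ctan_scaleR[of p x "-1"] by simp

lemma ctan_diff: assumes "ctan p x" "ctan p y" shows "ctan p (x - y)"
proof -
  have "(x - y) ** p + p ** (x - y) = (x ** p + p ** x) - (y ** p + p ** y)"
    by (simp add: mm_simps)
  then show ?thesis using assms by (simp add: ctan_def)
qed

lemma fs_cproj_N: "p \<in> M \<Longrightarrow> fs (cproj p v) (N p) = fs v (N p)"
  using fs_cproj[OF CP, of p v "N p"] cproj_id[OF CP N_ctan, of p] by simp

lemma P_cproj: "p \<in> M \<Longrightarrow> P p (cproj p v) = P p v"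
  by (simp add: P_def fs_cproj_N cproj_id[OF CP cproj_ctan[OF CP]])

lemma P_ctan: "p \<in> M \<Longrightarrow> ctan p v \<Longrightarrow> P p v = v - fs v (N p) *\<^sub>R N p"
  by (simp add: P_def cproj_id[OF CP])

lemma P_N: "p \<in> M \<Longrightarrow> P p (N p) = 0"
  by (simp add: P_ctan N_ctan N_norm)

lemma projected_M: "projected_matrix_manifold M P"
proof (intro projected_matrix_manifold.intro projected_manifold.intro)
  show "smooth_map M (\<lambda>q. P q v)" for v
    unfolding P_def
    by (intro smooth_map_diff smooth_map_cproj smooth_map_scaleR smooth_map_fs smooth_map_const N_smooth)
  show "linear (P p)" for p
    by (rule linearI) (simp_all add: P_def linear_add[OF linear_cproj] linear_cmul[OF linear_cproj] fs_simps algebra_simps)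
  show "P p v \<in> T p" if p: "p \<in> M" for p v
    unfolding T_iff[OF p] P_def
    by (intro conjI ctan_diff cproj_ctan[OF CP[OF p]] ctan_scaleR N_ctan[OF p])
      (simp add: fs_simps fs_cproj_N[OF p] N_norm[OF p])
  show "P p v = v" if "p \<in> M" "v \<in> T p" for p v
    using that by (simp add: P_def cproj_id[OF CP T_ctan] T_N)
  show "P p v \<bullet> w = v \<bullet> P p w" if p: "p \<in> M" for p v w
    using cproj_sym[OF CP[OF p], of v w]
    by (simp add: P_def inner_diff_left inner_diff_right fs_def inner_commute[of "N p" w])
  show "lie M X Y p \<in> T p" if "vfield M X" "vfield M Y" "p \<in> M" for X Y p
    by (rule submanifold_lie_tangent[OF M_sub that])
qed

sublocale projected_matrix_manifold M P
  by (rule projected_M)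

lemma P_linears: "p \<in> M \<Longrightarrow> P p (x + y) = P p x + P p y" "p \<in> M \<Longrightarrow> P p (x - y) = P p x - P p y"
  "p \<in> M \<Longrightarrow> P p (- x) = - P p x" "p \<in> M \<Longrightarrow> P p (c *\<^sub>R x) = c *\<^sub>R P p x" "p \<in> M \<Longrightarrow> P p 0 = 0"
  by (simp_all add: linear_add[OF P_linear] linear_diff[OF P_linear] linear_neg[OF P_linear]
      linear_cmul[OF P_linear] linear_0[OF P_linear])

lemma P_normal: "p \<in> M \<Longrightarrow> cproj p v = 0 \<Longrightarrow> P p v = 0"
  using P_cproj[of p v] P_linears(5) by simp

lemma J_linears: "J p (x + y) = J p x + J p y" "J p (x - y) = J p x - J p y" "J p (- x) = - J p x"
  "J p (c *\<^sub>R x) = c *\<^sub>R J p x" "J p 0 = 0"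
proof -
  interpret bounded_bilinear "cpJ :: complex^'m^'m \<Rightarrow> complex^'m^'m \<Rightarrow> _" by (rule bounded_bilinear_cpJ)
  show "J p (x + y) = J p x + J p y" "J p (x - y) = J p x - J p y" "J p (- x) = - J p x"
    "J p (c *\<^sub>R x) = c *\<^sub>R J p x" "J p 0 = 0"
    by (rule add_right diff_right minus_right scaleR_right zero_right)+
qed

lemma xi_facts: assumes p: "p \<in> M"
  shows "xi N p \<in> T p" "fs (xi N p) (xi N p) = 1" "J p (xi N p) = N p" "J p (N p) = - xi N p"
proof -
  have N: "fs (J p (N p)) (N p) = 0"
    using fs_cpJ[OF CP[OF p], of "N p" "N p"] fs_commute[of "N p" "J p (N p)"] by simp
  show "xi N p \<in> T p"
    unfolding T_iff[OF p] xi_def using N ctan_cpJ(1)[OF CP[OF p] N_ctan[OF p]] by (simp add: ctan_minus fs_simps)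
  show "fs (xi N p) (xi N p) = 1"
    using fs_cpJ[OF CP[OF p], of "N p" "J p (N p)"] ctan_cpJ(2)[OF CP[OF p] N_ctan[OF p]]
    by (simp add: xi_def fs_simps N_norm[OF p])
  show "J p (xi N p) = N p" "J p (N p) = - xi N p"
    using ctan_cpJ(2)[OF CP[OF p] N_ctan[OF p]] by (simp_all add: xi_def J_linears)
qed

lemma eta_J: "p \<in> M \<Longrightarrow> eta N p v = fs (J p v) (N p)"
  by (simp add: eta_def xi_def fs_simps fs_cpJ[OF CP])

lemma phi_P: assumes "p \<in> M" "x \<in> T p" shows "phi N p x = P p (J p x)"
  by (simp add: phi_def eta_J[OF assms(1)] P_ctan[OF assms(1) ctan_cpJ(1)[OF CP[OF assms(1)] T_ctan[OF assms]]])

lemma phi_facts: assumes p: "p \<in> M" and x: "x \<in> T p"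
  shows "phi N p x \<in> T p" "phi N p (phi N p x) = - x + eta N p x *\<^sub>R xi N p" "eta N p (phi N p x) = 0"
    "y \<in> T p \<Longrightarrow> fs (phi N p x) y = - fs x (phi N p y)"
proof -
  note cJ = ctan_cpJ[OF CP[OF p] T_ctan[OF p x]]
  show 1: "phi N p x \<in> T p" using P_tangent[OF p] phi_P[OF p x] by simp
  have 2: "J p (phi N p x) = - x + eta N p x *\<^sub>R xi N p"
    unfolding phi_def[of N p x] by (simp add: J_linears cJ xi_facts[OF p])
  show 3: "eta N p (phi N p x) = 0"
    unfolding eta_J[OF p] 2 by (simp add: fs_simps T_N[OF p x] T_N[OF p xi_facts(1)[OF p]])
  show "phi N p (phi N p x) = - x + eta N p x *\<^sub>R xi N p"
    unfolding phi_def[of N p "phi N p x"] 2 3 by simp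
  show "y \<in> T p \<Longrightarrow> fs (phi N p x) y = - fs x (phi N p y)"
    using T_N[OF p x] T_N[OF p, of y] fs_cpJ[OF CP[OF p], of x y]
    by (simp add: phi_def fs_simps fs_commute[of "N p"])
qed

lemma phi_linears: "phi N p (x + y) = phi N p x + phi N p y" "phi N p (x - y) = phi N p x - phi N p y"
  "phi N p (- x) = - phi N p x" "phi N p (c *\<^sub>R x) = c *\<^sub>R phi N p x"
  by (simp_all add: phi_def eta_def J_linears fs_simps algebra_simps)

lemma phi_xi: "p \<in> M \<Longrightarrow> phi N p (xi N p) = 0"
  by (simp add: phi_def xi_facts eta_def)

lemma smooth_map_J: "smooth_map M V \<Longrightarrow> smooth_map M (\<lambda>q. J q (V q))"
  by (rule smooth_map_bilinear[OF bounded_bilinear_cpJ smooth_map_id])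

lemma vfield_xi: "vfield M (xi N)"
  using smooth_map_minus[OF smooth_map_J[OF N_smooth]] xi_facts(1) by (simp add: vfield_def xi_def[abs_def])

lemma smooth_map_eta: "smooth_map M V \<Longrightarrow> smooth_map M (\<lambda>q. eta N q (V q))"
  unfolding eta_def using vfieldD(1)[OF vfield_xi] by (intro smooth_map_fs)

lemma vfield_phi: assumes "vfield M Y" shows "vfield M (\<lambda>q. phi N q (Y q))"
  unfolding vfield_def
proof (intro conjI ballI)
  show "smooth_map M (\<lambda>q. phi N q (Y q))"
    unfolding phi_def
    by (intro smooth_map_diff smooth_map_J smooth_map_scaleR smooth_map_eta N_smooth vfieldD(1)[OF assms])
  show "phi N p (Y p) \<in> T p" if "p \<in> M" for p by (rule phi_facts(1)[OF that vfieldD(2)[OF assms that]])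
qed

subsection \<open>The shape operator\<close>

lemma dN_N: assumes p: "p \<in> M" and x: "x \<in> T p" shows "fs (dir_deriv M N p x) (N p) = 0"
proof -
  have "dir_deriv M (\<lambda>q. fs (N q) (N q)) p x = dir_deriv M (\<lambda>q. 1) p x"
    by (rule dir_deriv_cong[OF p]) (rule N_norm)
  then have "2 * fs (dir_deriv M N p x) (N p) = 0"
    by (simp add: dir_deriv_fs[OF N_smooth N_smooth p x] dir_deriv_const[OF x] fs_commute[of "N p"])
  then show ?thesis by simp
qed

text \<open>The derivative of a field tangent to \<open>CP\<close> consists of a part normal to \<open>CP\<close>, determined by its
  value, and of the ambient covariant derivative.\<close>

lemma dir_deriv_ctan:
  assumes V: "smooth_map M V" "\<And>q. q \<in> M \<Longrightarrow> ctan q (V q)" and p: "p \<in> M" and x: "x \<in> T p"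
  shows "dir_deriv M V p x = dcproj p x (V p) + cproj p (dir_deriv M V p x)"
proof -
  have "dir_deriv M V p x = dir_deriv M (\<lambda>q. cproj q (V q)) p x"
    by (rule dir_deriv_cong[OF p]) (simp add: cproj_id[OF CP V(2)])
  then show ?thesis by (simp only: dir_deriv_cproj_comp[OF V(1) p x])
qed

lemma dN: "p \<in> M \<Longrightarrow> x \<in> T p \<Longrightarrow> dir_deriv M N p x = dcproj p x (N p) - A p x"
  using dir_deriv_ctan[OF N_smooth N_ctan] by (simp add: A_def)

lemma P_dN: "p \<in> M \<Longrightarrow> x \<in> T p \<Longrightarrow> P p (dir_deriv M N p x) = - A p x"
  by (simp add: P_def A_def dN_N)

lemma A_tangent: "p \<in> M \<Longrightarrow> x \<in> T p \<Longrightarrow> A p x \<in> T p"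
  using P_tangent[of p "dir_deriv M N p x"] subspace_neg[OF subspace_tangent] by (fastforce simp: P_dN)

lemma A_linears: assumes "p \<in> M" "x \<in> T p"
  shows "y \<in> T p \<Longrightarrow> A p (x + y) = A p x + A p y" "A p (c *\<^sub>R x) = c *\<^sub>R A p x"
    "y \<in> T p \<Longrightarrow> A p (x - y) = A p x - A p y" "A p (- x) = - A p x"
proof -
  show 1: "A p (x + y) = A p x + A p y" if "y \<in> T p" for y
    using that assms by (simp add: A_def dir_deriv_dir_add N_smooth linear_add[OF linear_cproj])
  have 2: "A p (c *\<^sub>R x) = c *\<^sub>R A p x" if "x \<in> T p" for c x
    using that assms by (simp add: A_def dir_deriv_dir_scaleR N_smooth linear_cmul[OF linear_cproj])
  show "A p (c *\<^sub>R x) = c *\<^sub>R A p x" by (rule 2[OF assms(2)])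
  show 3: "A p (- x) = - A p x" using 2[OF assms(2), of "-1"] by simp
  show "A p (x - y) = A p x - A p y" if "y \<in> T p"
    using 1[of "- y"] 2[of y "-1"] that subspace_neg[OF subspace_tangent[OF assms(1)]] by simp
qed

lemma vfield_A: assumes "vfield M X" shows "vfield M (\<lambda>q. A q (X q))"
  unfolding vfield_def
proof (intro conjI ballI)
  show "smooth_map M (\<lambda>q. A q (X q))"
    unfolding A_def
    by (intro smooth_map_minus smooth_map_cproj_comp smooth_map_dir_deriv N_smooth) (simp_all add: vfieldD[OF assms])
  show "A p (X p) \<in> T p" if "p \<in> M" for p by (rule A_tangent[OF that vfieldD(2)[OF assms that]])
qed

text \<open>Differentiating \<open>\<langle>Y, N\<rangle> = 0\<close>.\<close>

lemma fs_A: assumes p: "p \<in> M" and x: "x \<in> T p" and Y: "vfield M Y"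
  shows "fs (dir_deriv M Y p x) (N p) = fs (A p x) (Y p)"
proof -
  note s = vfieldD(1)[OF Y] and t = vfieldD(2)[OF Y p]
  have "dir_deriv M (\<lambda>q. fs (Y q) (N q)) p x = dir_deriv M (\<lambda>q. 0) p x"
    by (rule dir_deriv_cong[OF p]) (simp add: T_N vfieldD[OF Y])
  then have "fs (dir_deriv M Y p x) (N p) = - fs (Y p) (dir_deriv M N p x)"
    by (simp add: dir_deriv_fs[OF s N_smooth p x] dir_deriv_const[OF x])
  also have "\<dots> = - fs (cproj p (Y p)) (dir_deriv M N p x)"
    using cproj_id[OF CP[OF p] T_ctan[OF p t]] by simp
  also have "\<dots> = fs (A p x) (Y p)" by (simp add: fs_cproj[OF CP[OF p]] A_def fs_simps fs_commute)
  finally show ?thesis .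
qed

text \<open>The bracket of two tangent fields has no normal component.\<close>

lemma A_sym: assumes p: "p \<in> M" and x: "x \<in> T p" and y: "y \<in> T p"
  shows "fs (A p x) y = fs x (A p y)"
proof -
  obtain X where X: "vfield M X" "X p = x" by (rule tangent_extend[OF p x])
  obtain Y where Y: "vfield M Y" "Y p = y" by (rule tangent_extend[OF p y])
  have "fs (lie M X Y p) (N p) = 0" by (rule T_N[OF p lie_tangent[OF X(1) Y(1) p]])
  then show ?thesis
    using fs_A[OF p x Y(1)] fs_A[OF p y X(1)] by (simp add: lie_def fs_simps X Y fs_commute[of x])
qed

text \<open>Projecting arbitrary smooth extensions by \<open>cproj\<close> produces the fields near \<open>p\<close> on \<open>CP\<close> that the
  definition asks for; the derivative in a direction tangent to \<open>M\<close> does not see the extension, so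
  the ambient covariant derivative is computed along \<open>M\<close>.\<close>

lemma ambient_nabla_eq:
  assumes X: "vfield M X" and V: "smooth_map M V" "\<And>q. q \<in> M \<Longrightarrow> ctan q (V q)" and p: "p \<in> M"
  shows "ambient_nabla M X V p = cproj p (dir_deriv M V p (X p))"
  unfolding ambient_nabla_def
proof (rule the_equality)
  obtain \<Omega> F G where w: "p \<in> \<Omega>" "open \<Omega>" "smooth_on_open \<Omega> F" "\<forall>q\<in>M \<inter> \<Omega>. F q = X q"
    "smooth_on_open \<Omega> G" "\<forall>q\<in>M \<inter> \<Omega>. G q = V q"
    by (rule common_extension[OF vfieldD(1)[OF X] V(1) p])
  define W where "W = CP \<inter> \<Omega>"
  have W: "openin (top_of_set CP) W" unfolding W_def by (rule openin_open_Int[OF w(2)])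
  interpret W: projected_matrix_manifold W cproj by (rule projected_CP[OF W])
  have sm: "smooth_map W F" "smooth_map W G"
    using w(3,5) by (auto intro!: smooth_mapI simp: W_def)
  have v: "vfield W (\<lambda>q. cproj q (F q))" "vfield W (\<lambda>q. cproj q (G q))"
    by (rule W.vfield_P[OF sm(1)], rule W.vfield_P[OF sm(2)])
  have pW: "p \<in> W" using CP[OF p] w(1) by (simp add: W_def)
  have agree: "\<forall>q\<in>W \<inter> M. cproj q (F q) = X q \<and> cproj q (G q) = V q"
  proof
    fix q assume q: "q \<in> W \<inter> M"
    then have "F q = X q" "G q = V q" "q \<in> M" using w by (auto simp: W_def)
    then show "cproj q (F q) = X q \<and> cproj q (G q) = V q"
      using cproj_id[OF CP V(2)] cproj_id[OF CP T_ctan[OF _ vfieldD(2)[OF X]]] by simp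
  qed
  have calc: "nabla W' X' V' p = cproj p (dir_deriv M V p (X p))"
    if W': "openin (top_of_set CP) W'" "p \<in> W'" and v: "vfield W' X'" "vfield W' V'"
      and agree: "\<forall>q\<in>W' \<inter> M. X' q = X q \<and> V' q = V q" for W' X' V'
  proof -
    interpret W': projected_matrix_manifold W' cproj by (rule projected_CP[OF W'(1)])
    have X'p: "X' p = X p" using agree W'(2) p by simp
    obtain \<Omega>' where "open \<Omega>'" "W' = CP \<inter> \<Omega>'" using W'(1) by (auto simp: openin_open)
    then have "W' \<inter> M = M \<inter> \<Omega>'" using M_CP by auto
    then have o: "openin (top_of_set M) (W' \<inter> M)" using \<open>open \<Omega>'\<close> by (simp add: openin_open_Int)
    have pM: "p \<in> W' \<inter> M" using W'(2) p by simp
    have t: "X p \<in> tangent (W' \<inter> M) p" using tangent_openin[OF o pM] vfieldD(2)[OF X p] by simp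
    have "dir_deriv W' V' p (X p) = dir_deriv (W' \<inter> M) V' p (X p)"
      by (rule dir_deriv_subset[OF W'.vfieldD(1)[OF v(2)] _ pM t, symmetric]) simp
    also have "\<dots> = dir_deriv (W' \<inter> M) V p (X p)"
      by (rule dir_deriv_cong[OF pM]) (use agree in simp)
    also have "\<dots> = dir_deriv M V p (X p)"
      by (rule dir_deriv_subset[OF V(1) _ pM t]) simp
    finally show ?thesis by (simp add: W'.nabla_eq[OF v W'(2)] W'.cov_def X'p)
  qed
  show "\<exists>W X' V'. openin (top_of_set CP) W \<and> p \<in> W \<and> vfield W X' \<and> vfield W V' \<and>
        (\<forall>q\<in>W \<inter> M. X' q = X q \<and> V' q = V q) \<and> cproj p (dir_deriv M V p (X p)) = nabla W X' V' p"
    by (intro exI[of _ W] exI[of _ "\<lambda>q. cproj q (F q)"] exI[of _ "\<lambda>q. cproj q (G q)"] conjI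
        W pW v agree calc[symmetric])
  fix w assume "\<exists>W X' V'. openin (top_of_set CP) W \<and> p \<in> W \<and> vfield W X' \<and> vfield W V' \<and>
        (\<forall>q\<in>W \<inter> M. X' q = X q \<and> V' q = V q) \<and> w = nabla W X' V' p"
  then obtain W' X' V' where "openin (top_of_set CP) W'" "p \<in> W'" "vfield W' X'" "vfield W' V'"
     "\<forall>q\<in>W' \<inter> M. X' q = X q \<and> V' q = V q" "w = nabla W' X' V' p" by (elim exE conjE)
  then show "w = cproj p (dir_deriv M V p (X p))" using calc[of W' X' V'] by simp
qed

lemma shape_eq: "vfield M X \<Longrightarrow> p \<in> M \<Longrightarrow> shape M N X p = A p (X p)"
  by (simp add: shape_def A_def ambient_nabla_eq N_smooth N_ctan)

subsection \<open>Covariant derivatives of the structure\<close>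

lemma dir_deriv_J:
  assumes "smooth_map M V" "p \<in> M" "x \<in> T p"
  shows "dir_deriv M (\<lambda>q. J q (V q)) p x = J x (V p) + J p (dir_deriv M V p x)"
  using dir_deriv_bilinear[OF bounded_bilinear_cpJ smooth_map_id assms] dir_deriv_id[OF assms(3)] by simp

text \<open>The complex structure is parallel: the derivative of \<open>J\<close> and the normal part of the derivative of \<open>V\<close>
  do not contribute to the tangential part.\<close>

lemma P_dir_deriv_J:
  assumes V: "smooth_map M V" "\<And>q. q \<in> M \<Longrightarrow> ctan q (V q)" and p: "p \<in> M" and x: "x \<in> T p"
  shows "P p (dir_deriv M (\<lambda>q. J q (V q)) p x) = P p (J p (cproj p (dir_deriv M V p x)))"
proof -
  have "dir_deriv M V p x = dcproj p x (V p) + cproj p (dir_deriv M V p x)"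
    by (rule dir_deriv_ctan[OF V p x])
  then have "J p (dir_deriv M V p x) = J p (dcproj p x (V p)) + J p (cproj p (dir_deriv M V p x))"
    by (metis J_linears(1))
  then show ?thesis
    by (simp add: dir_deriv_J[OF V(1) p x] P_linears[OF p] cpJ_dcproj[OF CP[OF p] T_ctan[OF p x] V(2)[OF p]]
        P_normal[OF p cproj_cpJ[OF CP[OF p] T_ctan[OF p x] V(2)[OF p]]])
qed

lemma cov_xi: assumes p: "p \<in> M" and x: "x \<in> T p" shows "cov (xi N) p x = phi N p (A p x)"
proof -
  have "cov (xi N) p x = - P p (dir_deriv M (\<lambda>q. J q (N q)) p x)"
    unfolding cov_def xi_def[abs_def]
    by (simp add: dir_deriv_minus[OF smooth_map_J[OF N_smooth] p x] P_linears[OF p])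
  also have "\<dots> = P p (J p (A p x))"
    by (simp add: P_dir_deriv_J[OF N_smooth N_ctan p x] A_def J_linears P_linears[OF p])
  finally show ?thesis by (simp add: phi_P[OF p A_tangent[OF p x]])
qed

lemma cov_phi: assumes Y: "vfield M Y" and p: "p \<in> M" and x: "x \<in> T p"
  shows "cov (\<lambda>q. phi N q (Y q)) p x = phi N p (cov Y p x) + eta N p (Y p) *\<^sub>R A p x - fs (A p x) (Y p) *\<^sub>R xi N p"
proof -
  note s = vfieldD(1)[OF Y] and t = T_ctan[OF _ vfieldD(2)[OF Y]]
  have e: "smooth_map M (\<lambda>q. eta N q (Y q))" by (rule smooth_map_eta[OF s])
  have c: "cproj p (dir_deriv M Y p x) = cov Y p x + fs (A p x) (Y p) *\<^sub>R N p"
    by (simp add: cov_def P_def fs_A[OF p x Y])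
  have "cov (\<lambda>q. phi N q (Y q)) p x = P p (dir_deriv M (\<lambda>q. J q (Y q)) p x)
      - P p (dir_deriv M (\<lambda>q. eta N q (Y q) *\<^sub>R N q) p x)"
    unfolding cov_def phi_def
    by (simp add: dir_deriv_diff[OF smooth_map_J[OF s] smooth_map_scaleR[OF e N_smooth] p x] P_linears[OF p])
  also have "\<dots> = P p (J p (cov Y p x + fs (A p x) (Y p) *\<^sub>R N p)) + eta N p (Y p) *\<^sub>R A p x"
    by (simp add: P_dir_deriv_J[OF s t p x] c dir_deriv_scaleR[OF e N_smooth p x] P_linears[OF p] P_N[OF p] P_dN[OF p x])
  also have "\<dots> = phi N p (cov Y p x) - fs (A p x) (Y p) *\<^sub>R xi N p + eta N p (Y p) *\<^sub>R A p x"
    by (simp add: J_linears P_linears[OF p] phi_P[OF p cov_tangent[OF p]] xi_facts[OF p] P_id[OF p xi_facts(1)[OF p]])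
  finally show ?thesis by simp
qed

lemma cov_fs:
  assumes "vfield M Y" "vfield M Z" "p \<in> M" "x \<in> T p"
  shows "dir_deriv M (\<lambda>q. fs (Y q) (Z q)) p x = fs (cov Y p x) (Z p) + fs (Y p) (cov Z p x)"
proof -
  have "dir_deriv M (\<lambda>q. Y q \<bullet> Z q / 2) p x = dir_deriv M (\<lambda>q. Y q \<bullet> Z q) p x / 2"
    using assms by (intro dir_deriv_bounded_linear bounded_linear_divide smooth_map_inner) (simp_all add: vfieldD)
  then show ?thesis by (simp add: fs_def cov_metric[OF assms])
qed

subsection \<open>The equations of Gauss and Codazzi\<close>

lemma DP_eq: assumes p: "p \<in> M" and x: "x \<in> T p"
  shows "DP p x v = dcproj p x v - fs v (dir_deriv M N p x) *\<^sub>R N p - fs v (N p) *\<^sub>R dir_deriv M N p x"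
proof -
  have s: "smooth_map M (\<lambda>q. fs v (N q))" by (rule smooth_map_fs[OF smooth_map_const N_smooth])
  show ?thesis
    unfolding DP_def P_def
    by (simp add: dir_deriv_diff[OF smooth_map_cproj smooth_map_scaleR[OF s N_smooth] p x] dir_deriv_cproj[OF p x]
        dir_deriv_scaleR[OF s N_smooth p x] dir_deriv_fs[OF smooth_map_const N_smooth p x] dir_deriv_const[OF x]
        fs_simps)
qed

text \<open>The projector of the hypersurface differs from that of \<open>CP\<close> by \<open>\<langle>_, N\<rangle> N\<close>; differentiating this
  difference twice leaves the quadratic term of the Gauss equation.\<close>

lemma P_DP_DP: assumes p: "p \<in> M" and x: "x \<in> T p" and y: "y \<in> T p" and z: "z \<in> T p"
  shows "P p (DP p x (DP p y z)) = P p (cproj p (dcproj p x (dcproj p y z))) + fs (A p y) z *\<^sub>R A p x"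
proof -
  note cx = T_ctan[OF p x] and cy = T_ctan[OF p y] and cz = T_ctan[OF p z]
  have zN: "fs z (dir_deriv M N p y) = - fs (A p y) z"
  proof -
    have "fs z (dir_deriv M N p y) = fs (cproj p z) (dir_deriv M N p y)" by (simp add: cproj_id[OF CP[OF p] cz])
    then show ?thesis by (simp add: fs_cproj[OF CP[OF p]] A_def fs_simps fs_commute)
  qed
  have 1: "DP p y z = dcproj p y z + fs (A p y) z *\<^sub>R N p"
    by (simp add: DP_eq[OF p y] zN T_N[OF p z])
  have 2: "fs (dcproj p y z) (N p) = 0"
    using fs_cproj_N[OF p, of "dcproj p y z"] by (simp add: cproj_dcproj[OF CP[OF p] cy cz] fs_simps)
  have 3: "P p (dcproj p x (N p)) = 0"
    by (rule P_normal[OF p cproj_dcproj[OF CP[OF p] cx N_ctan[OF p]]])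
  have "P p (DP p x (DP p y z)) = P p (dcproj p x (dcproj p y z)) + fs (A p y) z *\<^sub>R A p x"
    unfolding 1 DP_eq[OF p x]
    by (simp add: linear_add[OF linear_dcproj] linear_cmul[OF linear_dcproj] P_linears[OF p] P_N[OF p]
        P_dN[OF p x] fs_simps 2 3 N_norm[OF p])
  then show ?thesis by (simp add: P_cproj[OF p])
qed

lemma gauss: assumes X: "vfield M X" and Y: "vfield M Y" and Z: "vfield M Z" and p: "p \<in> M"
  shows "curv M X Y Z p = fs (Y p) (Z p) *\<^sub>R X p - fs (X p) (Z p) *\<^sub>R Y p
     + fs (J p (Y p)) (Z p) *\<^sub>R phi N p (X p) - fs (J p (X p)) (Z p) *\<^sub>R phi N p (Y p)
     - (2 * fs (J p (X p)) (Y p)) *\<^sub>R phi N p (Z p)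
     + fs (A p (Y p)) (Z p) *\<^sub>R A p (X p) - fs (A p (X p)) (Z p) *\<^sub>R A p (Y p)"
proof -
  note t = vfieldD(2)[OF X p] vfieldD(2)[OF Y p] vfieldD(2)[OF Z p]
  have "curv M X Y Z p = P p (cproj p (dcproj p (X p) (dcproj p (Y p) (Z p))) - cproj p (dcproj p (Y p) (dcproj p (X p) (Z p))))
     + fs (A p (Y p)) (Z p) *\<^sub>R A p (X p) - fs (A p (X p)) (Z p) *\<^sub>R A p (Y p)"
    by (simp add: curv_eq[OF X Y Z p] P_DP_DP[OF p t] P_DP_DP[OF p t(2,1,3)] P_linears[OF p])
  then show ?thesis
    by (simp add: CP_curvature[OF CP[OF p] T_ctan[OF p t(1)] T_ctan[OF p t(2)] T_ctan[OF p t(3)]]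
        P_linears[OF p] P_id[OF p t(1)] P_id[OF p t(2)] P_id[OF p t(3)] phi_P[OF p t(1)] phi_P[OF p t(2)] phi_P[OF p t(3)])
qed

text \<open>The second derivatives of \<open>N\<close> in \<open>\<nabla>\<^sub>X (A Y) - \<nabla>\<^sub>Y (A X)\<close> combine to the derivative along the bracket,
  which is again the shape operator; the rest is the ambient curvature applied to \<open>N\<close>.\<close>

lemma codazzi:
  assumes X: "vfield M X" and Y: "vfield M Y" and p: "p \<in> M"
  shows "cov (\<lambda>q. A q (Y q)) p (X p) - A p (cov Y p (X p))
      - (cov (\<lambda>q. A q (X q)) p (Y p) - A p (cov X p (Y p)))
    = eta N p (X p) *\<^sub>R phi N p (Y p) - eta N p (Y p) *\<^sub>R phi N p (X p) - (2 * fs (phi N p (X p)) (Y p)) *\<^sub>R xi N p"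
proof -
  have half: "cov (\<lambda>q. A q (Y q)) p (X p) = - P p (cproj p (dcproj p (X p) (dcproj p (Y p) (N p))))
      - P p (dir_deriv M (\<lambda>q. dir_deriv M N q (Y q)) p (X p))" if X: "vfield M X" and Y: "vfield M Y" for X Y
  proof -
    note t = vfieldD(2)[OF X p] vfieldD(2)[OF Y p]
    have s: "smooth_map M (\<lambda>q. dir_deriv M N q (Y q))"
      by (rule smooth_map_dir_deriv[OF N_smooth]) (simp_all add: vfieldD[OF Y])
    have "cov (\<lambda>q. A q (Y q)) p (X p) = - P p (dir_deriv M (\<lambda>q. cproj q (dir_deriv M N q (Y q))) p (X p))"
      unfolding cov_def A_def
      by (simp add: dir_deriv_minus[OF smooth_map_cproj_comp[OF s] p t(1)] P_linears[OF p])
    also have "\<dots> = - P p (dcproj p (X p) (dir_deriv M N p (Y p)))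
        - P p (dir_deriv M (\<lambda>q. dir_deriv M N q (Y q)) p (X p))"
      by (simp add: dir_deriv_cproj_comp[OF s p t(1)] P_linears[OF p] P_cproj[OF p])
    also have "P p (dcproj p (X p) (dir_deriv M N p (Y p))) = P p (dcproj p (X p) (dcproj p (Y p) (N p)))"
      by (simp add: dN[OF p t(2)] linear_diff[OF linear_dcproj] P_linears[OF p]
          P_normal[OF p cproj_dcproj[OF CP[OF p] T_ctan[OF p t(1)] T_ctan[OF p A_tangent[OF p t(2)]]]])
    finally show ?thesis by (simp add: P_cproj[OF p])
  qed
  note t = vfieldD(2)[OF X p] vfieldD(2)[OF Y p] and l = lie_tangent[OF X Y p]
  have lie: "P p (dir_deriv M (\<lambda>q. dir_deriv M N q (Y q)) p (X p)) - P p (dir_deriv M (\<lambda>q. dir_deriv M N q (X q)) p (Y p))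
     = A p (cov X p (Y p)) - A p (cov Y p (X p))"
  proof -
    have "P p (dir_deriv M (\<lambda>q. dir_deriv M N q (Y q)) p (X p)) - P p (dir_deriv M (\<lambda>q. dir_deriv M N q (X q)) p (Y p))
      = P p (dir_deriv M N p (lie M X Y p))"
      using dir_deriv_commute[OF N_smooth X Y p l] by (metis P_linears(2)[OF p])
    also have "\<dots> = - A p (cov Y p (X p) - cov X p (Y p))"
      by (simp add: P_dN[OF p l] cov_torsion[OF X Y p])
    finally show ?thesis by (simp add: A_linears(3)[OF p cov_tangent[OF p] cov_tangent[OF p]])
  qed
  have "cov (\<lambda>q. A q (Y q)) p (X p) - A p (cov Y p (X p)) - (cov (\<lambda>q. A q (X q)) p (Y p) - A p (cov X p (Y p)))
     = - P p (cproj p (dcproj p (X p) (dcproj p (Y p) (N p))) - cproj p (dcproj p (Y p) (dcproj p (X p) (N p))))"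
    using lie by (simp add: half[OF X Y] half[OF Y X] P_linears[OF p] algebra_simps)
  also have "\<dots> = - P p (fs (Y p) (N p) *\<^sub>R X p - fs (X p) (N p) *\<^sub>R Y p + fs (J p (Y p)) (N p) *\<^sub>R J p (X p)
     - fs (J p (X p)) (N p) *\<^sub>R J p (Y p) - (2 * fs (J p (X p)) (Y p)) *\<^sub>R J p (N p))"
    by (simp only: CP_curvature[OF CP[OF p] T_ctan[OF p t(1)] T_ctan[OF p t(2)] N_ctan[OF p]])
  also have "\<dots> = eta N p (X p) *\<^sub>R phi N p (Y p) - eta N p (Y p) *\<^sub>R phi N p (X p) - (2 * fs (J p (X p)) (Y p)) *\<^sub>R xi N p"
    by (simp add: T_N[OF p t(1)] T_N[OF p t(2)] eta_J[OF p, symmetric] P_linears[OF p] phi_P[OF p t(1)] phi_P[OF p t(2)]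
        xi_facts[OF p] P_id[OF p xi_facts(1)[OF p]])
  also have "fs (J p (X p)) (Y p) = fs (phi N p (X p)) (Y p)"
    using T_N[OF p t(2)] by (simp add: phi_def fs_simps fs_commute[of "N p"])
  finally show ?thesis .
qed

subsection \<open>The structure Jacobi operator\<close>

definition \<alpha> :: "complex^'m^'m \<Rightarrow> real" where
  "\<alpha> p = fs (A p (xi N p)) (xi N p)"

definition AXi :: "complex^'m^'m \<Rightarrow> complex^'m^'m" where
  "AXi p = A p (xi N p)"

text \<open>The form which the Gauss equation gives to the structure Jacobi operator.\<close>

definition S :: "complex^'m^'m \<Rightarrow> complex^'m^'m \<Rightarrow> complex^'m^'m" where
  "S p y = y - eta N p y *\<^sub>R xi N p + \<alpha> p *\<^sub>R A p y - fs y (AXi p) *\<^sub>R AXi p"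

lemma jacobi_op_eq: assumes Y: "vfield M Y" and p: "p \<in> M" shows "jacobi_op M N Y p = S p (Y p)"
proof -
  note x = xi_facts[OF p] and t = vfieldD(2)[OF Y p]
  have "fs (J p (xi N p)) (xi N p) = 0" using x T_N[OF p x(1)] by (simp add: fs_commute)
  then show ?thesis
    unfolding jacobi_op_def gauss[OF Y vfield_xi vfield_xi p] S_def
    by (simp add: x phi_xi[OF p] eta_def \<alpha>_def AXi_def A_sym[OF p t x(1)])
qed

lemma vfield_AXi: "vfield M AXi"
  unfolding AXi_def[abs_def] by (rule vfield_A[OF vfield_xi])

lemma smooth_\<alpha>: "smooth_map M \<alpha>"
  using smooth_map_fs[OF vfieldD(1)[OF vfield_AXi] vfieldD(1)[OF vfield_xi]] by (simp add: \<alpha>_def[abs_def] AXi_def)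

text \<open>The product rule for \<open>S\<close>, with \<open>cov \<xi> = \<phi> A\<close>.  The remaining covariant derivative of \<open>A\<close> becomes
  accessible to the Codazzi equation after skew-symmetrisation.\<close>

lemma nabla_jacobi_eq:
  assumes X: "vfield M X" and Y: "vfield M Y" and p: "p \<in> M"
  shows "nabla_jacobi M N X Y p =
     - fs (Y p) (phi N p (A p (X p))) *\<^sub>R xi N p - eta N p (Y p) *\<^sub>R phi N p (A p (X p))
     + dir_deriv M \<alpha> p (X p) *\<^sub>R A p (Y p) + \<alpha> p *\<^sub>R (cov (\<lambda>q. A q (Y q)) p (X p) - A p (cov Y p (X p)))
     - fs (Y p) (cov AXi p (X p)) *\<^sub>R AXi p - fs (Y p) (AXi p) *\<^sub>R cov AXi p (X p)"
proof -
  note t = vfieldD(2)[OF X p] vfieldD(2)[OF Y p] and sY = vfieldD(1)[OF Y]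
  note sV = vfieldD(1)[OF vfield_AXi]
  have eS: "smooth_map M (\<lambda>q. eta N q (Y q))" by (rule smooth_map_eta[OF sY])
  have fS: "smooth_map M (\<lambda>q. fs (Y q) (AXi q))" by (rule smooth_map_fs[OF sY sV])
  note v1 = vfield_scaleR[OF eS vfield_xi] and v2 = vfield_scaleR[OF smooth_\<alpha> vfield_A[OF Y]]
    and v3 = vfield_scaleR[OF fS vfield_AXi]
  have vS: "vfield M (\<lambda>q. S q (Y q))"
    unfolding S_def by (intro vfield_diff vfield_add Y v1 v2 v3)
  have S_vf: "vfield M (jacobi_op M N Y)"
    unfolding vfield_def
    using smooth_map_cong[OF vfieldD(1)[OF vS], of "jacobi_op M N Y"] vfieldD(2)[OF vS] jacobi_op_eq[OF Y] by simp
  have "nabla M X (jacobi_op M N Y) p = cov (\<lambda>q. S q (Y q)) p (X p)"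
    unfolding nabla_eq[OF X S_vf p] by (rule cov_cong[OF p jacobi_op_eq[OF Y]])
  also have "\<dots> = cov Y p (X p)
      - (dir_deriv M (\<lambda>q. eta N q (Y q)) p (X p) *\<^sub>R xi N p + eta N p (Y p) *\<^sub>R phi N p (A p (X p)))
      + (dir_deriv M \<alpha> p (X p) *\<^sub>R A p (Y p) + \<alpha> p *\<^sub>R cov (\<lambda>q. A q (Y q)) p (X p))
      - (dir_deriv M (\<lambda>q. fs (Y q) (AXi q)) p (X p) *\<^sub>R AXi p + fs (Y p) (AXi p) *\<^sub>R cov AXi p (X p))"
    unfolding S_def
    by (simp only: cov_diff[OF vfield_add[OF vfield_diff[OF Y v1] v2] v3 p t(1)]
        cov_add[OF vfield_diff[OF Y v1] v2 p t(1)] cov_diff[OF Y v1 p t(1)]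
        cov_scaleR[OF eS vfield_xi p t(1)] cov_scaleR[OF smooth_\<alpha> vfield_A[OF Y] p t(1)]
        cov_scaleR[OF fS vfield_AXi p t(1)] cov_xi[OF p t(1)])
  finally show ?thesis
    unfolding nabla_jacobi_def jacobi_op_eq[OF vfield_nabla[OF X Y] p] nabla_eq[OF X Y p] S_def
    unfolding eta_def cov_fs[OF Y vfield_xi p t(1)] cov_fs[OF Y vfield_AXi p t(1)] cov_xi[OF p t(1)]
    by (simp add: algebra_simps)
qed

lemma d\<alpha>: assumes p: "p \<in> M" and x: "x \<in> T p"
  shows "dir_deriv M \<alpha> p x = fs (cov AXi p x) (xi N p) + fs (AXi p) (phi N p (A p x))"
  using cov_fs[OF vfield_AXi vfield_xi p x] by (simp add: \<alpha>_def[abs_def] AXi_def[abs_def] cov_xi[OF p x])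

text \<open>The exterior derivative of the form dual to \<open>A \<xi>\<close>, from the \<open>\<xi>\<close>-component of the Codazzi equation.\<close>

lemma d_AXi: assumes p: "p \<in> M" and x: "x \<in> T p" and y: "y \<in> T p"
  shows "fs y (cov AXi p x) - fs x (cov AXi p y) = - 2 * fs (phi N p x) y + 2 * fs (A p (phi N p (A p x))) y"
proof -
  obtain X where X: "vfield M X" "X p = x" by (rule tangent_extend[OF p x])
  obtain Y where Y: "vfield M Y" "Y p = y" by (rule tangent_extend[OF p y])
  have half: "fs (Y p) (cov AXi p x) = fs (cov (\<lambda>q. A q (Y q)) p x - A p (cov Y p x)) (xi N p) + fs (A p (Y p)) (phi N p (A p x))"
    if Y: "vfield M Y" and x: "x \<in> T p" for Y x
  proof -
    have "dir_deriv M (\<lambda>q. fs (A q (Y q)) (xi N q)) p x = dir_deriv M (\<lambda>q. fs (Y q) (AXi q)) p x"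
      by (rule dir_deriv_cong[OF p]) (simp add: AXi_def A_sym xi_facts vfieldD[OF Y])
    then have "fs (cov (\<lambda>q. A q (Y q)) p x) (xi N p) + fs (A p (Y p)) (phi N p (A p x)) =
       fs (cov Y p x) (AXi p) + fs (Y p) (cov AXi p x)"
      by (simp add: cov_fs[OF vfield_A[OF Y] vfield_xi p x] cov_fs[OF Y vfield_AXi p x] cov_xi[OF p x])
    moreover have "fs (cov Y p x) (AXi p) = fs (A p (cov Y p x)) (xi N p)"
      by (simp add: AXi_def A_sym[OF p cov_tangent[OF p] xi_facts(1)[OF p]])
    ultimately show ?thesis by (simp add: fs_simps)
  qed
  have "fs y (cov AXi p x) - fs x (cov AXi p y) =
     fs (cov (\<lambda>q. A q (Y q)) p (X p) - A p (cov Y p (X p)) - (cov (\<lambda>q. A q (X q)) p (Y p) - A p (cov X p (Y p)))) (xi N p)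
     + fs (A p y) (phi N p (A p x)) - fs (A p x) (phi N p (A p y))"
    using half[OF Y(1) x] half[OF X(1) y] by (simp add: X Y fs_simps)
  also have "\<dots> = - 2 * fs (phi N p x) y + fs (A p y) (phi N p (A p x)) - fs (A p x) (phi N p (A p y))"
    unfolding codazzi[OF X(1) Y(1) p]
    using phi_facts(3)[OF p x] phi_facts(3)[OF p y] by (simp add: X Y fs_simps xi_facts[OF p] eta_def)
  also have "fs (A p x) (phi N p (A p y)) = - fs (phi N p (A p x)) (A p y)"
    using phi_facts(4)[OF p A_tangent[OF p x] A_tangent[OF p y]] by simp
  also have "fs (phi N p (A p x)) (A p y) = fs (A p (phi N p (A p x))) y"
    by (rule A_sym[OF p phi_facts(1)[OF p A_tangent[OF p x]] y, symmetric])
  also have "fs (A p y) (phi N p (A p x)) = fs (A p (phi N p (A p x))) y"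
    using A_sym[OF p phi_facts(1)[OF p A_tangent[OF p x]] y] by (simp add: fs_commute)
  finally show ?thesis by simp
qed

end

section \<open>The algebra of the Jacobi condition at a point\<close>

text \<open>The tangent space of a hypersurface at one point, with the metric \<open>g\<close>, the shape operator and the
  almost contact structure.\<close>

locale contact_point =
  fixes T :: "'a::real_vector set" and g :: "'a \<Rightarrow> 'a \<Rightarrow> real" and A \<phi> :: "'a \<Rightarrow> 'a" and \<xi> :: 'a
  assumes sub: "subspace T"
    and g_add: "g (x + y) z = g x z + g y z" and g_scaleR: "g (c *\<^sub>R x) y = c * g x y"
    and g_sym: "g x y = g y x" and g_pos: "x \<noteq> 0 \<Longrightarrow> g x x > 0"
    and A_T: "x \<in> T \<Longrightarrow> A x \<in> T" and A_add: "x \<in> T \<Longrightarrow> y \<in> T \<Longrightarrow> A (x + y) = A x + A y"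
    and A_scaleR: "x \<in> T \<Longrightarrow> A (c *\<^sub>R x) = c *\<^sub>R A x"
    and A_sym: "x \<in> T \<Longrightarrow> y \<in> T \<Longrightarrow> g (A x) y = g x (A y)"
    and phi_T: "x \<in> T \<Longrightarrow> \<phi> x \<in> T" and phi_add: "\<phi> (x + y) = \<phi> x + \<phi> y"
    and phi_scaleR: "\<phi> (c *\<^sub>R x) = c *\<^sub>R \<phi> x"
    and phi_skew: "x \<in> T \<Longrightarrow> y \<in> T \<Longrightarrow> g (\<phi> x) y = - g x (\<phi> y)"
    and phi_phi: "x \<in> T \<Longrightarrow> \<phi> (\<phi> x) = - x + g x \<xi> *\<^sub>R \<xi>"
    and xi_T: "\<xi> \<in> T" and xi_unit: "g \<xi> \<xi> = 1" and phi_xi: "\<phi> \<xi> = 0"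
begin

lemma g_simps:
  "g (x + y) z = g x z + g y z" "g z (x + y) = g z x + g z y" "g (c *\<^sub>R x) y = c * g x y"
  "g y (c *\<^sub>R x) = c * g y x" "g 0 y = 0" "g y 0 = 0" "g (- x) y = - g x y" "g y (- x) = - g y x"
  "g (x - y) z = g x z - g y z" "g z (x - y) = g z x - g z y"
proof -
  show 1: "g (x + y) z = g x z + g y z" and 3: "g (c *\<^sub>R x) y = c * g x y" for x y z c by (rule g_add g_scaleR)+
  show 2: "g z (x + y) = g z x + g z y" and 4: "g y (c *\<^sub>R x) = c * g y x" for x y z c
    using 1[of x y z] 3[of c x y] by (simp_all add: g_sym)
  show "g 0 y = 0" "g y 0 = 0" using 3[of 0 0 y] 4[of y 0 0] by simp_all
  show m: "g (- x) y = - g x y" "g y (- x) = - g y x" for x y using 3[of "-1" x y] 4[of y "-1" x] by simp_all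
  show "g (x - y) z = g x z - g y z" "g z (x - y) = g z x - g z y"
    using 1[of x "- y" z] 2[of z x "- y"] m by simp_all
qed

lemma g_zero: "g x x = 0 \<Longrightarrow> x = 0"
  using g_pos[of x] by auto

lemma phi_minus: "\<phi> (- x) = - \<phi> x" and phi_zero: "\<phi> 0 = 0" and phi_diff: "\<phi> (x - y) = \<phi> x - \<phi> y"
proof -
  show m: "\<phi> (- x) = - \<phi> x" for x using phi_scaleR[of "-1" x] by simp
  show "\<phi> 0 = 0" using phi_scaleR[of 0 0] by simp
  show "\<phi> (x - y) = \<phi> x - \<phi> y" using phi_add[of x "- y"] m by simp
qed

lemmas phi_simps = phi_add phi_scaleR phi_minus phi_zero phi_diff

lemma T_simps: "x \<in> T \<Longrightarrow> y \<in> T \<Longrightarrow> x + y \<in> T" "x \<in> T \<Longrightarrow> y \<in> T \<Longrightarrow> x - y \<in> T" "x \<in> T \<Longrightarrow> c *\<^sub>R x \<in> T" "x \<in> T \<Longrightarrow> - x \<in> T"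
  using sub by (auto simp: subspace_add subspace_diff subspace_scale subspace_neg)

lemma phi_xi_orth: "x \<in> T \<Longrightarrow> g (\<phi> x) \<xi> = 0" "x \<in> T \<Longrightarrow> g \<xi> (\<phi> x) = 0"
  using phi_skew[of x \<xi>] xi_T g_sym[of \<xi>] by (simp_all add: phi_xi g_simps)

lemma phi_self: "x \<in> T \<Longrightarrow> g x (\<phi> x) = 0"
  using phi_skew[of x x] g_sym[of x "\<phi> x"] by simp

text \<open>A symmetric endomorphism on a space with complex structure \<open>\<phi>\<close> which satisfies this linear
  equation is a multiple of the identity: comparing the equation with its adjoint, either \<open>\<epsilon>\<close>
  vanishes, or \<open>A\<close> anticommutes with \<open>\<phi>\<close> and the equation forces \<open>A = 0\<close> and \<open>m = 0\<close>.\<close>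

lemma scalar_from_linear_equation:
  assumes D: "subspace D" "D \<subseteq> T" "\<And>x. x \<in> D \<Longrightarrow> A x \<in> D" "\<And>x. x \<in> D \<Longrightarrow> \<phi> x \<in> D"
      "\<And>x. x \<in> D \<Longrightarrow> g x \<xi> = 0"
    and c: "c \<noteq> 0" and eq: "\<And>y. y \<in> D \<Longrightarrow> c *\<^sub>R \<phi> (A y) + \<epsilon> *\<^sub>R A y + m *\<^sub>R \<phi> y = 0"
    and w: "w \<in> D"
  shows "c *\<^sub>R A w = - m *\<^sub>R w"
proof -
  have T: "x \<in> T" if "x \<in> D" for x using that D(2) by auto
  have pp: "\<phi> (\<phi> x) = - x" if "x \<in> D" for x using phi_phi[OF T[OF that]] D(5)[OF that] by simp
  have adj: "- c *\<^sub>R A (\<phi> w) + \<epsilon> *\<^sub>R A w - m *\<^sub>R \<phi> w = 0" if w: "w \<in> D" for w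
  proof -
    define z where "z = - c *\<^sub>R A (\<phi> w) + \<epsilon> *\<^sub>R A w - m *\<^sub>R \<phi> w"
    have zD: "z \<in> D"
      unfolding z_def by (intro subspace_diff[OF D(1)] subspace_add[OF D(1)] subspace_scale[OF D(1)] D(3,4) w)
    have "g z z = - c * g (A (\<phi> w)) z + \<epsilon> * g (A w) z - m * g (\<phi> w) z"
      by (subst (1) z_def) (simp add: g_simps)
    also have "\<dots> = c * g w (\<phi> (A z)) + \<epsilon> * g w (A z) + m * g w (\<phi> z)"
      using w zD D(3,4) T by (simp add: A_sym phi_skew)
    also have "\<dots> = g w (c *\<^sub>R \<phi> (A z) + \<epsilon> *\<^sub>R A z + m *\<^sub>R \<phi> z)" by (simp add: g_simps)
    also have "\<dots> = 0" by (simp only: eq[OF zD] g_simps)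
    finally have "z = 0" by (rule g_zero)
    then show ?thesis by (simp only: z_def)
  qed
  have AD: "A w \<in> D" and pD: "\<phi> w \<in> D" using w D by auto
  have "\<epsilon> *\<^sub>R (\<phi> (A w) + A (\<phi> w)) = 0"
  proof -
    have "\<phi> (- c *\<^sub>R A (\<phi> w) + \<epsilon> *\<^sub>R A w - m *\<^sub>R \<phi> w) + (c *\<^sub>R \<phi> (A (\<phi> w)) + \<epsilon> *\<^sub>R A (\<phi> w) + m *\<^sub>R \<phi> (\<phi> w)) = 0"
      by (simp only: adj[OF w] eq[OF pD] phi_simps) simp
    then show ?thesis by (simp add: phi_simps algebra_simps)
  qed
  then consider "\<epsilon> = 0" | "A (\<phi> w) = - \<phi> (A w)" "\<epsilon> \<noteq> 0" by (auto simp: add_eq_0_iff)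
  then show ?thesis
  proof cases
    case 1
    then have "\<phi> (c *\<^sub>R \<phi> (A w) + m *\<^sub>R \<phi> w) = 0" using eq[OF w] by (simp add: phi_simps)
    then have "- (c *\<^sub>R A w + m *\<^sub>R w) = 0" by (simp add: phi_simps pp[OF AD] pp[OF w])
    then show ?thesis by (metis add.inverse_inverse add.inverse_neutral eq_neg_iff_add_eq_0 scaleR_minus_left)
  next
    case 2
    have e2: "c *\<^sub>R \<phi> (A w) + \<epsilon> *\<^sub>R A w - m *\<^sub>R \<phi> w = 0" using adj[OF w] 2(1) by simp
    have "2 *\<^sub>R (m *\<^sub>R \<phi> w) = (c *\<^sub>R \<phi> (A w) + \<epsilon> *\<^sub>R A w + m *\<^sub>R \<phi> w) - (c *\<^sub>R \<phi> (A w) + \<epsilon> *\<^sub>R A w - m *\<^sub>R \<phi> w)"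
      by (simp add: scaleR_2 scaleR_add_left[symmetric])
    then have mp: "m *\<^sub>R \<phi> w = 0" by (simp add: eq[OF w] e2)
    have "\<phi> (m *\<^sub>R \<phi> w) = 0" by (simp only: mp phi_zero)
    then have mw: "m *\<^sub>R w = 0" by (simp add: phi_simps pp[OF w])
    have e3: "c *\<^sub>R \<phi> (A w) = - \<epsilon> *\<^sub>R A w" using eq[OF w] mp by (simp add: eq_neg_iff_add_eq_0)
    have "\<phi> (c *\<^sub>R \<phi> (A w)) = \<phi> (- \<epsilon> *\<^sub>R A w)" by (simp only: e3)
    then have "c *\<^sub>R A w = \<epsilon> *\<^sub>R \<phi> (A w)" by (simp add: phi_simps pp[OF AD])
    then have "c *\<^sub>R (c *\<^sub>R A w) = \<epsilon> *\<^sub>R (c *\<^sub>R \<phi> (A w))" by (simp add: mult.commute)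
    then have "(c * c + \<epsilon> * \<epsilon>) *\<^sub>R A w = 0" by (simp add: e3 scaleR_add_left)
    moreover have "c * c + \<epsilon> * \<epsilon> > 0" using c by (simp add: sum_squares_gt_zero_iff)
    ultimately have "A w = 0" by auto
    then show ?thesis using mw by simp
  qed
qed

end

text \<open>The skew-symmetrised condition at one point.  Here \<open>V\<close> is \<open>A \<xi>\<close>, \<open>B x\<close> is its covariant
  derivative and \<open>da x\<close> the derivative of \<open>\<alpha> = \<langle>A \<xi>, \<xi>\<rangle>\<close> in the direction \<open>x\<close>; \<open>B_skew\<close> is the
  \<open>\<xi>\<close>-component of the Codazzi equation; and \<open>K\<close> is the condition for the vectors \<open>x\<close>, \<open>y\<close>, \<open>w\<close>,
  in which the derivatives of \<open>A\<close> have been removed by the Codazzi equation.\<close>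

locale jacobi_point = contact_point T g A \<phi> \<xi>
  for T :: "'a::real_vector set" and g A \<phi> \<xi> +
  fixes B :: "'a \<Rightarrow> 'a" and da :: "'a \<Rightarrow> real" and V :: 'a and \<alpha> k :: real
  assumes B_T: "x \<in> T \<Longrightarrow> B x \<in> T" and B_add: "x \<in> T \<Longrightarrow> y \<in> T \<Longrightarrow> B (x + y) = B x + B y"
    and B_scaleR: "x \<in> T \<Longrightarrow> B (c *\<^sub>R x) = c *\<^sub>R B x"
    and V: "V = A \<xi>" and \<alpha>: "\<alpha> = g V \<xi>"
    and da: "x \<in> T \<Longrightarrow> da x = g (B x) \<xi> + g V (\<phi> (A x))"
    and B_skew: "x \<in> T \<Longrightarrow> y \<in> T \<Longrightarrow> g y (B x) - g x (B y) = - 2 * g (\<phi> x) y + 2 * g (A (\<phi> (A x))) y"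
    and K: "x \<in> T \<Longrightarrow> y \<in> T \<Longrightarrow> w \<in> T \<Longrightarrow>
      - g y (\<phi> (A x)) * g \<xi> w + g x (\<phi> (A y)) * g \<xi> w - g y \<xi> * g (\<phi> (A x)) w + g x \<xi> * g (\<phi> (A y)) w
      + da x * g (A y) w - da y * g (A x) w
      + \<alpha> * (g x \<xi> * g (\<phi> y) w - g y \<xi> * g (\<phi> x) w - 2 * g (\<phi> x) y * g \<xi> w)
      + 2 * (g (\<phi> x) y - g (A (\<phi> (A x))) y) * g V w - g y V * g (B x) w + g x V * g (B y) w
      = k * (2 * g (\<phi> x) y * g \<xi> w + g y \<xi> * g (\<phi> x) w - g x \<xi> * g (\<phi> y) w)"
begin

lemma V_T: "V \<in> T" by (simp add: V A_T xi_T)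

lemma g_A_xi: "x \<in> T \<Longrightarrow> g (A x) \<xi> = g x V"
  by (simp add: V A_sym xi_T)

text \<open>In the Hopf case \<open>A \<xi> = \<alpha> \<xi>\<close>, the condition for \<open>x = \<xi>\<close> makes \<open>A\<close> scalar on the orthogonal
  complement of \<open>\<xi>\<close>.\<close>

lemma hopf_umbilical:
  assumes hopf: "V = \<alpha> *\<^sub>R \<xi>" and B: "\<And>x. x \<in> T \<Longrightarrow> B x = da x *\<^sub>R \<xi> + \<alpha> *\<^sub>R \<phi> (A x)"
    and y: "y \<in> T" "g y \<xi> = 0"
  shows "(1 + \<alpha>\<^sup>2) *\<^sub>R A y = - (\<alpha> + k) *\<^sub>R y"
proof (rule scalar_from_linear_equation[where D = "{y \<in> T. g y \<xi> = 0}" and \<epsilon> = "da \<xi>"])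
  have pV: "\<phi> V = 0" "A \<xi> = V" by (simp_all add: hopf phi_simps phi_xi V[symmetric])
  have A0: "A 0 = 0" using A_scaleR[OF xi_T, of 0] by simp
  show "subspace {y \<in> T. g y \<xi> = 0}" using sub by (auto simp: subspace_def g_simps)
  show "A x \<in> {y \<in> T. g y \<xi> = 0}" if "x \<in> {y \<in> T. g y \<xi> = 0}" for x
    using that by (simp add: A_T g_A_xi hopf g_simps)
  show "\<phi> x \<in> {y \<in> T. g y \<xi> = 0}" if "x \<in> {y \<in> T. g y \<xi> = 0}" for x
    using that by (simp add: phi_T phi_xi_orth)
  show "(1 + \<alpha>\<^sup>2) *\<^sub>R \<phi> (A y) + da \<xi> *\<^sub>R A y + (\<alpha> + k) *\<^sub>R \<phi> y = 0" (is "?z = 0") if "y \<in> {y \<in> T. g y \<xi> = 0}" for y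
  proof -
    have y: "y \<in> T" "g y \<xi> = 0" "g \<xi> y = 0" using that g_sym by auto
    have day: "da y = 0"
      using B_skew[OF xi_T y(1)] y xi_unit
      by (simp add: pV phi_xi A0 phi_zero g_simps B[OF xi_T] B[OF y(1)] phi_xi_orth[OF A_T[OF y(1)]])
    have zT: "?z \<in> T" using y by (intro T_simps A_T phi_T)
    have "g ?z w = 0" if w: "w \<in> T" for w
    proof -
      have xV: "g \<xi> V = \<alpha>" "g y V = 0" using y xi_unit by (simp_all add: hopf g_simps)
      show ?thesis
        using K[OF xi_T y(1) w] y xi_unit
        by (simp add: pV phi_xi A0 phi_zero g_simps xV day B[OF y(1)] phi_xi_orth[OF A_T[OF y(1)]]
            power2_eq_square algebra_simps)
    qed
    then have "g ?z ?z = 0" using zT by blast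
    then show ?thesis by (rule g_zero)
  qed
  show "1 + \<alpha>\<^sup>2 \<noteq> 0" using zero_le_power2[of \<alpha>] by linarith
qed (use y in auto)

text \<open>If \<open>H\<close>, the part of \<open>A \<xi>\<close> orthogonal to \<open>\<xi>\<close>, is not zero, the tangent space splits orthogonally into
  the lines of \<open>\<xi>\<close>, \<open>H\<close>, \<open>F = \<phi> H\<close> and the rest \<open>D\<close>; \<open>b\<close> is the squared length of \<open>H\<close>, and \<open>\<gamma>\<close> will
  be the diagonal entry of \<open>A\<close> at \<open>H\<close>.\<close>

definition "H = V - \<alpha> *\<^sub>R \<xi>"
definition "F = \<phi> H"
definition "b = g H H"
definition "\<gamma> = (b - 1) / \<alpha> + 2 * k"
definition "D = {x \<in> T. g x \<xi> = 0 \<and> g x H = 0 \<and> g x F = 0}"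

lemma H_T: "H \<in> T" and F_T: "F \<in> T"
  by (simp_all add: H_def F_def T_simps V_T xi_T phi_T)

lemma g_V: "g V y = \<alpha> * g \<xi> y + g H y" "g y V = \<alpha> * g y \<xi> + g y H"
  by (simp_all only: H_def g_simps)

lemma A_xi: "A \<xi> = V" and phi_V: "\<phi> V = F"
  by (simp_all add: H_def V[symmetric] F_def phi_simps phi_xi)

lemma gHF: "g H \<xi> = 0" "g \<xi> H = 0" "g F \<xi> = 0" "g \<xi> F = 0" "g H F = 0" "g F H = 0" "g H H = b" "g F F = b"
  "g H V = b" "g V H = b" "g F V = 0" "g V F = 0" "g \<xi> V = \<alpha>" "g V \<xi> = \<alpha>"
proof -
  have "g H \<xi> = g V \<xi> - \<alpha> * 1" by (simp only: H_def g_simps xi_unit)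
  then show 1: "g H \<xi> = 0" using \<alpha> by linarith
  then show o1: "g \<xi> H = 0" by (simp add: g_sym)
  show 2: "g F \<xi> = 0" "g \<xi> F = 0" by (simp_all add: F_def phi_xi_orth H_T)
  show 3: "g H F = 0" by (simp add: F_def phi_self H_T)
  then show o3: "g F H = 0" by (simp add: g_sym)
  show 4: "g H H = b" by (simp add: b_def)
  show "g F F = b" using phi_skew[OF H_T F_T] phi_phi[OF H_T] 1 4 by (simp add: F_def g_simps)
  show "g H V = b" "g V H = b" "g F V = 0" "g V F = 0" "g \<xi> V = \<alpha>" "g V \<xi> = \<alpha>"
    by (simp_all add: g_V g_simps 1 o1 2 3 o3 4 xi_unit)
qed

lemma phi_F: "\<phi> F = - H"
  using phi_phi[OF H_T] by (simp add: F_def gHF)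

text \<open>In the \<open>\<xi>\<close>-component of the condition all derivatives cancel.  What remains is
  \<open>S \<phi> A + A \<phi> S = - 2 k \<phi>\<close> for the structure Jacobi operator \<open>S\<close>.\<close>

lemma K_xi: assumes x: "x \<in> T" and y: "y \<in> T"
  shows "- g y (\<phi> (A x)) + g x (\<phi> (A y)) - 2 * \<alpha> * g (A (\<phi> (A x))) y
     + g y V * g V (\<phi> (A x)) - g x V * g V (\<phi> (A y)) = 2 * k * g (\<phi> x) y"
proof -
  have "g (B x) \<xi> = da x - g V (\<phi> (A x))" "g (B y) \<xi> = da y - g V (\<phi> (A y))" using da x y by simp_all
  note 1 = this
  have "- g y (\<phi> (A x)) + g x (\<phi> (A y)) + da x * g y V - da y * g x V - \<alpha> * (2 * g (\<phi> x) y)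
     + 2 * (g (\<phi> x) y - g (A (\<phi> (A x))) y) * \<alpha> - g y V * g (B x) \<xi> + g x V * g (B y) \<xi> = k * (2 * g (\<phi> x) y)"
    using K[OF x y xi_T] x y by (simp add: xi_unit phi_xi_orth A_T g_A_xi \<alpha>[symmetric])
  then show ?thesis unfolding 1 by (simp add: algebra_simps)
qed

text \<open>The algebraic component of the condition at \<open>x = \<xi>\<close>.\<close>

lemma alpha_A_F: "\<alpha> *\<^sub>R A F = - F"
proof -
  let ?z = "\<alpha> *\<^sub>R A F + F"
  have zT: "?z \<in> T" by (intro T_simps A_T F_T)
  have "g ?z y = 0" if y: "y \<in> T" for y
  proof -
    have "g V (\<phi> (A y)) = - g (A F) y"
      using phi_skew[OF V_T A_T[OF y]] A_sym[OF F_T y] by (simp add: phi_V)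
    then show ?thesis
      using K_xi[OF xi_T y] by (simp add: A_xi phi_V phi_xi_orth A_T y phi_xi g_simps gHF g_sym[of y])
  qed
  then have "g ?z ?z = 0" using zT by blast
  then show ?thesis using g_zero by (simp add: eq_neg_iff_add_eq_0)
qed

context
  assumes b: "b \<noteq> 0"
begin

lemma alpha_nonzero: "\<alpha> \<noteq> 0"
  using alpha_A_F b gHF by (auto simp: g_simps)

lemma A_F: "A F = (- 1 / \<alpha>) *\<^sub>R F"
proof -
  have "(1 / \<alpha>) *\<^sub>R (\<alpha> *\<^sub>R A F) = (1 / \<alpha>) *\<^sub>R (- F)" by (simp only: alpha_A_F)
  then show ?thesis using alpha_nonzero by simp
qed

text \<open>The algebraic component of the condition at \<open>x = F\<close>, where \<open>A F\<close> is already known.\<close>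

lemma A_H: "A H = b *\<^sub>R \<xi> + \<gamma> *\<^sub>R H"
proof -
  let ?z = "A H - (b *\<^sub>R \<xi> + \<gamma> *\<^sub>R H)"
  have zT: "?z \<in> T" by (intro T_simps A_T H_T xi_T)
  have pAF: "\<phi> (A F) = (1 / \<alpha>) *\<^sub>R H" by (simp add: A_F phi_simps phi_F)
  have "g ?z y = 0" if y: "y \<in> T" for y
  proof -
    have "g F (\<phi> (A y)) = g (A H) y"
      using phi_skew[OF F_T A_T[OF y]] A_sym[OF H_T y] by (simp add: phi_F g_simps)
    moreover have "A (\<phi> (A F)) = (1 / \<alpha>) *\<^sub>R A H" by (simp add: pAF A_scaleR H_T)
    moreover have "g y V = \<alpha> * g y \<xi> + g y H" by (rule g_V)
    ultimately have "- (g y H / \<alpha>) + g (A H) y - 2 * g (A H) y + (\<alpha> * g y \<xi> + g y H) * (b / \<alpha>) = - 2 * k * g y H"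
      using K_xi[OF F_T y] alpha_nonzero by (simp add: pAF gHF g_simps phi_F g_sym[of H y])
    then have "\<alpha> * (g y H + \<alpha> * g (A H) y) = \<alpha> * (\<alpha> * (g y \<xi> * b) + (b * g y H + \<alpha> * (k * (2 * g y H))))"
      using alpha_nonzero by (simp add: field_simps)
    then have "g y H + \<alpha> * g (A H) y = \<alpha> * (g y \<xi> * b) + (b * g y H + \<alpha> * (k * (2 * g y H)))"
      using alpha_nonzero by (simp only: mult_cancel_left) simp
    then have "g (A H) y = b * g y \<xi> + \<gamma> * g y H"
      using alpha_nonzero by (simp add: \<gamma>_def field_simps)
    then show ?thesis by (simp add: g_simps g_sym[of \<xi> y] g_sym[of H y])
  qed
  then have "g ?z ?z = 0" using zT by blast
  then show ?thesis using g_zero[of ?z] by simp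
qed

lemma D_T: "x \<in> D \<Longrightarrow> x \<in> T" by (simp add: D_def)

lemma D_orth: assumes "x \<in> D"
  shows "g x \<xi> = 0" "g \<xi> x = 0" "g x H = 0" "g H x = 0" "g x F = 0" "g F x = 0" "g x V = 0" "g V x = 0"
  using assms g_sym[of _ x] by (auto simp: D_def g_V)

lemma A_D: assumes x: "x \<in> D" shows "A x \<in> D"
  using D_T[OF x] D_orth[OF x] A_sym[OF D_T[OF x] H_T] A_sym[OF D_T[OF x] F_T]
  by (simp add: D_def A_T g_A_xi A_H A_F g_simps)

lemma phi_D: assumes x: "x \<in> D" shows "\<phi> x \<in> D"
  using D_T[OF x] D_orth[OF x] phi_skew[OF D_T[OF x] H_T] phi_skew[OF D_T[OF x] F_T]
  by (simp add: D_def phi_T phi_xi_orth phi_F F_def[symmetric] g_simps)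

lemma subspace_D: "subspace D"
  using sub by (auto simp: D_def subspace_def g_simps)

lemma da_D: assumes x: "x \<in> D" shows "da x = 0"
proof -
  note o = D_orth[OF x] D_orth[OF A_D[OF x]] D_orth[OF phi_D[OF A_D[OF x]]] D_orth[OF phi_D[OF x]]
    D_orth[OF A_D[OF phi_D[OF A_D[OF x]]]]
  have pAF: "\<phi> (A F) = (1 / \<alpha>) *\<^sub>R H" by (simp add: A_F phi_simps phi_F)
  have 1: "da x * g (A F) w = da F * g (A x) w" if w: "w \<in> T" for w
    using K[OF D_T[OF x] F_T w] by (simp add: o pAF g_simps gHF)
  show "da x = 0" using 1[OF F_T] alpha_nonzero b by (simp add: A_F g_simps gHF o)
qed

text \<open>The \<open>H\<close>-component of the condition for two vectors in \<open>D\<close>: only the term with \<open>V\<close> can have one.\<close>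

lemma A_phi_A_D: assumes x: "x \<in> D" and y: "y \<in> D" shows "g (A (\<phi> (A x))) y = g (\<phi> x) y"
proof -
  note o = D_orth[OF x] D_orth[OF A_D[OF x]] D_orth[OF y] D_orth[OF A_D[OF y]]
  show ?thesis using K[OF D_T[OF x] D_T[OF y] H_T] b by (simp add: o gHF)
qed

lemma B_D: assumes x: "x \<in> D" and w: "w \<in> T" shows "b * g (B x) w = - da H * g (A x) w"
proof -
  note o = D_orth[OF x] D_orth[OF phi_D[OF x]] D_orth[OF phi_D[OF A_D[OF x]]] D_orth[OF A_D[OF phi_D[OF A_D[OF x]]]]
  have "\<phi> (A H) = \<gamma> *\<^sub>R F" by (simp add: A_H phi_simps phi_xi F_def)
  then show ?thesis
    using K[OF D_T[OF x] H_T w] by (simp add: o gHF g_simps da_D[OF x])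
qed

text \<open>The condition at \<open>x = \<xi>\<close>, with \<open>B\<close> on \<open>D\<close> eliminated by the condition at \<open>y = H\<close>, is a linear equation
  for \<open>A\<close> on \<open>D\<close>.\<close>

lemma A_scalar_D: assumes y: "y \<in> D" shows "A y = - (\<alpha> + k) *\<^sub>R y"
proof -
  have "1 *\<^sub>R A y = - (\<alpha> + k) *\<^sub>R y"
  proof (rule scalar_from_linear_equation[OF subspace_D _ A_D phi_D D_orth(1) _ _ y,
        where \<epsilon> = "da \<xi> - \<alpha> * da H / b"])
    fix y assume y: "y \<in> D"
    let ?z = "1 *\<^sub>R \<phi> (A y) + (da \<xi> - \<alpha> * da H / b) *\<^sub>R A y + (\<alpha> + k) *\<^sub>R \<phi> y"
    note o = D_orth[OF y] D_orth[OF phi_D[OF y]] D_orth[OF phi_D[OF A_D[OF y]]]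
    have zT: "?z \<in> T" using D_T[OF y] by (intro T_simps A_T phi_T)
    have "g ?z w = 0" if w: "w \<in> T" for w
    proof -
      have "g (B y) w = - da H * g (A y) w / b" using B_D[OF y w] b by (simp add: field_simps)
      then show ?thesis
        using K[OF xi_T D_T[OF y] w]
        by (simp add: o gHF g_simps da_D[OF y] A_xi phi_V phi_xi xi_unit A_F algebra_simps)
    qed
    then have "g ?z ?z = 0" using zT by blast
    then show "?z = 0" by (rule g_zero)
  qed (auto simp: D_T)
  then show ?thesis by simp
qed

lemma alpha_plus_k: assumes x: "x \<in> D" "x \<noteq> 0" shows "(\<alpha> + k)\<^sup>2 = 1"
proof -
  have pp: "g (\<phi> x) (\<phi> x) = g x x"
    using phi_skew[OF D_T[OF x(1)] phi_T[OF D_T[OF x(1)]]] phi_phi[OF D_T[OF x(1)]] D_orth[OF x(1)] by (simp add: g_simps)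
  have "A (\<phi> (A x)) = ((\<alpha> + k) * (\<alpha> + k)) *\<^sub>R \<phi> x"
    using A_scalar_D[OF x(1)] A_scalar_D[OF phi_D[OF x(1)]] A_scaleR[OF phi_T[OF D_T[OF x(1)]]]
    by (simp only: phi_simps scaleR_scaleR) (simp add: algebra_simps)
  then have "(\<alpha> + k)\<^sup>2 * g x x = g x x"
    using A_phi_A_D[OF x(1) phi_D[OF x(1)]] pp by (simp add: g_simps power2_eq_square)
  then show ?thesis using g_pos[OF x(2)] by simp
qed

text \<open>Once \<open>\<alpha>\<close> is known to be constant, \<open>k = 0\<close> and \<open>\<alpha>\<^sup>2 = 1\<close>, the condition determines the
  derivative of \<open>A \<xi>\<close> as far as it is needed below.\<close>

lemma B_D_zero: assumes "\<And>x. x \<in> T \<Longrightarrow> da x = 0" "x \<in> D" shows "B x = 0"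
  using B_D[OF assms(2), of "B x"] assms(1)[OF H_T] b B_T[OF D_T[OF assms(2)]] g_zero[of "B x"] by simp

context
  assumes da0: "\<And>x. x \<in> T \<Longrightarrow> da x = 0" and k0: "k = 0" and a1: "\<alpha>\<^sup>2 = 1"
begin

lemma inverse_alpha: "1 / \<alpha> = \<alpha>"
  using a1 alpha_nonzero by (simp add: power2_eq_square field_simps)

lemma gamma: "\<gamma> = \<alpha> * (b - 1)"
proof -
  have "\<gamma> = (b - 1) * (1 / \<alpha>) + 2 * k" by (simp add: \<gamma>_def)
  also have "\<dots> = \<alpha> * (b - 1)" unfolding inverse_alpha using k0 by simp
  finally show ?thesis .
qed

lemma phi_A_H: "\<phi> (A H) = (\<alpha> * (b - 1)) *\<^sub>R F"
  by (simp add: A_H gamma phi_simps phi_xi F_def)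

lemma A_F': "A F = (- \<alpha>) *\<^sub>R F" using A_F inverse_alpha by (simp add: divide_inverse)

lemma A_phi_A_H: "A (\<phi> (A H)) = (- (b - 1)) *\<^sub>R F"
proof -
  have "\<alpha> * (b - 1) * (- \<alpha>) = - (\<alpha>\<^sup>2 * (b - 1))" by (simp add: power2_eq_square)
  then have "\<alpha> * (b - 1) * (- \<alpha>) = - (b - 1)" by (simp only: a1 mult_1)
  then show ?thesis by (simp only: phi_A_H A_scaleR[OF F_T] A_F' scaleR_scaleR)
qed

lemma g_A_phi_A_H_F: "g (A (\<phi> (A H))) F = - b * (b - 1)"
  by (simp add: A_phi_A_H g_simps gHF algebra_simps)

lemma B_F_H: "g (B F) H = - 2 * b * b"
proof -
  have "2 * (b - g (A (\<phi> (A H))) F) * b + b * g (B F) H = 0"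
    using K[OF H_T F_T H_T] by (simp add: gHF k0 da0 H_T F_T F_def[symmetric])
  then have "b * g (B F) H = b * (- 2 * b * b)"
    unfolding g_A_phi_A_H_F by (simp add: algebra_simps)
  then show ?thesis by (rule mult_left_cancel[OF b, THEN iffD1])
qed

lemma B_xi_H: "g (B \<xi>) H = 0"
proof -
  have "g (B H) \<xi> = 0" using da[OF H_T] da0[OF H_T] by (simp add: phi_A_H g_simps gHF)
  then show ?thesis
    using B_skew[OF xi_T H_T] by (simp add: A_xi phi_V A_F' g_simps gHF phi_xi g_sym[of H] g_sym[of \<xi>])
qed

lemma B_H: assumes w: "w \<in> T" shows "\<alpha> * g (B H) w = b * g (B \<xi>) w - \<alpha> * b * g F w"
proof -
  have "\<alpha> * (b - 1) * g F w + \<alpha> * g F w - b * g (B \<xi>) w + \<alpha> * g (B H) w = 0"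
    using K[OF xi_T H_T w]
    by (simp add: gHF k0 da0 xi_T H_T phi_xi phi_A_H g_simps A_xi phi_V A_F' xi_unit F_def[symmetric])
  then show ?thesis by (simp add: algebra_simps)
qed

lemma B_H_H: "g (B H) H = 0"
  using B_H[OF H_T] alpha_nonzero by (simp add: B_xi_H gHF)

lemma B_xi_F: "g (B \<xi>) F = - 3 * \<alpha> * b"
proof -
  have "g F (B H) - g H (B F) = - 2 * b + 2 * g (A (\<phi> (A H))) F"
    using B_skew[OF H_T F_T] by (simp add: gHF F_def[symmetric])
  then have "g (B H) F = - 4 * b * b"
    unfolding g_A_phi_A_H_F g_sym[of F "B H"] g_sym[of H "B F"] B_F_H by (simp add: algebra_simps)
  then have "b * g (B \<xi>) F = b * (- 3 * \<alpha> * b)"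
    using B_H[OF F_T] by (simp add: gHF algebra_simps)
  then show ?thesis by (rule mult_left_cancel[OF b, THEN iffD1])
qed

lemma B_x_H: assumes x: "x \<in> T" shows "g (B x) H = - 2 * b * g x F"
proof -
  define c d e where "c = g x \<xi>" and "d = g x H / b" and "e = g x F / b"
  define y where "y = x - (c *\<^sub>R \<xi> + d *\<^sub>R H + e *\<^sub>R F)"
  have "y \<in> T" unfolding y_def by (intro T_simps x xi_T H_T F_T)
  then have y: "y \<in> D"
    using b by (simp add: D_def y_def g_simps gHF xi_unit c_def d_def e_def)
  have "x = y + (c *\<^sub>R \<xi> + d *\<^sub>R H + e *\<^sub>R F)" by (simp add: y_def)
  then have "B x = B y + (c *\<^sub>R B \<xi> + d *\<^sub>R B H + e *\<^sub>R B F)"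
    using D_T[OF y] xi_T H_T F_T by (simp add: B_add B_scaleR T_simps)
  then have "g (B x) H = e * (- 2 * b * b)"
    by (simp add: B_D_zero[OF da0 y] g_simps B_xi_H B_H_H B_F_H)
  then show ?thesis using b by (simp add: e_def)
qed

end

end

end

section \<open>The Jacobi conditions force total umbilicity on the contact distribution\<close>

lemma fs_pos_strict: "x \<noteq> 0 \<Longrightarrow> fs x x > 0"
  using fs_pos[of x] by (simp add: less_le)

text \<open>Three vectors do not span a space of dimension at least four.\<close>

lemma orthogonal_vector_exists:
  fixes T :: "(complex^'m::finite^'m) set"
  assumes T: "subspace T" "dim T \<ge> 4" and abc: "a \<in> T" "b \<in> T" "c \<in> T"
  obtains y where "y \<in> T" "y \<noteq> 0" "fs y a = 0" "fs y b = 0" "fs y c = 0"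
proof -
  let ?Q = "{y \<in> T. \<forall>x\<in>span {a, b, c}. orthogonal x y}"
  have "span {a, b, c} \<subseteq> T" using abc by (intro span_minimal T) auto
  then have "dim ?Q + dim (span {a, b, c}) = dim T"
    by (intro dim_subspace_orthogonal_to_vectors subspace_span T)
  moreover have "dim (span {a, b, c}) \<le> card {a, b, c}" by (simp add: dim_le_card')
  moreover have "card {a, b, c} \<le> 3" by (simp add: card_insert_if)
  ultimately have "dim ?Q \<noteq> 0" using T(2) by linarith
  then have "\<not> ?Q \<subseteq> {0}" by simp
  then obtain y where y: "y \<in> T" "y \<noteq> 0" "\<forall>x\<in>span {a, b, c}. orthogonal x y" by auto
  then have "fs y x = 0" if "x \<in> {a, b, c}" for x
    using span_base[OF that] by (auto simp: orthogonal_def fs_def inner_commute)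
  then show ?thesis using that y by auto
qed

context oriented_hypersurface
begin

lemma contact_point: "p \<in> M \<Longrightarrow> contact_point (T p) fs (A p) (phi N p) (xi N p)"
  by (rule contact_point.intro; (rule fs_commute)?; simp add: subspace_tangent fs_simps A_tangent A_linears
      A_sym phi_facts phi_linears xi_facts phi_xi fs_pos_strict eta_def)

lemma orthogonal_in_T:
  assumes p: "p \<in> M" and "a \<in> T p" "b \<in> T p" "c \<in> T p"
  obtains y where "y \<in> T p" "y \<noteq> 0" "fs y a = 0" "fs y b = 0" "fs y c = 0"
proof -
  have "dim (T p) \<ge> 4" using submanifold_tangent(2)[OF M_sub p] n by linarith
  show ?thesis
    by (rule orthogonal_vector_exists[OF subspace_tangent[OF p] \<open>dim (T p) \<ge> 4\<close> assms(2-4)]) (rule that)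
qed

lemma dir_deriv_cong_open:
  assumes O: "openin (top_of_set M) U" "p \<in> U" and eq: "\<And>q. q \<in> U \<Longrightarrow> f q = h q"
    and s: "smooth_map M f" "smooth_map M h" and x: "x \<in> T p"
  shows "dir_deriv M f p x = dir_deriv M h p x"
proof -
  have x': "x \<in> tangent U p" using tangent_openin[OF O] x by simp
  show ?thesis
    using dir_deriv_subset[OF s(1) openin_imp_subset[OF O(1)] O(2) x']
      dir_deriv_subset[OF s(2) openin_imp_subset[OF O(1)] O(2) x'] dir_deriv_cong[OF O(2) eq] by simp
qed

lemma cov_cong_open:
  assumes "openin (top_of_set M) U" "p \<in> U" "\<And>q. q \<in> U \<Longrightarrow> Y q = Z q"
    and "vfield M Y" "vfield M Z" "x \<in> T p"
  shows "cov Y p x = cov Z p x"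
  unfolding cov_def by (simp only: dir_deriv_cong_open[OF assms(1-3) vfieldD(1)[OF assms(4)] vfieldD(1)[OF assms(5)] assms(6)])

lemma jacobi_imp_skew: assumes "jacobi_condition M N k" shows "skew_jacobi_condition M N k"
  unfolding skew_jacobi_condition_def
proof (intro allI impI ballI)
  fix X Y W p assume v: "vfield M X" "vfield M Y" "vfield M W" and p: "p \<in> M"
  have e: "nabla_jacobi M N X Y p = k *\<^sub>R (fs (phi N p (X p)) (Y p) *\<^sub>R xi N p + eta N p (Y p) *\<^sub>R phi N p (X p))"
    if "vfield M X" "vfield M Y" for X Y
    using assms that p by (simp add: jacobi_condition_def)
  show "fs (nabla_jacobi M N X Y p - nabla_jacobi M N Y X p) (W p) =
      k * (2 * eta N p (W p) * fs (phi N p (X p)) (Y p) + eta N p (Y p) * fs (phi N p (X p)) (W p)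
               - eta N p (X p) * fs (phi N p (Y p)) (W p))"
  proof -
    have "fs (phi N p (Y p)) (X p) = - fs (phi N p (X p)) (Y p)"
      using phi_facts(4)[OF p vfieldD(2)[OF v(1) p] vfieldD(2)[OF v(2) p]] fs_commute[of "X p"] by simp
    then show ?thesis
      unfolding e[OF v(1,2)] e[OF v(2,1)] eta_def fs_simps fs_commute[of "xi N p" "W p"]
      by (simp add: algebra_simps)
  qed
qed

text \<open>The \<open>nabla_jacobi\<close> terms are expanded, and the skew part of the covariant derivative of \<open>A\<close> is replaced
  by the right-hand side of the Codazzi equation.\<close>

lemma jacobi_point:
  assumes skew: "skew_jacobi_condition M N k" and p: "p \<in> M"
  shows "jacobi_point (T p) fs (A p) (phi N p) (xi N p) (cov AXi p) (dir_deriv M \<alpha> p) (AXi p) (\<alpha> p) k"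
proof (intro jacobi_point.intro contact_point[OF p] jacobi_point_axioms.intro)
  fix x y w c assume x: "x \<in> T p"
  show "cov AXi p x \<in> T p" by (rule cov_tangent[OF p])
  show "cov AXi p (c *\<^sub>R x) = c *\<^sub>R cov AXi p x" by (rule cov_dir_scaleR[OF vfield_AXi p x])
  show "dir_deriv M \<alpha> p x = fs (cov AXi p x) (xi N p) + fs (AXi p) (phi N p (A p x))" by (rule d\<alpha>[OF p x])
  assume y: "y \<in> T p"
  show "cov AXi p (x + y) = cov AXi p x + cov AXi p y" by (rule cov_dir_add[OF vfield_AXi p x y])
  show d: "fs y (cov AXi p x) - fs x (cov AXi p y) = - 2 * fs (phi N p x) y + 2 * fs (A p (phi N p (A p x))) y"
    by (rule d_AXi[OF p x y])
  assume w: "w \<in> T p"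
  obtain X where X: "vfield M X" "X p = x" by (rule tangent_extend[OF p x])
  obtain Y where Y: "vfield M Y" "Y p = y" by (rule tangent_extend[OF p y])
  obtain W where W: "vfield M W" "W p = w" by (rule tangent_extend[OF p w])
  define U where "U = cov (\<lambda>q. A q (Y q)) p x - A p (cov Y p x)"
  define U' where "U' = cov (\<lambda>q. A q (X q)) p y - A p (cov X p y)"
  have U: "U = U' + (eta N p x *\<^sub>R phi N p y - eta N p y *\<^sub>R phi N p x - (2 * fs (phi N p x) y) *\<^sub>R xi N p)"
    using codazzi[OF X(1) Y(1) p] unfolding X(2) Y(2) U_def[symmetric] U'_def[symmetric] by (simp add: algebra_simps)
  have d': "fs y (cov AXi p x) = fs x (cov AXi p y) - 2 * fs (phi N p x) y + 2 * fs (A p (phi N p (A p x))) y"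
    using d by simp
  have "fs (nabla_jacobi M N X Y p - nabla_jacobi M N Y X p) w = k * (2 * eta N p w * fs (phi N p x) y
               + eta N p y * fs (phi N p x) w - eta N p x * fs (phi N p y) w)"
    using skew X Y W p unfolding skew_jacobi_condition_def by blast
  then show "- fs y (phi N p (A p x)) * fs (xi N p) w + fs x (phi N p (A p y)) * fs (xi N p) w
      - fs y (xi N p) * fs (phi N p (A p x)) w + fs x (xi N p) * fs (phi N p (A p y)) w
      + dir_deriv M \<alpha> p x * fs (A p y) w - dir_deriv M \<alpha> p y * fs (A p x) w
      + \<alpha> p * (fs x (xi N p) * fs (phi N p y) w - fs y (xi N p) * fs (phi N p x) w - 2 * fs (phi N p x) y * fs (xi N p) w)
      + 2 * (fs (phi N p x) y - fs (A p (phi N p (A p x))) y) * fs (AXi p) w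
      - fs y (AXi p) * fs (cov AXi p x) w + fs x (AXi p) * fs (cov AXi p y) w
      = k * (2 * fs (phi N p x) y * fs (xi N p) w + fs y (xi N p) * fs (phi N p x) w - fs x (xi N p) * fs (phi N p y) w)"
    unfolding nabla_jacobi_eq[OF X(1) Y(1) p] nabla_jacobi_eq[OF Y(1) X(1) p] X(2) Y(2)
      U_def[symmetric] U'_def[symmetric] U d' fs_simps eta_def fs_commute[of w "xi N p"]
    by (simp add: algebra_simps)
qed (auto simp: AXi_def \<alpha>_def)

text \<open>The vectors \<open>H\<close> and \<open>F = \<phi> H\<close> and the number \<open>b\<close> of the pointwise algebra, as fields on the
  hypersurface.\<close>

definition Hf :: "complex^'m^'m \<Rightarrow> complex^'m^'m" where
  "Hf p = AXi p - \<alpha> p *\<^sub>R xi N p"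

definition Ff :: "complex^'m^'m \<Rightarrow> complex^'m^'m" where
  "Ff p = phi N p (Hf p)"

definition bf :: "complex^'m^'m \<Rightarrow> real" where
  "bf p = fs (Hf p) (Hf p)"

lemma vfield_Hf: "vfield M Hf"
  unfolding Hf_def[abs_def] by (intro vfield_diff vfield_AXi vfield_scaleR smooth_\<alpha> vfield_xi)

lemma vfield_Ff: "vfield M Ff"
  unfolding Ff_def[abs_def] by (rule vfield_phi[OF vfield_Hf])

lemma smooth_bf: "smooth_map M bf"
  unfolding bf_def[abs_def] by (intro smooth_map_fs vfieldD(1)[OF vfield_Hf])

lemma cov_Hf: assumes p: "p \<in> M" and x: "x \<in> T p"
  shows "cov Hf p x = cov AXi p x - (dir_deriv M \<alpha> p x *\<^sub>R xi N p + \<alpha> p *\<^sub>R phi N p (A p x))"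
  unfolding Hf_def[abs_def]
  by (simp only: cov_diff[OF vfield_AXi vfield_scaleR[OF smooth_\<alpha> vfield_xi] p x]
      cov_scaleR[OF smooth_\<alpha> vfield_xi p x] cov_xi[OF p x])

lemma openin_nonHopf: "openin (top_of_set M) {p \<in> M. bf p \<noteq> 0}"
proof -
  have "openin (top_of_set M) (M \<inter> bf -` (- {0}))"
    by (rule continuous_openin_preimage_gen[OF smooth_map_continuous[OF smooth_bf]]) auto
  moreover have "M \<inter> bf -` (- {0}) = {p \<in> M. bf p \<noteq> 0}" by auto
  ultimately show ?thesis by simp
qed

text \<open>A non-Hopf point is impossible.  On the open set of such points the pointwise algebra makes
  \<open>\<alpha> + k\<close> a sign, hence \<open>\<alpha>\<close> constant; the Codazzi equation then gives \<open>k = 0\<close>, \<open>\<alpha>\<^sup>2 = 1\<close>; and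
  finally the gradient of the squared length \<open>b\<close> of the non-Hopf part \<open>H\<close> of \<open>A \<xi>\<close> is a multiple of
  \<open>\<phi> H\<close>, so that \<open>[\<xi>, H] b = 0\<close> can be compared with the known value of the bracket.\<close>

lemma hopf:
  assumes skew: "skew_jacobi_condition M N k" and p: "p \<in> M"
  shows "AXi p = \<alpha> p *\<^sub>R xi N p"
proof (rule ccontr)
  assume "AXi p \<noteq> \<alpha> p *\<^sub>R xi N p"
  then have "bf p \<noteq> 0" by (simp add: bf_def Hf_def fs_pos)
  define U where "U = {q \<in> M. bf q \<noteq> 0}"
  have pU: "p \<in> U" using p \<open>bf p \<noteq> 0\<close> by (simp add: U_def)
  note oU = openin_nonHopf[folded U_def]
  have UM: "q \<in> M" if "q \<in> U" for q using that by (simp add: U_def)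
  note jp = jacobi_point[OF skew]
  have names: "jacobi_point.H (xi N q) (AXi q) (\<alpha> q) = Hf q"
    "jacobi_point.F (phi N q) (xi N q) (AXi q) (\<alpha> q) = Ff q"
    "jacobi_point.b fs (xi N q) (AXi q) (\<alpha> q) = bf q"
    "jacobi_point.D (T q) fs (phi N q) (xi N q) (AXi q) (\<alpha> q) =
       {x \<in> T q. fs x (xi N q) = 0 \<and> fs x (Hf q) = 0 \<and> fs x (Ff q) = 0}" if "q \<in> M" for q
    using jp[OF that]
    by (simp_all add: jacobi_point.H_def jacobi_point.F_def jacobi_point.b_def jacobi_point.D_def
        Hf_def Ff_def bf_def)
  define D where "D q = {x \<in> T q. fs x (xi N q) = 0 \<and> fs x (Hf q) = 0 \<and> fs x (Ff q) = 0}" for q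
  note names' = names(1-3) names(4)[folded D_def]
  have b0: "jacobi_point.b fs (xi N q) (AXi q) (\<alpha> q) \<noteq> 0" if "q \<in> U" for q
    using that names(3)[OF UM[OF that]] by (simp add: U_def)
  have T: "xi N q \<in> T q" "Hf q \<in> T q" "Ff q \<in> T q" if "q \<in> U" for q
    using xi_facts vfieldD(2)[OF vfield_Hf] vfieldD(2)[OF vfield_Ff] UM[OF that] by auto
  \<comment> \<open>This uses \<open>n > 2\<close>: there is room besides \<open>\<xi>\<close>, \<open>H\<close> and \<open>\<phi> H\<close>.\<close>
  have D_ex: "\<exists>x. x \<in> D q \<and> x \<noteq> 0" if q: "q \<in> U" for q
  proof -
    obtain y where "y \<in> T q" "y \<noteq> 0" "fs y (xi N q) = 0" "fs y (Hf q) = 0" "fs y (Ff q) = 0"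
      by (rule orthogonal_in_T[OF UM[OF q] T[OF q]])
    then show ?thesis by (intro exI[of _ y]) (simp add: D_def)
  qed
  have g: "fs (Hf q) (xi N q) = 0" "fs (Hf q) (Ff q) = 0" "fs (xi N q) (Ff q) = 0" "fs (Ff q) (Ff q) = bf q"
    "fs (Ff q) (xi N q) = 0" if "q \<in> M" for q
    using jacobi_point.gHF[OF jp[OF that]] unfolding names[OF that] by auto
  have sq: "(\<alpha> q + k)\<^sup>2 = 1" if q: "q \<in> U" for q
    using D_ex[OF q] jacobi_point.alpha_plus_k[OF jp[OF UM[OF q]] b0[OF q]] names'(4)[OF UM[OF q]] by auto
  have da: "dir_deriv M \<alpha> q x = 0" if q: "q \<in> U" and x: "x \<in> T q" for q x
  proof -
    have s: "smooth_map M (\<lambda>q. \<alpha> q + k)" by (intro smooth_map_add smooth_\<alpha> smooth_map_const)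
    have "dir_deriv M (\<lambda>q. (\<alpha> q + k) * (\<alpha> q + k)) q x = dir_deriv M (\<lambda>q. 1) q x"
      using sq by (intro dir_deriv_cong_open[OF oU q _ smooth_map_mult[OF s s] smooth_map_const x])
        (simp add: power2_eq_square)
    then have "(\<alpha> q + k) * dir_deriv M \<alpha> q x = 0"
      by (simp add: dir_deriv_mult[OF s s UM[OF q] x] dir_deriv_add[OF smooth_\<alpha> smooth_map_const UM[OF q] x]
          dir_deriv_const[OF x])
    moreover have "\<alpha> q + k \<noteq> 0" using sq[OF q] by auto
    ultimately show ?thesis by simp
  qed
  have AD: "A q x = - (\<alpha> q + k) *\<^sub>R x" if "q \<in> U" "x \<in> D q" for q x
    using jacobi_point.A_scalar_D[OF jp[OF UM[OF that(1)]] b0[OF that(1)], of x] that(2) names'(4)[OF UM[OF that(1)]] by simp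
  have AF: "\<alpha> q *\<^sub>R A q (Ff q) = - Ff q" if "q \<in> M" for q
    using jacobi_point.alpha_A_F[OF jp[OF that]] unfolding names[OF that] .
  have a0: "\<alpha> q \<noteq> 0" if "q \<in> U" for q
    by (rule jacobi_point.alpha_nonzero[OF jp[OF UM[OF that]] b0[OF that]])
  \<comment> \<open>The Codazzi equation for \<open>\<phi> H\<close> and a field \<open>X\<close> in \<open>D\<close>, paired with \<open>X\<close>.  The factor \<open>bf\<close> in the
    definition of \<open>X\<close> avoids dividing by the squared length of \<open>H\<close> and \<open>\<phi> H\<close>.\<close>
  have al: "\<alpha> q * (\<alpha> q + k) = 1" if q: "q \<in> U" for q
  proof -
    note qM = UM[OF q]
    obtain x0 where x0: "x0 \<in> D q" "x0 \<noteq> 0" using D_ex[OF q] by auto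
    then have "x0 \<in> T q" by (simp add: D_def)
    then obtain X0 where X0: "vfield M X0" "X0 q = x0" by (rule tangent_extend[OF qM])
    define X where "X r = bf r *\<^sub>R X0 r - (bf r * fs (X0 r) (xi N r)) *\<^sub>R xi N r
       - fs (X0 r) (Hf r) *\<^sub>R Hf r - fs (X0 r) (Ff r) *\<^sub>R Ff r" for r
    note sm = vfieldD(1)[OF X0(1)] vfieldD(1)[OF vfield_Hf] vfieldD(1)[OF vfield_Ff] vfieldD(1)[OF vfield_xi]
    have X: "vfield M X"
      unfolding X_def[abs_def]
      by (intro vfield_diff vfield_scaleR smooth_bf smooth_map_fs smooth_map_mult X0(1) vfield_Hf vfield_Ff vfield_xi sm)
    have XD: "X r \<in> D r" if r: "r \<in> U" for r
      using vfieldD(2)[OF X UM[OF r]] g[OF UM[OF r]] xi_facts(2)[OF UM[OF r]]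
      by (simp add: D_def X_def fs_simps bf_def[symmetric] fs_commute[of "xi N r" "Hf r"] fs_commute[of "Ff r" "Hf r"])
    have Xq: "X q = bf q *\<^sub>R x0" using x0(1) by (simp add: X_def X0 D_def)
    define x where "x = X q"
    have x: "x \<in> D q" "x \<noteq> 0" using XD[OF q] Xq x0(2) q by (auto simp: x_def U_def)
    have xT: "x \<in> T q" and xo: "fs x (xi N q) = 0" "fs x (Hf q) = 0" "fs x (Ff q) = 0"
      using x(1) by (simp_all add: D_def)
    note FT = T(3)[OF q]
    have v: "vfield M (\<lambda>r. (- (\<alpha> r + k)) *\<^sub>R X r)"
      by (intro vfield_scaleR X smooth_map_minus smooth_map_add smooth_\<alpha> smooth_map_const)
    have s: "smooth_map M (\<lambda>r. - (\<alpha> r + k))"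
      by (intro smooth_map_minus smooth_map_add smooth_\<alpha> smooth_map_const)
    have ds: "dir_deriv M (\<lambda>r. - (\<alpha> r + k)) q y = 0" if y: "y \<in> T q" for y
      using da[OF q y] dir_deriv_minus[OF smooth_map_add[OF smooth_\<alpha> smooth_map_const] qM y]
        dir_deriv_add[OF smooth_\<alpha> smooth_map_const qM y] dir_deriv_const[OF y] by simp
    have "cov (\<lambda>r. A r (X r)) q (Ff q) = cov (\<lambda>r. (- (\<alpha> r + k)) *\<^sub>R X r) q (Ff q)"
      by (rule cov_cong_open[OF oU q AD[OF _ XD] vfield_A[OF X] v FT])
    also have "\<dots> = (- (\<alpha> q + k)) *\<^sub>R cov X q (Ff q)"
      by (simp only: cov_scaleR[OF s X qM FT] ds[OF FT]) simp
    finally have second: "fs (cov (\<lambda>r. A r (X r)) q (Ff q) - A q (cov X q (Ff q))) x = 0"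
      using A_sym[OF qM cov_tangent[OF qM] xT, of X "Ff q"] by (simp add: fs_simps AD[OF q x(1)])
    have "cov (\<lambda>r. \<alpha> r *\<^sub>R A r (Ff r)) q x = cov (\<lambda>r. (-1) *\<^sub>R Ff r) q x"
      by (rule cov_cong[OF qM]) (simp add: AF)
    then have first: "\<alpha> q *\<^sub>R cov (\<lambda>r. A r (Ff r)) q x = - cov Ff q x"
      by (simp only: cov_scaleR[OF smooth_\<alpha> vfield_A[OF vfield_Ff] qM xT] cov_scaleR[OF smooth_map_const vfield_Ff qM xT]
          da[OF q xT] dir_deriv_const[OF xT]) simp
    have "cov AXi q x = 0"
      by (rule jacobi_point.B_D_zero[OF jp[OF qM] b0[OF q] da[OF q]]) (use x(1) names'(4)[OF qM] in auto)
    then have cH: "cov Hf q x = (\<alpha> q * (\<alpha> q + k)) *\<^sub>R phi N q x"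
      by (simp add: cov_Hf[OF qM xT] da[OF q xT] AD[OF q x(1)] phi_linears algebra_simps)
    have "phi N q (cov Hf q x) = (- (\<alpha> q * (\<alpha> q + k))) *\<^sub>R x"
      unfolding cH using phi_facts(2)[OF qM xT] xo(1) by (simp add: phi_linears eta_def)
    then have cF: "cov Ff q x = (- (\<alpha> q * (\<alpha> q + k))) *\<^sub>R x"
      using cov_phi[OF vfield_Hf qM xT] g(1)[OF qM] xo AD[OF q x(1)]
      by (simp add: Ff_def[abs_def] eta_def fs_simps)
    have "fs (cov (\<lambda>r. A r (Ff r)) q x - A q (cov Ff q x)) x = 0"
    proof -
      have "fs (phi N q x) (Ff q) = 0"
        using phi_facts(4)[OF qM xT FT] phi_facts(2)[OF qM T(2)[OF q]] xo g(1)[OF qM]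
        by (simp add: Ff_def fs_simps eta_def)
      then have "cov (\<lambda>r. A r (Ff r)) q x - A q (cov Ff q x) = cov (\<lambda>r. A r (X r)) q (Ff q) - A q (cov X q (Ff q))"
        using codazzi[OF X vfield_Ff qM] xo g(5)[OF qM] by (simp add: x_def[symmetric] eta_def)
      then show ?thesis using second by simp
    qed
    then have "\<alpha> q * fs (cov (\<lambda>r. A r (Ff r)) q x) x = \<alpha> q * fs (A q (cov Ff q x)) x" by (simp add: fs_simps)
    then have "fs (\<alpha> q *\<^sub>R cov (\<lambda>r. A r (Ff r)) q x) x = \<alpha> q * fs (A q (cov Ff q x)) x" by (simp only: fs_simps real_scaleR_def)
    then have "\<alpha> q * (\<alpha> q + k) * fs x x = (\<alpha> q * (\<alpha> q + k)) * (\<alpha> q * (\<alpha> q + k)) * fs x x"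
      unfolding first cF A_linears(2)[OF qM xT] AD[OF q x(1)] fs_simps real_scaleR_def by (simp add: algebra_simps)
    then have "\<alpha> q * (\<alpha> q + k) = (\<alpha> q * (\<alpha> q + k)) * (\<alpha> q * (\<alpha> q + k))"
      using x(2) fs_pos(2)[of x] by simp
    moreover have "\<alpha> q * (\<alpha> q + k) \<noteq> 0" using a0[OF q] sq[OF q] by auto
    ultimately show ?thesis by simp
  qed
  have ka: "k = 0 \<and> (\<alpha> q)\<^sup>2 = 1" if q: "q \<in> U" for q
  proof -
    have "\<alpha> q = \<alpha> q * (\<alpha> q + k)\<^sup>2" using sq[OF q] by simp
    also have "\<dots> = \<alpha> q + k" using al[OF q] by (simp add: power2_eq_square mult.assoc[symmetric])
    finally have "k = 0" by simp
    then show ?thesis using sq[OF q] by simp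
  qed
  have k: "k = 0" using ka[OF pU] by simp
  have a1: "(\<alpha> q)\<^sup>2 = 1" if "q \<in> U" for q using ka[OF that] by simp
  have db: "dir_deriv M bf q x = - 2 * (1 + 2 * bf q) * fs x (Ff q)" if q: "q \<in> U" and x: "x \<in> T q" for q x
  proof -
    note qM = UM[OF q]
    have "fs (phi N q (A q x)) (Hf q) = - fs x (A q (Ff q))"
      using phi_facts(4)[OF qM A_tangent[OF qM x] T(2)[OF q]] A_sym[OF qM x T(3)[OF q]] by (simp add: Ff_def)
    then have "\<alpha> q * fs (phi N q (A q x)) (Hf q) = - fs x (\<alpha> q *\<^sub>R A q (Ff q))" by (simp add: fs_simps)
    also have "\<dots> = fs x (Ff q)" by (simp only: AF[OF qM]) (simp add: fs_simps)
    finally have 1: "\<alpha> q * fs (phi N q (A q x)) (Hf q) = fs x (Ff q)" .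
    have 2: "fs (cov AXi q x) (Hf q) = - 2 * bf q * fs x (Ff q)"
      using jacobi_point.B_x_H[OF jp[OF qM] b0[OF q] da[OF q] k a1[OF q] x] unfolding names[OF qM] by simp
    have "dir_deriv M bf q x = 2 * fs (cov Hf q x) (Hf q)"
      using cov_fs[OF vfield_Hf vfield_Hf qM x] by (simp add: bf_def[abs_def] fs_commute)
    also have "\<dots> = 2 * (- 2 * bf q * fs x (Ff q) - fs x (Ff q))"
      by (simp add: cov_Hf[OF qM x] da[OF q x] fs_simps 1 2)
    finally show ?thesis by (simp add: algebra_simps)
  qed
  \<comment> \<open>By the formula for its differential, \<open>bf\<close> is stationary along \<open>\<xi>\<close> and \<open>H\<close>, hence along \<open>[\<xi>, H]\<close>.\<close>
  have lieT: "lie M (xi N) Hf p \<in> T p" by (rule lie_tangent[OF vfield_xi vfield_Hf p])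
  have zero: "dir_deriv M (\<lambda>q. dir_deriv M bf q (Z q)) p x = 0"
    if Z: "vfield M Z" "\<And>q. q \<in> U \<Longrightarrow> fs (Z q) (Ff q) = 0" and x: "x \<in> T p" for Z x
  proof -
    have "dir_deriv M (\<lambda>q. dir_deriv M bf q (Z q)) p x = dir_deriv M (\<lambda>q. 0) p x"
      using db vfieldD(2)[OF Z(1) UM] Z(2)
      by (intro dir_deriv_cong_open[OF oU pU _ smooth_map_dir_deriv[OF smooth_bf vfieldD(1)[OF Z(1)] vfieldD(2)[OF Z(1)]]
            smooth_map_const x]) auto
    then show ?thesis by (simp add: dir_deriv_const[OF x])
  qed
  have "dir_deriv M bf p (lie M (xi N) Hf p) = 0"
    using dir_deriv_commute[OF smooth_bf vfield_xi vfield_Hf p lieT]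
      zero[OF vfield_Hf g(2)[OF UM] T(1)[OF pU]] zero[OF vfield_xi g(3)[OF UM] T(2)[OF pU]] by simp
  moreover have "bf p \<ge> 0" by (simp add: bf_def fs_pos)
  ultimately have "fs (lie M (xi N) Hf p) (Ff p) = 0" using db[OF pU lieT] by auto
  then have *: "fs (cov Hf p (xi N p)) (Ff p) = fs (cov (xi N) p (Hf p)) (Ff p)"
    by (simp add: cov_torsion[OF vfield_xi vfield_Hf p, symmetric] fs_simps)
  note ctx = jp[OF p] b0[OF pU] da[OF pU] k a1[OF pU]
  have "fs (cov AXi p (xi N p)) (Ff p) = - 3 * \<alpha> p * bf p"
    using jacobi_point.B_xi_F[OF ctx] unfolding names[OF p] .
  moreover have "phi N p (A p (xi N p)) = Ff p"
    using jacobi_point.phi_V[OF jp[OF p]] unfolding names[OF p] by (simp add: AXi_def)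
  ultimately have "fs (cov Hf p (xi N p)) (Ff p) = - 4 * \<alpha> p * bf p"
    by (simp add: cov_Hf[OF p T(1)[OF pU]] fs_simps g[OF p])
  moreover have "cov (xi N) p (Hf p) = (\<alpha> p * (bf p - 1)) *\<^sub>R Ff p"
    using jacobi_point.phi_A_H[OF ctx] unfolding names[OF p] cov_xi[OF p T(2)[OF pU]] .
  ultimately have "- 4 * (\<alpha> p * bf p) = (bf p - 1) * (\<alpha> p * bf p)" using * g(4)[OF p] by (simp add: fs_simps algebra_simps)
  then have "bf p = - 3" using a0[OF pU] \<open>bf p \<noteq> 0\<close> by (simp only: mult_cancel_right) auto
  with \<open>bf p \<ge> 0\<close> show False by simp
qed

definition umbilical :: "(complex^'m^'m \<Rightarrow> real) \<Rightarrow> bool" where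
  "umbilical lam \<longleftrightarrow> (\<forall>p\<in>M. \<forall>x\<in>T p. fs x (xi N p) = 0 \<longrightarrow> A p x = lam p *\<^sub>R x)"

lemma eta_umbilical_iff: "eta_umbilical M N \<longleftrightarrow> (\<exists>lam. umbilical lam)"
proof
  assume "eta_umbilical M N"
  then obtain lam where lam: "\<And>X p. vfield M X \<Longrightarrow> (\<forall>p\<in>M. fs (X p) (xi N p) = 0) \<Longrightarrow> p \<in> M \<Longrightarrow>
      shape M N X p = lam p *\<^sub>R X p" unfolding eta_umbilical_def by blast
  have "umbilical lam"
    unfolding umbilical_def
  proof (intro ballI impI)
    fix p x assume p: "p \<in> M" and x: "x \<in> T p" "fs x (xi N p) = 0"
    obtain X where X: "vfield M X" "X p = x" by (rule tangent_extend[OF p x(1)])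
    have s: "smooth_map M (\<lambda>q. fs (X q) (xi N q))"
      by (rule smooth_map_fs[OF vfieldD(1)[OF X(1)] vfieldD(1)[OF vfield_xi]])
    have Y: "vfield M (\<lambda>q. X q - fs (X q) (xi N q) *\<^sub>R xi N q)"
      by (intro vfield_diff vfield_scaleR X(1) vfield_xi s)
    have "shape M N (\<lambda>q. X q - fs (X q) (xi N q) *\<^sub>R xi N q) p = lam p *\<^sub>R (X p - fs (X p) (xi N p) *\<^sub>R xi N p)"
      by (rule lam[OF Y _ p]) (simp add: fs_simps xi_facts)
    then show "A p x = lam p *\<^sub>R x" by (simp add: shape_eq[OF Y p] X(2) x(2))
  qed
  then show "\<exists>lam. umbilical lam" by (rule exI[of _ lam])
next
  assume "\<exists>lam. umbilical lam"
  then obtain lam where "umbilical lam" ..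
  then show "eta_umbilical M N"
    unfolding eta_umbilical_def by (intro exI[of _ lam]) (auto simp: umbilical_def shape_eq vfieldD)
qed

lemma skew_imp_umbilical:
  assumes skew: "skew_jacobi_condition M N k" shows "eta_umbilical M N"
proof -
  have B: "cov AXi p x = dir_deriv M \<alpha> p x *\<^sub>R xi N p + \<alpha> p *\<^sub>R phi N p (A p x)" if p: "p \<in> M" and x: "x \<in> T p" for p x
  proof -
    have "cov AXi p x = cov (\<lambda>q. \<alpha> q *\<^sub>R xi N q) p x" by (rule cov_cong[OF p hopf[OF skew]])
    then show ?thesis by (simp only: cov_scaleR[OF smooth_\<alpha> vfield_xi p x] cov_xi[OF p x])
  qed
  have "umbilical (\<lambda>p. - (\<alpha> p + k) / (1 + (\<alpha> p)\<^sup>2))"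
    unfolding umbilical_def
  proof (intro ballI impI)
    fix p x assume p: "p \<in> M" and x: "x \<in> T p" "fs x (xi N p) = 0"
    have c: "1 + (\<alpha> p)\<^sup>2 \<noteq> 0" using zero_le_power2[of "\<alpha> p"] by linarith
    have "(1 + (\<alpha> p)\<^sup>2) *\<^sub>R A p x = - (\<alpha> p + k) *\<^sub>R x"
      by (rule jacobi_point.hopf_umbilical[OF jacobi_point[OF skew p] hopf[OF skew p] B[OF p] x])
    then have "(1 / (1 + (\<alpha> p)\<^sup>2)) *\<^sub>R ((1 + (\<alpha> p)\<^sup>2) *\<^sub>R A p x) = (1 / (1 + (\<alpha> p)\<^sup>2)) *\<^sub>R (- (\<alpha> p + k) *\<^sub>R x)"
      by (simp only:)
    then show "A p x = (- (\<alpha> p + k) / (1 + (\<alpha> p)\<^sup>2)) *\<^sub>R x" using c by simp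
  qed
  then show ?thesis unfolding eta_umbilical_iff by (rule exI[of umbilical])
qed

end

section \<open>Totally umbilical hypersurfaces satisfy the Jacobi condition\<close>

context oriented_hypersurface
begin

context
  fixes lam :: "complex^'m^'m \<Rightarrow> real"
  assumes umb: "umbilical lam"
begin

lemma A_orth: "p \<in> M \<Longrightarrow> x \<in> T p \<Longrightarrow> fs x (xi N p) = 0 \<Longrightarrow> A p x = lam p *\<^sub>R x"
  using umb by (simp add: umbilical_def)

text \<open>\<open>A \<xi>\<close> is orthogonal to the eigenvectors of \<open>A\<close> that fill the complement of \<open>\<xi>\<close>.\<close>

lemma A_xi_umbilical: assumes p: "p \<in> M" shows "A p (xi N p) = \<alpha> p *\<^sub>R xi N p"
proof -
  note x = xi_facts[OF p]
  define z where "z = A p (xi N p) - \<alpha> p *\<^sub>R xi N p"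
  have zT: "z \<in> T p"
    unfolding z_def using x A_tangent[OF p x(1)] subspace_tangent[OF p] by (simp add: subspace_diff subspace_scale)
  have zx: "fs z (xi N p) = 0" by (simp add: z_def fs_simps x \<alpha>_def)
  have "fs (A p (xi N p)) z = 0"
    using A_sym[OF p x(1) zT] A_orth[OF p zT zx] zx by (simp add: fs_simps fs_commute[of "xi N p"])
  then have "fs z z = 0"
    using zx by (subst (1) z_def) (simp add: fs_simps fs_commute[of "xi N p"])
  then show ?thesis using fs_pos(2)[of z] by (simp add: z_def)
qed

lemma A_umbilical: assumes p: "p \<in> M" and x: "x \<in> T p"
  shows "A p x = lam p *\<^sub>R x + ((\<alpha> p - lam p) * eta N p x) *\<^sub>R xi N p"
proof -
  note xi = xi_facts[OF p]
  let ?y = "x - eta N p x *\<^sub>R xi N p"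
  have e: "eta N p x *\<^sub>R xi N p \<in> T p" using xi subspace_tangent[OF p] by (simp add: subspace_scale)
  have y: "?y \<in> T p" using x e subspace_tangent[OF p] by (simp add: subspace_diff)
  have "A p ?y = lam p *\<^sub>R ?y" by (rule A_orth[OF p y]) (simp add: fs_simps eta_def xi)
  then have "A p x - eta N p x *\<^sub>R A p (xi N p) = lam p *\<^sub>R ?y"
    by (simp add: A_linears[OF p x] A_linears[OF p xi(1)] e)
  then show ?thesis by (simp add: A_xi_umbilical[OF p] algebra_simps)
qed

text \<open>With \<open>Q\<close> the projection to the complement of \<open>\<xi>\<close>, the function \<open>\<lambda>\<close> is the quotient of the smooth
  functions \<open>\<Sum>\<langle>A (Q b), Q b\<rangle>\<close> and \<open>\<Sum>\<langle>Q b, Q b\<rangle>\<close>, summed over a basis of the surrounding space.\<close>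

lemma smooth_lam: "smooth_map M lam"
proof -
  define X where "X b q = P q b - fs (P q b) (xi N q) *\<^sub>R xi N q" for b q
  have vP: "vfield M (\<lambda>q. P q b)" for b by (rule vfield_P[OF smooth_map_const])
  have X: "vfield M (X b)" for b
    unfolding X_def[abs_def]
    by (intro vfield_diff vfield_scaleR vP vfield_xi smooth_map_fs vfieldD(1)[OF vP] vfieldD(1)[OF vfield_xi])
  define c where "c q = (\<Sum>b\<in>Basis. fs (X b q) (X b q))" for q
  have c: "c q \<noteq> 0" if q: "q \<in> M" for q
  proof
    assume "c q = 0"
    then have "\<forall>b\<in>Basis. fs (X b q) (X b q) = 0"
      unfolding c_def by (subst (asm) sum_nonneg_eq_0_iff) (auto simp: fs_pos)
    then have X0: "X b q = 0" if "b \<in> Basis" for b using that by (simp add: fs_pos)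
    obtain y where y: "y \<in> T q" "y \<noteq> 0" "fs y (xi N q) = 0"
      by (rule orthogonal_in_T[OF q xi_facts(1)[OF q] xi_facts(1)[OF q] xi_facts(1)[OF q]])
    have "y = P q y - fs (P q y) (xi N q) *\<^sub>R xi N q" by (simp add: P_id[OF q y(1)] y(3))
    also have "\<dots> = (\<Sum>b\<in>Basis. (y \<bullet> b) *\<^sub>R X b q)"
      unfolding X_def scaleR_diff_right sum_subtractf P_expand[OF q, symmetric]
      by (subst P_expand[OF q, of y]) (simp add: fs.sum_left fs_simps scaleR_sum_left)
    also have "\<dots> = 0" by (simp add: X0)
    finally show False using y(2) by simp
  qed
  have eq: "(\<Sum>b\<in>Basis. fs (A q (X b q)) (X b q)) * inverse (c q) = lam q" if q: "q \<in> M" for q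
  proof -
    have "A q (X b q) = lam q *\<^sub>R X b q" for b
      by (rule A_orth[OF q vfieldD(2)[OF X q]]) (simp add: X_def fs_simps xi_facts[OF q])
    then have "(\<Sum>b\<in>Basis. fs (A q (X b q)) (X b q)) = lam q * c q" by (simp add: c_def fs_simps sum_distrib_left)
    then show ?thesis using c[OF q] by simp
  qed
  have sm: "smooth_map M (\<lambda>q. (\<Sum>b\<in>Basis. fs (A q (X b q)) (X b q)) * inverse (c q))"
    by (intro smooth_map_mult smooth_map_inverse smooth_map_sum finite_Basis smooth_map_fs c
        vfieldD(1)[OF X] vfieldD(1)[OF vfield_A[OF X]]) (auto simp: c_def[abs_def] intro!: smooth_map_sum smooth_map_fs vfieldD(1)[OF X])
  show ?thesis by (rule smooth_map_cong[OF sm eq])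
qed

lemma cov_A_umbilical:
  assumes Y: "vfield M Y" and p: "p \<in> M" and x: "x \<in> T p"
  shows "cov (\<lambda>q. A q (Y q)) p x - A p (cov Y p x) = dir_deriv M lam p x *\<^sub>R Y p
    + (dir_deriv M (\<lambda>q. \<alpha> q - lam q) p x * eta N p (Y p) + (\<alpha> p - lam p) * fs (Y p) (phi N p (A p x))) *\<^sub>R xi N p
    + ((\<alpha> p - lam p) * eta N p (Y p)) *\<^sub>R phi N p (A p x)"
proof -
  have eS: "smooth_map M (\<lambda>q. eta N q (Y q))" by (rule smooth_map_eta[OF vfieldD(1)[OF Y]])
  have mS: "smooth_map M (\<lambda>q. \<alpha> q - lam q)" by (intro smooth_map_diff smooth_\<alpha> smooth_lam)
  have de: "dir_deriv M (\<lambda>q. eta N q (Y q)) p x = eta N p (cov Y p x) + fs (Y p) (phi N p (A p x))"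
    unfolding eta_def by (simp add: cov_fs[OF Y vfield_xi p x] cov_xi[OF p x])
  have "cov (\<lambda>q. A q (Y q)) p x = cov (\<lambda>q. lam q *\<^sub>R Y q + ((\<alpha> q - lam q) * eta N q (Y q)) *\<^sub>R xi N q) p x"
    by (rule cov_cong[OF p A_umbilical[OF _ vfieldD(2)[OF Y]]]) 
  also have "\<dots> = dir_deriv M lam p x *\<^sub>R Y p + lam p *\<^sub>R cov Y p x
     + (dir_deriv M (\<lambda>q. (\<alpha> q - lam q) * eta N q (Y q)) p x *\<^sub>R xi N p + ((\<alpha> p - lam p) * eta N p (Y p)) *\<^sub>R phi N p (A p x))"
    by (simp only: cov_add[OF vfield_scaleR[OF smooth_lam Y] vfield_scaleR[OF smooth_map_mult[OF mS eS] vfield_xi] p x]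
        cov_scaleR[OF smooth_lam Y p x] cov_scaleR[OF smooth_map_mult[OF mS eS] vfield_xi p x] cov_xi[OF p x])
  finally have e: "cov (\<lambda>q. A q (Y q)) p x = dir_deriv M lam p x *\<^sub>R Y p + lam p *\<^sub>R cov Y p x
     + (dir_deriv M (\<lambda>q. (\<alpha> q - lam q) * eta N q (Y q)) p x *\<^sub>R xi N p + ((\<alpha> p - lam p) * eta N p (Y p)) *\<^sub>R phi N p (A p x))" .
  show ?thesis
    unfolding e A_umbilical[OF p cov_tangent[OF p]] dir_deriv_mult[OF mS eS p x] de
    by (simp add: algebra_simps)
qed

lemma phi_A_umbilical: assumes p: "p \<in> M" and x: "x \<in> T p" shows "phi N p (A p x) = lam p *\<^sub>R phi N p x"
  unfolding A_umbilical[OF p x] by (simp add: phi_linears phi_xi[OF p])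

text \<open>The Codazzi equation for the known form of \<open>A\<close>.  Its \<open>\<xi>\<close>-component for \<open>y = \<phi> x\<close> determines \<open>\<alpha>\<close> from
  \<open>\<lambda>\<close> (\<open>mu_lam\<close>), and its component along a vector \<open>y\<close> orthogonal to \<open>\<xi>\<close>, \<open>x\<close> and \<open>\<phi> x\<close> makes \<open>\<lambda>\<close> locally
  constant (\<open>d_lam\<close>).\<close>

lemma codazzi_umbilical:
  assumes p: "p \<in> M" and x: "x \<in> T p" and y: "y \<in> T p" and w: "w \<in> T p"
  shows "dir_deriv M lam p x * fs y w - dir_deriv M lam p y * fs x w
    + (dir_deriv M (\<lambda>q. \<alpha> q - lam q) p x * eta N p y - dir_deriv M (\<lambda>q. \<alpha> q - lam q) p y * eta N p x
       + 2 * (\<alpha> p - lam p) * lam p * fs (phi N p x) y) * eta N p w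
    + (\<alpha> p - lam p) * lam p * (eta N p y * fs (phi N p x) w - eta N p x * fs (phi N p y) w)
    = eta N p x * fs (phi N p y) w - eta N p y * fs (phi N p x) w - 2 * fs (phi N p x) y * eta N p w"
proof -
  obtain X where X: "vfield M X" "X p = x" by (rule tangent_extend[OF p x])
  obtain Y where Y: "vfield M Y" "Y p = y" by (rule tangent_extend[OF p y])
  have s: "fs y (phi N p x) = fs (phi N p x) y" "fs x (phi N p y) = - fs (phi N p x) y"
    using phi_facts(4)[OF p x y] by (simp_all add: fs_commute)
  have ew: "fs (xi N p) w = eta N p w" by (simp add: eta_def fs_commute)
  have "fs (cov (\<lambda>q. A q (Y q)) p x - A p (cov Y p x) - (cov (\<lambda>q. A q (X q)) p y - A p (cov X p y))) w
    = fs (eta N p x *\<^sub>R phi N p y - eta N p y *\<^sub>R phi N p x - (2 * fs (phi N p x) y) *\<^sub>R xi N p) w"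
    using codazzi[OF X(1) Y(1) p] by (simp add: X Y)
  then show ?thesis
    unfolding cov_A_umbilical[OF Y(1) p x] cov_A_umbilical[OF X(1) p y] phi_A_umbilical[OF p x] phi_A_umbilical[OF p y]
      X(2) Y(2) fs_simps s ew
    by (simp add: algebra_simps)
qed

lemma mu_lam: assumes p: "p \<in> M" shows "(\<alpha> p - lam p) * lam p = - 1"
proof -
  note xi = xi_facts[OF p]
  obtain x where x: "x \<in> T p" "x \<noteq> 0" "fs x (xi N p) = 0"
    by (rule orthogonal_in_T[OF p xi(1) xi(1) xi(1)])
  have "fs (phi N p x) (phi N p x) = fs x x"
    using phi_facts(4)[OF p x(1) phi_facts(1)[OF p x(1)]] phi_facts(2)[OF p x(1)] x(3) by (simp add: eta_def fs_simps)
  then have nz: "fs (phi N p x) (phi N p x) \<noteq> 0" using x(2) fs_pos(2)[of x] by simp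
  have "2 * ((\<alpha> p - lam p) * lam p) * fs (phi N p x) (phi N p x) = 2 * (- 1) * fs (phi N p x) (phi N p x)"
  proof -
    have e: "eta N p x = 0" "eta N p (phi N p x) = 0" "eta N p (xi N p) = 1" "fs (phi N p x) (xi N p) = 0"
      using phi_facts(3)[OF p x(1)] x(3) xi(2) by (simp_all add: eta_def)
    show ?thesis
      using codazzi_umbilical[OF p x(1) phi_facts(1)[OF p x(1)] xi(1)]
      unfolding e x(3) mult_zero_left mult_zero_right mult_1_right diff_self mult.assoc by linarith
  qed
  then have "2 * ((\<alpha> p - lam p) * lam p) = 2 * (- 1)" by (rule mult_right_cancel[OF nz, THEN iffD1])
  then show ?thesis by linarith
qed

lemma lam_nonzero: "p \<in> M \<Longrightarrow> lam p \<noteq> 0"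
  using mu_lam[of p] by auto

lemma d_lam: assumes p: "p \<in> M" and x: "x \<in> T p" shows "dir_deriv M lam p x = 0"
proof -
  note xi = xi_facts[OF p]
  have orth: "dir_deriv M lam p x = 0" if x: "x \<in> T p" "fs x (xi N p) = 0" for x
  proof -
    obtain y where y: "y \<in> T p" "y \<noteq> 0" "fs y (xi N p) = 0" "fs y x = 0" "fs y (phi N p x) = 0"
      by (rule orthogonal_in_T[OF p xi(1) x(1) phi_facts(1)[OF p x(1)]])
    have "dir_deriv M lam p x * fs y y = 0"
      using codazzi_umbilical[OF p x(1) y(1) y(1)] x(2) y(3,4) by (simp add: eta_def fs_commute[of x y])
    then show ?thesis using y(2) fs_pos(2)[of y] by simp
  qed
  obtain y where y: "y \<in> T p" "y \<noteq> 0" "fs y (xi N p) = 0"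
    by (rule orthogonal_in_T[OF p xi(1) xi(1) xi(1)])
  have "fs (phi N p y) y = 0" using phi_facts(4)[OF p y(1) y(1)] fs_commute[of y "phi N p y"] by simp
  then have "dir_deriv M lam p (xi N p) * fs y y = 0"
    using codazzi_umbilical[OF p xi(1) y(1) y(1)] y(3)
    by (simp add: eta_def xi phi_xi[OF p] fs_commute[of "xi N p" y] fs_simps)
  then have dxi: "dir_deriv M lam p (xi N p) = 0" using y(2) fs_pos(2)[of y] by simp
  let ?z = "x - eta N p x *\<^sub>R xi N p"
  have e: "eta N p x *\<^sub>R xi N p \<in> T p" using xi subspace_tangent[OF p] by (simp add: subspace_scale)
  have z: "?z \<in> T p" "fs ?z (xi N p) = 0"
    using x e subspace_tangent[OF p] by (simp_all add: subspace_diff fs_simps eta_def xi)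
  have "dir_deriv M lam p (?z + eta N p x *\<^sub>R xi N p) = 0"
    by (simp only: dir_deriv_dir_add[OF smooth_lam p z(1) e] orth[OF z] dir_deriv_dir_scaleR[OF smooth_lam p xi(1)] dxi) simp
  then show ?thesis by simp
qed

lemma d_alpha_umbilical: assumes p: "p \<in> M" and x: "x \<in> T p" shows "dir_deriv M \<alpha> p x = 0"
proof -
  have mS: "smooth_map M (\<lambda>q. \<alpha> q - lam q)" by (intro smooth_map_diff smooth_\<alpha> smooth_lam)
  have "dir_deriv M (\<lambda>q. (\<alpha> q - lam q) * lam q) p x = dir_deriv M (\<lambda>q. - 1) p x"
    by (rule dir_deriv_cong[OF p mu_lam])
  then show ?thesis
    using lam_nonzero[OF p]
    by (simp add: dir_deriv_mult[OF mS smooth_lam p x] dir_deriv_diff[OF smooth_\<alpha> smooth_lam p x]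
        d_lam[OF p x] dir_deriv_const[OF x])
qed

text \<open>All derivatives of functions vanish, and the remaining terms are multiples of
  \<open>\<langle>\<phi> X, Y\<rangle> \<xi> + \<eta>(Y) \<phi> X\<close> with total factor \<open>- (\<lambda> + \<alpha> + \<alpha>\<^sup>2 \<lambda>)\<close>, where \<open>\<alpha> \<lambda> = \<lambda>\<^sup>2 - 1\<close>.\<close>

lemma nabla_jacobi_umbilical:
  assumes X: "vfield M X" and Y: "vfield M Y" and p: "p \<in> M"
  shows "nabla_jacobi M N X Y p =
    (- (lam p ^ 3)) *\<^sub>R (fs (phi N p (X p)) (Y p) *\<^sub>R xi N p + eta N p (Y p) *\<^sub>R phi N p (X p))"
proof -
  note x = vfieldD(2)[OF X p] and y = vfieldD(2)[OF Y p]
  note dl = d_lam[OF p x] and dal = d_alpha_umbilical[OF p x] and ph = phi_A_umbilical[OF p x]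
  define c where "c = fs (phi N p (X p)) (Y p)"
  define e where "e = eta N p (Y p)"
  define E where "E = c *\<^sub>R xi N p + e *\<^sub>R phi N p (X p)"
  have c: "fs (Y p) (phi N p (X p)) = c" by (simp add: c_def fs_commute)
  have e: "fs (Y p) (xi N p) = e" by (simp add: e_def eta_def)
  have V: "AXi p = \<alpha> p *\<^sub>R xi N p" by (simp add: AXi_def A_xi_umbilical[OF p])
  have B: "cov AXi p (X p) = (\<alpha> p * lam p) *\<^sub>R phi N p (X p)"
  proof -
    have "cov AXi p (X p) = cov (\<lambda>q. \<alpha> q *\<^sub>R xi N q) p (X p)"
      by (rule cov_cong[OF p]) (simp add: AXi_def A_xi_umbilical)
    then show ?thesis by (simp add: cov_scaleR[OF smooth_\<alpha> vfield_xi p x] dal cov_xi[OF p x] ph)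
  qed
  have dmu: "dir_deriv M (\<lambda>q. \<alpha> q - lam q) p (X p) = 0"
    by (simp add: dir_deriv_diff[OF smooth_\<alpha> smooth_lam p x] dl dal)
  have "cov (\<lambda>q. A q (Y q)) p (X p) - A p (cov Y p (X p)) = ((\<alpha> p - lam p) * lam p) *\<^sub>R E"
    unfolding cov_A_umbilical[OF Y p x] dl dmu ph fs_simps c e_def[symmetric] E_def by (simp add: algebra_simps)
  then have cA: "cov (\<lambda>q. A q (Y q)) p (X p) - A p (cov Y p (X p)) = - E"
    by (simp only: mu_lam[OF p]) simp
  have "nabla_jacobi M N X Y p = - (lam p *\<^sub>R E) + \<alpha> p *\<^sub>R (- E) - (\<alpha> p * (\<alpha> p * lam p)) *\<^sub>R E"
    unfolding nabla_jacobi_eq[OF X Y p] dal ph B V cA fs_simps c e e_def[symmetric]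
    by (simp add: E_def algebra_simps)
  also have "\<dots> = (- (lam p + \<alpha> p + \<alpha> p * (\<alpha> p * lam p))) *\<^sub>R E"
    by (simp add: algebra_simps)
  also have "lam p + \<alpha> p + \<alpha> p * (\<alpha> p * lam p) = lam p ^ 3"
  proof -
    have al: "\<alpha> p * lam p = lam p * lam p - 1" using mu_lam[OF p] by (simp add: algebra_simps)
    have "\<alpha> p * (\<alpha> p * lam p) = \<alpha> p * (lam p * lam p - 1)" by (simp only: al)
    also have "\<dots> = \<alpha> p * lam p * lam p - \<alpha> p" by (simp add: algebra_simps)
    also have "\<dots> = (lam p * lam p - 1) * lam p - \<alpha> p" by (simp add: al)
    finally show ?thesis by (simp add: power3_eq_cube algebra_simps)
  qed
  finally show ?thesis by (simp only: E_def c_def e_def)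
qed

lemma jacobi_condition_umbilical:
  assumes "\<And>p. p \<in> M \<Longrightarrow> lam p = c" shows "jacobi_condition M N (- (c ^ 3))"
  unfolding jacobi_condition_def using nabla_jacobi_umbilical assms by simp

end

end

section \<open>Change of normal and global constancy\<close>

lemma oriented_hypersurface_openin:
  assumes "oriented_hypersurface M N n" "openin (top_of_set M) U"
  shows "oriented_hypersurface U N n"
proof -
  interpret oriented_hypersurface M N n by (rule assms(1))
  have sub: "U \<subseteq> M" by (rule openin_imp_subset[OF assms(2)])
  have "unit_normal U N"
    using normal sub smooth_map_subset[OF N_smooth sub] tangent_openin[OF assms(2)]
    by (auto simp: unit_normal_def)
  then show ?thesis using card n M_CP sub submanifold_openin[OF M_sub assms(2)]
    by (intro oriented_hypersurface.intro) auto
qed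

lemma umbilical_openin:
  assumes "oriented_hypersurface M N n" and W: "openin (top_of_set M) W"
    and umb: "oriented_hypersurface.umbilical M N lam"
  shows "oriented_hypersurface.umbilical W N lam"
proof -
  interpret oriented_hypersurface M N n by (rule assms(1))
  interpret w: oriented_hypersurface W N n by (rule oriented_hypersurface_openin[OF assms(1) W])
  show ?thesis
    unfolding w.umbilical_def
  proof (intro ballI impI)
    fix q x assume q: "q \<in> W" and x: "x \<in> tangent W q" "fs x (xi N q) = 0"
    have qM: "q \<in> M" by (rule subsetD[OF openin_imp_subset[OF W] q])
    have xT: "x \<in> T q" using x(1) tangent_openin[OF W q] by simp
    have "w.A q x = A q x"
      using dir_deriv_subset[OF N_smooth openin_imp_subset[OF W] q x(1)] by (simp add: w.A_def A_def)
    also have "\<dots> = lam q *\<^sub>R x" by (rule A_orth[OF umb qM xT x(2)])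
    finally show "w.A q x = lam q *\<^sub>R x" .
  qed
qed

text \<open>Two unit normals of the same hypersurface differ by a sign, and so do their shape operators.\<close>

lemma shape_change_of_normal:
  assumes "oriented_hypersurface U N n" "oriented_hypersurface U N' n" and p: "p \<in> U"
  obtains s where "s\<^sup>2 = 1" "xi N' p = s *\<^sub>R xi N p"
    "\<forall>x\<in>tangent U p. oriented_hypersurface.A U N' p x = s *\<^sub>R oriented_hypersurface.A U N p x"
proof -
  interpret a: oriented_hypersurface U N n by (rule assms(1))
  interpret b: oriented_hypersurface U N' n by (rule assms(2))
  define s where "s q = fs (N' q) (N q)" for q
  have s: "smooth_map U s" unfolding s_def[abs_def] by (rule smooth_map_fs[OF b.N_smooth a.N_smooth])
  have eq: "N' q = s q *\<^sub>R N q \<and> (s q)\<^sup>2 = 1" if q: "q \<in> U" for q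
  proof -
    let ?v = "N' q - s q *\<^sub>R N q"
    have "fs ?v (N q) = 0" by (simp add: fs_simps s_def a.N_norm[OF q])
    moreover have "ctan q ?v" by (intro a.ctan_diff a.ctan_scaleR a.N_ctan b.N_ctan q)
    ultimately have "?v \<in> tangent U q" using a.T_iff[OF q] by simp
    then have v: "fs ?v (N' q) = 0" by (rule b.T_N[OF q])
    have "fs ?v ?v = fs ?v (N' q) - s q * fs ?v (N q)" by (simp add: fs_simps)
    then have "fs ?v ?v = 0" using v \<open>fs ?v (N q) = 0\<close> by simp
    then have 1: "N' q = s q *\<^sub>R N q" by (simp add: fs_pos)
    have "s q * s q = fs (N' q) (N' q)" by (simp add: 1 fs_simps a.N_norm[OF q])
    then show ?thesis using 1 b.N_norm[OF q] by (simp add: power2_eq_square)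
  qed
  have A: "b.A p x = s p *\<^sub>R a.A p x" if x: "x \<in> tangent U p" for x
  proof -
    have "dir_deriv U N' p x = dir_deriv U (\<lambda>q. s q *\<^sub>R N q) p x"
      by (rule dir_deriv_cong[OF p]) (simp add: eq)
    also have "\<dots> = dir_deriv U s p x *\<^sub>R N p + s p *\<^sub>R dir_deriv U N p x"
      by (rule dir_deriv_scaleR[OF s a.N_smooth p x])
    finally have d: "a.P p (dir_deriv U N' p x) = s p *\<^sub>R a.P p (dir_deriv U N p x)"
      by (simp add: a.P_linears[OF p] a.P_N[OF p])
    have "b.A p x = a.P p (b.A p x)" by (rule a.P_id[OF p b.A_tangent[OF p x], symmetric])
    also have "\<dots> = - a.P p (dir_deriv U N' p x)" by (simp add: b.A_def a.P_linears[OF p] a.P_cproj[OF p])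
    also have "\<dots> = s p *\<^sub>R a.A p x" by (simp add: d a.P_dN[OF p x])
    finally show ?thesis .
  qed
  show ?thesis
    by (rule that[of "s p"]) (use eq[OF p] A in \<open>simp_all add: xi_def a.J_linears\<close>)
qed

lemma unit_normal_minus:
  assumes "oriented_hypersurface U N n" shows "oriented_hypersurface U (\<lambda>q. - N q) n"
proof -
  interpret oriented_hypersurface U N n by (rule assms)
  have "unit_normal U (\<lambda>q. - N q)"
    using normal N_smooth tangent_CP[OF CP] ctan_minus[OF N_ctan]
    by (auto simp: unit_normal_def smooth_map_minus fs_simps)
  then show ?thesis using card n M_CP M_sub by (intro oriented_hypersurface.intro) auto
qed

text \<open>The principal curvature is determined up to sign at each point.\<close>

lemma umbilical_change_of_normal:
  assumes "oriented_hypersurface U N n" "oriented_hypersurface U N' n" and p: "p \<in> U"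
    and "oriented_hypersurface.umbilical U N lam" "oriented_hypersurface.umbilical U N' lam'"
  shows "\<bar>lam' p\<bar> = \<bar>lam p\<bar>"
proof -
  interpret a: oriented_hypersurface U N n by (rule assms(1))
  interpret b: oriented_hypersurface U N' n by (rule assms(2))
  obtain s where s: "s\<^sup>2 = 1" "xi N' p = s *\<^sub>R xi N p" "\<forall>x\<in>tangent U p. b.A p x = s *\<^sub>R a.A p x"
    by (rule shape_change_of_normal[OF assms(1-3)])
  note xi = a.xi_facts(1)[OF p]
  obtain x where x: "x \<in> tangent U p" "x \<noteq> 0" "fs x (xi N p) = 0"
    by (rule a.orthogonal_in_T[OF p xi xi xi])
  have "lam' p *\<^sub>R x = b.A p x"
    by (rule b.A_orth[OF assms(5) p x(1), symmetric]) (simp add: s(2) fs_simps x(3))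
  also have "\<dots> = s *\<^sub>R (lam p *\<^sub>R x)" using s(3) x(1) a.A_orth[OF assms(4) p x(1,3)] by simp
  finally have "lam' p = s * lam p" using x(2) by simp
  moreover have "\<bar>s\<bar> = 1" using s(1) by (metis power2_eq_1_iff abs_1 abs_minus_cancel)
  ultimately show ?thesis by (simp add: abs_mult)
qed

text \<open>The normal is chosen so that the principal curvature becomes \<open>\<bar>l\<bar>\<close>.\<close>

lemma oriented_umbilical_exists:
  assumes "oriented_hypersurface U N n" and umb: "oriented_hypersurface.umbilical U N (\<lambda>q. l)"
  obtains N' where "unit_normal U N'" "jacobi_condition U N' (- (\<bar>l\<bar> ^ 3))"
proof -
  interpret a: oriented_hypersurface U N n by (rule assms(1))
  interpret b: oriented_hypersurface U "\<lambda>q. - N q" n by (rule unit_normal_minus[OF assms(1)])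
  show ?thesis
  proof (cases "l \<ge> 0")
    case True
    then show ?thesis using that[OF a.normal] a.jacobi_condition_umbilical[OF umb refl] by simp
  next
    case False
    have "b.umbilical (\<lambda>q. - l)"
      unfolding b.umbilical_def
    proof (intro ballI impI)
      fix q x assume q: "q \<in> U" and x: "x \<in> tangent U q" "fs x (xi (\<lambda>q. - N q) q) = 0"
      have xo: "fs x (xi N q) = 0" using x(2) by (simp add: xi_def a.J_linears fs_simps)
      have "b.A q x = - a.A q x"
        by (simp add: b.A_def a.A_def dir_deriv_minus[OF a.N_smooth q x(1)] linear_neg[OF linear_cproj])
      then show "b.A q x = - l *\<^sub>R x" by (simp add: a.A_orth[OF umb q x(1) xo])
    qed
    from b.jacobi_condition_umbilical[OF this refl] show ?thesis using that[OF b.normal] False by simp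
  qed
qed

lemma real_hypersurface_oriented:
  fixes M :: "(complex^'m::finite^'m) set"
  assumes "CARD('m) = n + 1" and "n > 2" and M: "real_hypersurface n M"
    and U: "openin (top_of_set M) U" and "unit_normal U N"
  shows "oriented_hypersurface U N n"
  using assms openin_imp_subset[OF U] submanifold_openin[OF _ U]
  by (intro oriented_hypersurface.intro) (auto simp: real_hypersurface_def)

text \<open>By connectedness \<open>\<bar>\<lambda>\<bar>\<close>, which does not depend on the local normal, is the same at all points.\<close>

lemma umbilical_imp_jacobi:
  fixes M :: "(complex^'m::finite^'m) set"
  assumes card: "CARD('m) = n + 1" and n: "n > 2" and M: "real_hypersurface n M"
    and loc: "locally_oriented M (\<lambda>U N. eta_umbilical U N)"
  shows "\<exists>k. locally_oriented M (\<lambda>U N. jacobi_condition U N k)"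
proof -
  have sub: "M \<subseteq> CP" "submanifold (2 * n - 1) M" "connected M" using M by (auto simp: real_hypersurface_def)
  note oh = real_hypersurface_oriented[OF card n M]
  \<comment> \<open>Near each point the hypersurface carries a normal with constant principal curvature \<open>c\<close>.\<close>
  define R where "R p U N c \<longleftrightarrow> openin (top_of_set M) U \<and> p \<in> U \<and> unit_normal U N \<and>
      oriented_hypersurface.umbilical U N (\<lambda>q. c)" for p U N and c :: real
  have "\<forall>p\<in>M. \<exists>U N c. R p U N c"
  proof
    fix p assume p: "p \<in> M"
    obtain U N where U: "openin (top_of_set M) U" "p \<in> U" "unit_normal U N" "eta_umbilical U N"
      using loc p unfolding locally_oriented_def by blast
    interpret oriented_hypersurface U N n by (rule oh[OF U(1,3)])
    obtain lam where lam: "umbilical lam" using U(4) unfolding eta_umbilical_iff by (rule exE)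
    obtain W where W: "openin (top_of_set U) W" "p \<in> W" "\<forall>q\<in>W. lam q = lam p"
      by (rule submanifold_locally_constant[OF M_sub smooth_lam[OF lam] d_lam[OF lam] U(2)])
    have oW: "openin (top_of_set M) W" by (rule openin_trans[OF W(1) U(1)])
    interpret w: oriented_hypersurface W N n by (rule oriented_hypersurface_openin[OF oh[OF U(1,3)] W(1)])
    have "w.umbilical lam" by (rule umbilical_openin[OF oh[OF U(1,3)] W(1) lam])
    then have "w.umbilical (\<lambda>q. lam p)" using W(3) unfolding w.umbilical_def by metis
    then have "R p W N (lam p)" using oW W(2) w.normal unfolding R_def by blast
    then show "\<exists>U N c. R p U N c" by blast
  qed
  from bchoice[OF this] obtain U where "\<forall>p\<in>M. \<exists>N c. R p (U p) N c" by (rule exE)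
  from bchoice[OF this] obtain N where "\<forall>p\<in>M. \<exists>c. R p (U p) (N p) c" by (rule exE)
  from bchoice[OF this] obtain c where R: "\<forall>p\<in>M. R p (U p) (N p) (c p)" by (rule exE)
  have U: "openin (top_of_set M) (U p)" "p \<in> U p" "unit_normal (U p) (N p)"
    and umb: "oriented_hypersurface.umbilical (U p) (N p) (\<lambda>q. c p)" if "p \<in> M" for p
    using bspec[OF R that] unfolding R_def by blast+
  have abs_c: "\<bar>c q\<bar> = \<bar>c p\<bar>" if p: "p \<in> M" and q: "q \<in> U p" for p q
  proof -
    have qM: "q \<in> M" by (rule subsetD[OF openin_imp_subset[OF U(1)[OF p]] q])
    define W where "W = U p \<inter> U q"
    have o: "openin (top_of_set M) W" unfolding W_def by (rule openin_Int[OF U(1)[OF p] U(1)[OF qM]])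
    have W: "openin (top_of_set (U p)) W" "openin (top_of_set (U q)) W"
      using openin_subset_trans[OF o _ openin_imp_subset[OF U(1)[OF p]]]
        openin_subset_trans[OF o _ openin_imp_subset[OF U(1)[OF qM]]] by (simp_all add: W_def)
    have qW: "q \<in> W" using q U(2)[OF qM] by (simp add: W_def)
    note op = oh[OF U(1)[OF p] U(3)[OF p]] and oq = oh[OF U(1)[OF qM] U(3)[OF qM]]
    show ?thesis
      by (rule umbilical_change_of_normal[OF oriented_hypersurface_openin[OF op W(1)]
            oriented_hypersurface_openin[OF oq W(2)] qW umbilical_openin[OF op W(1) umb[OF p]]
            umbilical_openin[OF oq W(2) umb[OF qM]]])
  qed
  have "(\<lambda>p. \<bar>c p\<bar>) constant_on M"
  proof (rule locally_constant_imp_constant[OF sub(3)])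
    fix a assume a: "a \<in> M"
    show "\<exists>T. openin (top_of_set M) T \<and> a \<in> T \<and> (\<forall>x\<in>T. \<bar>c x\<bar> = \<bar>c a\<bar>)"
      using U(1,2)[OF a] abs_c[OF a] by blast
  qed
  then obtain d where d: "\<And>p. p \<in> M \<Longrightarrow> \<bar>c p\<bar> = d" by (auto simp: constant_on_def)
  have "locally_oriented M (\<lambda>U N. jacobi_condition U N (- (d ^ 3)))"
    unfolding locally_oriented_def
  proof
    fix p assume p: "p \<in> M"
    obtain N' where "unit_normal (U p) N'" "jacobi_condition (U p) N' (- (\<bar>c p\<bar> ^ 3))"
      by (rule oriented_umbilical_exists[OF oh[OF U(1)[OF p] U(3)[OF p]] umb[OF p]])
    then show "\<exists>U N. openin (top_of_set M) U \<and> p \<in> U \<and> unit_normal U N \<and> jacobi_condition U N (- (d ^ 3))"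
      unfolding d[OF p] using U(1,2)[OF p] by blast
  qed
  then show ?thesis by (rule exI)
qed

lemma locally_oriented_mono:
  assumes "locally_oriented M Q"
    and imp: "\<And>U N. openin (top_of_set M) U \<Longrightarrow> unit_normal U N \<Longrightarrow> Q U N \<Longrightarrow> Q' U N"
  shows "locally_oriented M Q'"
  unfolding locally_oriented_def
proof
  fix p assume "p \<in> M"
  then have "\<exists>U N. openin (top_of_set M) U \<and> p \<in> U \<and> unit_normal U N \<and> Q U N"
    by (rule bspec[OF assms(1)[unfolded locally_oriented_def]])
  then obtain U N where U: "openin (top_of_set M) U" "p \<in> U" "unit_normal U N" "Q U N"
    by (elim exE conjE)
  show "\<exists>U N. openin (top_of_set M) U \<and> p \<in> U \<and> unit_normal U N \<and> Q' U N"
    by (rule exI[of _ U], rule exI[of _ N]) (intro conjI U imp)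
qed

theorem corollary7:
  fixes M :: "(complex^'m::finite^'m) set" and n :: nat
  assumes "CARD('m) = n + 1" and "n > 2" and "real_hypersurface n M"
  shows "((\<exists>k. locally_oriented M (\<lambda>U N. jacobi_condition U N k)) \<longleftrightarrow>
          (\<exists>k. locally_oriented M (\<lambda>U N. skew_jacobi_condition U N k))) \<and>
         ((\<exists>k. locally_oriented M (\<lambda>U N. skew_jacobi_condition U N k)) \<longleftrightarrow>
          locally_oriented M (\<lambda>U N. eta_umbilical U N))"
proof -
  note oh = real_hypersurface_oriented[OF assms]
  have ab: "locally_oriented M (\<lambda>U N. skew_jacobi_condition U N k)"
    if "locally_oriented M (\<lambda>U N. jacobi_condition U N k)" for k
    by (rule locally_oriented_mono[OF that]) (rule oriented_hypersurface.jacobi_imp_skew[OF oh])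
  have bc: "locally_oriented M (\<lambda>U N. eta_umbilical U N)"
    if "locally_oriented M (\<lambda>U N. skew_jacobi_condition U N k)" for k
    by (rule locally_oriented_mono[OF that]) (rule oriented_hypersurface.skew_imp_umbilical[OF oh])
  show ?thesis
  proof (intro conjI iffI)
    show "\<exists>k. locally_oriented M (\<lambda>U N. skew_jacobi_condition U N k)"
      if a: "\<exists>k. locally_oriented M (\<lambda>U N. jacobi_condition U N k)"
    proof -
      obtain k where "locally_oriented M (\<lambda>U N. jacobi_condition U N k)" using a by (rule exE)
      from ab[OF this] show ?thesis by (rule exI)
    qed
    note ab' = this
    show c: "locally_oriented M (\<lambda>U N. eta_umbilical U N)"
      if b: "\<exists>k. locally_oriented M (\<lambda>U N. skew_jacobi_condition U N k)"
    proof -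
      obtain k where "locally_oriented M (\<lambda>U N. skew_jacobi_condition U N k)" using b by (rule exE)
      then show ?thesis by (rule bc)
    qed
    show "\<exists>k. locally_oriented M (\<lambda>U N. jacobi_condition U N k)"
      if "\<exists>k. locally_oriented M (\<lambda>U N. skew_jacobi_condition U N k)"
      by (rule umbilical_imp_jacobi[OF assms c[OF that]])
    show "\<exists>k. locally_oriented M (\<lambda>U N. skew_jacobi_condition U N k)"
      if "locally_oriented M (\<lambda>U N. eta_umbilical U N)"
      by (rule ab'[OF umbilical_imp_jacobi[OF assms that]])
  qed
qed

end
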